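(* Let $A_Q=R/I_Q$ be an almost complete intersection algebra of codimension $3$ with $t_Q=3$. Let $$0 \to \bigoplus_{i=1}^{3}R(-(d-s_i)) \to \bigoplus_{1\le i<j\le 3}R(-(d_i+d_j))\oplus\bigoplus_{i=1}^{3}R(-s_i) \to R(-d^* )\oplus\bigoplus_{i=1}^{3}R(-d_i) \to R \to A_Q \to 0$$ be its graded minimal free resolution, with $d=d_1+d_2+d_3+d^*$, $d_1\le d_2\le d_3$, $s_1\le s_2\le s_3$. Then the graded Betti numbers of $I_Q$ can be realized by an artinian monomial ideal (i.e. there is a monomial ideal $J\subset R$ with $R/J$ artinian having the same graded Betti numbers as $I_Q$) if and only if $$d^*<s_i<d^*+d_i\quad\text{for } 1\le i\le 3.$$
   Context: $k$ is an infinite field and $R=k[x,y,z]$ is the standard graded polynomial ring; all ideals are homogeneous. An almost complete intersection algebra of codimension $3$ is a standard graded artinian algebra $A_Q=R/I_Q$ with $I_Q$ minimally generated by $4$ homogeneous elements. $t_Q$ is the rank of the last module in the graded minimal free resolution of $A_Q$. (It is known that when $t_Q=3$ the graded minimal free resolution always has the displayed form for suitable integers.) *)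

theory Defs
  imports "HOL-Library.Poly_Mapping" "Jordan_Normal_Form.Matrix_Kernel"
begin

section \<open>The standard graded polynomial ring in three indeterminates\<close>

datatype indet = Ind_x | Ind_y | Ind_z

text \<open>A monomial is a finitely supported exponent map. Convolution of finitely supported
  coefficient maps makes \<open>'k poly3\<close> the commutative ring \<open>k[x,y,z]\<close>.\<close>

type_synonym monom3 = "indet \<Rightarrow>\<^sub>0 nat"
type_synonym 'k poly3 = "monom3 \<Rightarrow>\<^sub>0 'k"

definition monomial :: "monom3 \<Rightarrow> 'k::field poly3" where
  "monomial t = Poly_Mapping.single t 1"

definition indeterminate :: "indet \<Rightarrow> 'k::field poly3" where
  "indeterminate v = monomial (Poly_Mapping.single v 1)"

definition mdeg :: "monom3 \<Rightarrow> nat" where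
  "mdeg t = (\<Sum>v\<in>Poly_Mapping.keys t. Poly_Mapping.lookup t v)"

text \<open>\<open>homogeneous n p\<close> says that \<open>p\<close> lies in the graded piece \<open>R\<^sub>n\<close>. Thus \<open>0\<close> is homogeneous of
  every degree, and it is the only element of negative degree.\<close>

definition homogeneous :: "int \<Rightarrow> 'k::field poly3 \<Rightarrow> bool" where
  "homogeneous n p \<longleftrightarrow> (\<forall>t\<in>Poly_Mapping.keys p. int (mdeg t) = n)"


section \<open>Ideals\<close>

text \<open>Ideals are the submodules of the ring regarded as a module over itself.\<close>

definition is_ideal :: "'a::comm_ring_1 set \<Rightarrow> bool" where
  "is_ideal I \<longleftrightarrow> module.subspace (*) I"

definition ideal_of :: "'a::comm_ring_1 set \<Rightarrow> 'a set" where
  "ideal_of G = module.span (*) G"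

definition irrelevant_ideal :: "'k::field poly3 set" where
  "irrelevant_ideal = ideal_of (range indeterminate)"

definition minimally_generates :: "'k::field poly3 set \<Rightarrow> 'k poly3 set \<Rightarrow> bool" where
  "minimally_generates G I \<longleftrightarrow>
     finite G \<and> (\<forall>g\<in>G. \<exists>n. homogeneous n g) \<and>
     ideal_of G = I \<and> (\<forall>H. H \<subset> G \<longrightarrow> ideal_of H \<noteq> I)"

definition monomial_ideal :: "'k::field poly3 set \<Rightarrow> bool" where
  "monomial_ideal J \<longleftrightarrow> (\<exists>T. J = ideal_of (monomial ` T))"

text \<open>The descending chain condition for the ideals of \<open>R/I\<close>, which correspond to the
  ideals of \<open>R\<close> containing \<open>I\<close>.\<close>

definition artinian_quotient :: "'a::comm_ring_1 set \<Rightarrow> bool" where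
  "artinian_quotient I \<longleftrightarrow>
     (\<forall>f :: nat \<Rightarrow> 'a set.
        (\<forall>n. is_ideal (f n) \<and> I \<subseteq> f n \<and> f (Suc n) \<subseteq> f n) \<longrightarrow>
        (\<exists>m. \<forall>n\<ge>m. f n = f m))"

definition almost_complete_intersection3 :: "'k::field poly3 set \<Rightarrow> bool" where
  "almost_complete_intersection3 I \<longleftrightarrow>
     artinian_quotient I \<and> (\<exists>G. minimally_generates G I \<and> card G = 4)"


section \<open>Minimal graded free resolutions\<close>

text \<open>A list \<open>a = [a\<^sub>0, \<dots>, a\<^sub>n]\<close> of integers stands for the graded free module
  \<open>R(-a\<^sub>0) \<oplus> \<dots> \<oplus> R(-a\<^sub>n)\<close>, whose elements are the vectors in \<open>carrier_vec (length a)\<close>.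
  A homomorphism of degree \<open>0\<close> from the module of \<open>b\<close> to the module of \<open>a\<close> is a matrix whose
  \<open>(i,j)\<close> entry is homogeneous of degree \<open>b\<^sub>j - a\<^sub>i\<close>.\<close>

definition graded_map :: "int list \<Rightarrow> int list \<Rightarrow> 'k::field poly3 mat \<Rightarrow> bool" where
  "graded_map b a M \<longleftrightarrow>
     M \<in> carrier_mat (length a) (length b) \<and>
     (\<forall>i<length a. \<forall>j<length b. homogeneous (b ! j - a ! i) (M $$ (i, j)))"

definition mat_image :: "'a::comm_ring_1 mat \<Rightarrow> 'a vec set" where
  "mat_image M = {M *\<^sub>v v | v. v \<in> carrier_vec (dim_col M)}"

text \<open>\<open>graded_free_resolution I as Ms\<close>: with \<open>F\<^sub>i\<close> the module of \<open>as ! i\<close>, the matrices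
  \<open>Ms ! i : F\<^bsub>i+1\<^esub> \<rightarrow> F\<^sub>i\<close> form an exact sequence
  \<open>0 \<rightarrow> F\<^sub>n \<rightarrow> \<dots> \<rightarrow> F\<^sub>1 \<rightarrow> F\<^sub>0 = R \<rightarrow> R/I \<rightarrow> 0\<close> with all \<open>F\<^sub>i\<close> nonzero. The cycles at \<open>F\<^sub>0\<close> are
  the kernel of the projection \<open>R \<rightarrow> R/I\<close>, and the boundaries at \<open>F\<^sub>n\<close> are \<open>0\<close>.\<close>

definition cycles_at :: "'k::field poly3 set \<Rightarrow> 'k poly3 mat list \<Rightarrow> nat \<Rightarrow> 'k poly3 vec set" where
  "cycles_at I Ms i =
     (if i = 0 then {v \<in> carrier_vec 1. v $ 0 \<in> I} else mat_kernel (Ms ! (i - 1)))"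

definition boundaries_at ::
  "int list list \<Rightarrow> 'k::field poly3 mat list \<Rightarrow> nat \<Rightarrow> 'k poly3 vec set" where
  "boundaries_at as Ms i =
     (if i < length Ms then mat_image (Ms ! i) else {0\<^sub>v (length (as ! i))})"

definition graded_free_resolution ::
  "'k::field poly3 set \<Rightarrow> int list list \<Rightarrow> 'k poly3 mat list \<Rightarrow> bool" where
  "graded_free_resolution I as Ms \<longleftrightarrow>
     length as = Suc (length Ms) \<and> as ! 0 = [0] \<and> [] \<notin> set as \<and>
     (\<forall>i<length Ms. graded_map (as ! Suc i) (as ! i) (Ms ! i)) \<and>
     (\<forall>i<length as. cycles_at I Ms i = boundaries_at as Ms i)"

definition minimal_graded_free_resolution ::
  "'k::field poly3 set \<Rightarrow> int list list \<Rightarrow> 'k poly3 mat list \<Rightarrow> bool" where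
  "minimal_graded_free_resolution I as Ms \<longleftrightarrow>
     graded_free_resolution I as Ms \<and>
     (\<forall>M\<in>set Ms. elements_mat M \<subseteq> irrelevant_ideal)"

text \<open>Numbers read off a minimal graded free resolution are stated as relations. A proper
  homogeneous ideal has such a resolution, unique up to isomorphism, so each relation determines
  its second argument; \<open>I = R\<close> has none of the form above (there \<open>F\<^sub>0 = R\<close> is not minimal), so
  neither relation holds.\<close>

definition has_graded_betti_numbers :: "'k::field poly3 set \<Rightarrow> (nat \<Rightarrow> int \<Rightarrow> nat) \<Rightarrow> bool" where
  "has_graded_betti_numbers I \<beta> \<longleftrightarrow>
     (\<exists>as Ms. minimal_graded_free_resolution I as Ms \<and>
        (\<forall>i j. \<beta> i j = (if i < length as then count_list (as ! i) j else 0)))"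

definition has_last_rank :: "'k::field poly3 set \<Rightarrow> nat \<Rightarrow> bool" where
  "has_last_rank I t \<longleftrightarrow>
     (\<exists>as Ms. minimal_graded_free_resolution I as Ms \<and> length (last as) = t)"

definition same_graded_betti_numbers :: "'k::field poly3 set \<Rightarrow> 'k poly3 set \<Rightarrow> bool" where
  "same_graded_betti_numbers I J \<longleftrightarrow>
     (\<exists>\<beta>. has_graded_betti_numbers I \<beta> \<and> has_graded_betti_numbers J \<beta>)"

end

theory Submission
  imports Defs "HOL-Library.Function_Algebras"
begin

text \<open>
  Write \<open>e\<^sub>i = s\<^sub>i - d\<^sup>*\<close>. Comparing Hilbert functions of the given resolution in two consecutive
  large degrees, where \<open>R/I\<close> vanishes, gives \<open>e\<^sub>1 + e\<^sub>2 + e\<^sub>3 = d\<^sub>1 + d\<^sub>2 + d\<^sub>3 - d\<^sup>*\<close>. If \<open>0 < e\<^sub>i < d\<^sub>i\<close>, the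
  ideal generated by \<open>x\<^bsup>d\<^sub>1\<^esup>, y\<^bsup>d\<^sub>2\<^esup>, z\<^bsup>d\<^sub>3\<^esup>\<close> and a monomial with exponents \<open>d\<^sub>i - e\<^sub>i\<close> therefore has the
  required Betti numbers: its minimal resolution is an explicit mapping cone of Koszul complexes.

  Conversely, an artinian monomial ideal with four minimal generators is generated by three pure
  powers and one further monomial, so it is resolved by the same mapping cone. Betti numbers are
  unique (two minimal resolutions are homotopy equivalent, and homotopies vanish modulo the
  irrelevant ideal), so the cone is minimal, hence all exponents involved are positive, and its
  shifts agree with the given ones as multisets. The last two modules force the degrees of the pure
  powers to be \<open>d\<^sub>1, d\<^sub>2, d\<^sub>3\<close> and the degree of the fourth monomial to be \<open>d\<^sup>*\<close>; sorting gives the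
  inequalities.
\<close>


section \<open>Monomials, coefficients and ideals\<close>

text \<open>The cone rests on a colon ideal: modulo \<open>(x^(a+e), y^(b+f), z^(c+g))\<close>, the
  annihilator of \<open>x^a y^b z^c\<close> is \<open>(x^e, y^f, z^g)\<close>. Multiplication by
  \<open>x^a y^b z^c\<close> lifts to the Koszul complexes as that product in degree 0, products of
  two of \<open>x^a, y^b, z^c\<close> in degree 1, a single one in degree 2, and 1 in degree 3. This
  1 makes one copy of \<open>R\<close> cancel, whatever the exponents, so that three summands remain
  at the end. The bounds \<open>0 < e_i < d_i\<close> say exactly that none of the six monomials
  \<open>x^a, y^b, z^c, x^e, y^f, z^g\<close> is 1, and the sum relation gives
  \<open>x^a y^b z^c\<close> the degree \<open>d*\<close>. The obstacle in the converse is that a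
  given monomial ideal is first brought into this shape only with possibly vanishing exponents, so
  its cone is a resolution not known to be minimal. Comparison is therefore set up between a minimal
  and an arbitrary resolution: ranks agreeing with a minimal resolution force minimality, and
  positivity of the exponents is read off from that.\<close>

abbreviation coef :: "('a \<Rightarrow>\<^sub>0 'b::zero) \<Rightarrow> 'a \<Rightarrow> 'b" where
  "coef \<equiv> Poly_Mapping.lookup"

abbreviation supp :: "('a \<Rightarrow>\<^sub>0 'b::zero) \<Rightarrow> 'a set" where
  "supp \<equiv> Poly_Mapping.keys"

definition adds :: "monom3 \<Rightarrow> monom3 \<Rightarrow> bool" where
  "adds s t \<longleftrightarrow> (\<exists>u. t = s + u)"

lemma adds_iff: "adds s t \<longleftrightarrow> (\<forall>v. coef s v \<le> coef t v)"
proof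
  assume "\<forall>v. coef s v \<le> coef t v"
  then have "t = s + (t - s)"
    by (intro poly_mapping_eqI) (simp add: lookup_add lookup_minus)
  then show "adds s t" unfolding adds_def by blast
qed (auto simp: adds_def lookup_add)

lemma adds_refl [simp]: "adds t t"
  by (simp add: adds_iff)

lemma adds_add [simp]: "adds s (s + t)"
  by (simp add: adds_iff lookup_add)

lemma adds_trans: "adds s t \<Longrightarrow> adds t u \<Longrightarrow> adds s u"
  by (meson adds_iff le_trans)

lemma all_indet: "(\<forall>v. P v) \<longleftrightarrow> P Ind_x \<and> P Ind_y \<and> P Ind_z"
  by (metis indet.exhaust)

lemma mdeg_expand: "mdeg t = coef t Ind_x + coef t Ind_y + coef t Ind_z"
proof -
  have "mdeg t = (\<Sum>v\<in>{Ind_x, Ind_y, Ind_z}. coef t v)"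
    unfolding mdeg_def by (rule sum.mono_neutral_left) (auto simp: in_keys_iff intro: indet.exhaust)
  then show ?thesis by simp
qed

lemma mdeg_add: "mdeg (s + t) = mdeg s + mdeg t"
  by (simp add: mdeg_expand lookup_add)

lemma mdeg_zero [simp]: "mdeg 0 = 0"
  by (simp add: mdeg_expand)

lemma mdeg_eq_0_iff [simp]: "mdeg t = 0 \<longleftrightarrow> t = 0"
  by (auto simp: mdeg_expand poly_mapping_eq_iff fun_eq_iff all_indet)

definition mono3 :: "nat \<Rightarrow> nat \<Rightarrow> nat \<Rightarrow> monom3" where
  "mono3 a b c = Poly_Mapping.single Ind_x a + Poly_Mapping.single Ind_y b + Poly_Mapping.single Ind_z c"

lemma coef_mono3 [simp]:
  "coef (mono3 a b c) Ind_x = a" "coef (mono3 a b c) Ind_y = b" "coef (mono3 a b c) Ind_z = c"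
  by (simp_all add: mono3_def lookup_add lookup_single)

lemma mono3_eqI: "coef t Ind_x = a \<Longrightarrow> coef t Ind_y = b \<Longrightarrow> coef t Ind_z = c \<Longrightarrow> t = mono3 a b c"
  by (auto simp: poly_mapping_eq_iff fun_eq_iff all_indet)

lemma mono3_coef: "mono3 (coef t Ind_x) (coef t Ind_y) (coef t Ind_z) = t"
  by (metis mono3_eqI)

lemma mono3_add: "mono3 a b c + mono3 a' b' c' = mono3 (a + a') (b + b') (c + c')"
  by (rule mono3_eqI) (simp_all add: lookup_add)

lemma mono3_inject [simp]: "mono3 a b c = mono3 a' b' c' \<longleftrightarrow> a = a' \<and> b = b' \<and> c = c'"
  by (metis coef_mono3)

lemma mono3_zero [simp]: "mono3 0 0 0 = 0"
  by (simp add: mono3_def)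

lemma mono3_eq_0_iff [simp]: "mono3 a b c = 0 \<longleftrightarrow> a = 0 \<and> b = 0 \<and> c = 0"
  using mono3_inject[of a b c 0 0 0] by (simp del: mono3_inject)

lemma mdeg_mono3 [simp]: "mdeg (mono3 a b c) = a + b + c"
  by (simp add: mdeg_expand)

lemma adds_mono3_iff: "adds (mono3 a b c) t \<longleftrightarrow> a \<le> coef t Ind_x \<and> b \<le> coef t Ind_y \<and> c \<le> coef t Ind_z"
  by (simp add: adds_iff all_indet)

text \<open>The hypothesis leaves \<open>q = w\<close>, hence \<open>l = 0\<close>, as the only
  contribution to the convolution. It serves for constant terms and for coefficients at minimal
  monomials of an ideal.\<close>

lemma coef_times_eq:
  fixes f g :: "'k::field poly3"
  assumes "\<And>l q. w = l + q \<Longrightarrow> q \<in> supp f \<Longrightarrow> q = w"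
  shows "coef (g * f) w = coef g 0 * coef f w"
proof -
  have "Sum_any (\<lambda>q. coef f q when w = l + q) = (coef f w when l = 0)" for l
  proof -
    have "(coef f q when w = l + q) = ((coef f w when l = 0) when w = q)" for q
    proof (cases "w = l + q \<and> q \<in> supp f")
      case True
      with assms[of l q] have "q = w" by blast
      with True show ?thesis by simp
    qed (auto simp: in_keys_iff when_def)
    then show ?thesis by simp
  qed
  then have "coef (g * f) w = Sum_any (\<lambda>l. coef g l * (coef f w when l = 0))"
    by (simp add: lookup_mult)
  also have "\<dots> = Sum_any (\<lambda>l::monom3. (coef g 0 * coef f w when 0 = l))"
    by (rule Sum_any.cong) (auto simp: when_def)
  finally show ?thesis by simp
qed

lemma add_eq_0_monom: "(s::monom3) + t = 0 \<longleftrightarrow> s = 0 \<and> t = 0"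
  by (metis add_is_0 mdeg_add mdeg_eq_0_iff)

lemma coef_times_zero: "coef (g * f) 0 = coef g 0 * coef f (0::monom3)" for f g :: "'k::field poly3"
  by (rule coef_times_eq) (metis add_eq_0_monom)

lemma coef_monomial_times_add [simp]: "coef (monomial s * f) (s + t) = coef f t"
  for f :: "'k::field poly3"
proof -
  have "coef (monomial s * f) (s + t) = Sum_any (\<lambda>l. Sum_any (\<lambda>q. coef f q when t = q) when s = l)"
    unfolding lookup_mult monomial_def
    by (intro Sum_any.cong) (auto simp: lookup_single when_def)
  then show ?thesis by simp
qed

lemma coef_monomial_times_not_adds: "\<not> adds s u \<Longrightarrow> coef (monomial s * f) u = 0"
  for f :: "'k::field poly3"
proof -
  assume "\<not> adds s u"
  then have "coef (monomial s * f) u = Sum_any (\<lambda>l::monom3. 0)"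
    unfolding lookup_mult monomial_def
    by (intro Sum_any.cong) (auto simp: lookup_single when_def adds_def)
  then show ?thesis by simp
qed

lemma monomial_times_eq_0 [simp]: "monomial s * f = 0 \<longleftrightarrow> f = 0" for f :: "'k::field poly3"
  by (metis coef_monomial_times_add lookup_zero mult_zero_right poly_mapping_eqI)

lemma monomial_mult: "monomial s * monomial t = (monomial (s + t) :: 'k::field poly3)"
  by (simp add: monomial_def mult_single)

lemma monomial_zero [simp]: "monomial 0 = (1 :: 'k::field poly3)"
  by (simp add: monomial_def)

lemma coef_monomial: "coef (monomial s :: 'k::field poly3) t = (if s = t then 1 else 0)"
  by (simp add: monomial_def lookup_single when_def)

lemma supp_monomial [simp]: "supp (monomial s :: 'k::field poly3) = {s}"
  by (simp add: monomial_def)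

text \<open>The quotient is \<open>f\<close> pulled back along the injective translation by
  \<open>s\<close>; no coefficient is lost because \<open>s\<close> divides every monomial of
  \<open>f\<close>.\<close>

lemma monomial_times_exists:
  fixes f :: "'k::field poly3"
  assumes "\<And>t. t \<in> supp f \<Longrightarrow> adds s t"
  obtains g where "f = monomial s * g" and "\<And>t. t \<in> supp g \<Longrightarrow> s + t \<in> supp f"
proof
  have inj: "inj (\<lambda>t::monom3. s + t)" by (simp add: inj_def)
  let ?g = "Poly_Mapping.map_key (\<lambda>t. s + t) f"
  have g: "coef ?g t = coef f (s + t)" for t
    by (simp add: map_key.rep_eq[OF inj])
  show "f = monomial s * ?g"
  proof (rule poly_mapping_eqI)
    fix u
    show "coef f u = coef (monomial s * ?g) u"
    proof (cases "adds s u")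
      case True
      then show ?thesis unfolding adds_def using g by auto
    next
      case False
      then have "u \<notin> supp f" using assms by blast
      then show ?thesis using False by (simp add: coef_monomial_times_not_adds in_keys_iff)
    qed
  qed
  show "\<And>t. t \<in> supp ?g \<Longrightarrow> s + t \<in> supp f" by (simp add: in_keys_iff g)
qed

text \<open>Projection onto the span of the monomials in \<open>S\<close>. Homogeneous components,
  division by a monomial and reduction to standard monomials are all instances.\<close>

definition part :: "monom3 set \<Rightarrow> 'k::field poly3 \<Rightarrow> 'k poly3" where
  "part S f = Poly_Mapping.mapp (\<lambda>t c. c when t \<in> S) f"

lemma coef_part: "coef (part S f) t = (coef f t when t \<in> S)"
  by (auto simp: part_def lookup_mapp when_def in_keys_iff)

lemma supp_part: "supp (part S f) = supp f \<inter> S"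
  by (auto simp: in_keys_iff coef_part)

lemma part_split: "f = part S f + part (- S) f"
  by (rule poly_mapping_eqI) (simp add: lookup_add coef_part when_def)

lemma part_add: "part S (f + g) = part S f + part S g"
  by (rule poly_mapping_eqI) (simp add: lookup_add coef_part when_def)

lemma part_zero [simp]: "part S 0 = 0"
  by (rule poly_mapping_eqI) (simp add: coef_part)

lemma part_sum: "part S (\<Sum>i\<in>A. f i) = (\<Sum>i\<in>A. part S (f i))"
  by (induction A rule: infinite_finite_induct) (simp_all add: part_add)

lemma part_eq_self_iff: "part S f = f \<longleftrightarrow> supp f \<subseteq> S"
proof
  assume "supp f \<subseteq> S"
  then show "part S f = f"
    by (intro poly_mapping_eqI) (auto simp: coef_part when_def in_keys_iff)
qed (metis supp_part inf.absorb_iff1)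

lemma part_eq_0_iff: "part S f = 0 \<longleftrightarrow> supp f \<inter> S = {}"
  by (metis supp_part keys_eq_empty)

section \<open>Homogeneous components\<close>

definition hcomp :: "int \<Rightarrow> 'k::field poly3 \<Rightarrow> 'k poly3" where
  "hcomp n f = part {t. int (mdeg t) = n} f"

lemma homogeneous_iff_hcomp: "homogeneous n f \<longleftrightarrow> hcomp n f = f"
  by (auto simp: homogeneous_def hcomp_def part_eq_self_iff)

lemma homogeneous_hcomp [simp]: "homogeneous n (hcomp n f)"
  by (simp add: homogeneous_def hcomp_def supp_part)

lemma homogeneous_zero [simp]: "homogeneous n 0"
  by (simp add: homogeneous_def)

lemma homogeneous_add: "homogeneous n f \<Longrightarrow> homogeneous n g \<Longrightarrow> homogeneous n (f + g)"
  by (simp add: homogeneous_iff_hcomp hcomp_def part_add)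

lemma homogeneous_uminus: "homogeneous n f \<Longrightarrow> homogeneous n (- f)"
  by (simp add: homogeneous_def)

lemma homogeneous_sum: "(\<And>i. i \<in> A \<Longrightarrow> homogeneous n (f i)) \<Longrightarrow> homogeneous n (\<Sum>i\<in>A. f i)"
  by (simp add: homogeneous_iff_hcomp hcomp_def part_sum)

lemma homogeneous_monomial: "n = int (mdeg t) \<Longrightarrow> homogeneous n (monomial t)"
  by (simp add: homogeneous_def)

text \<open>Only terms of \<open>g\<close> of degree \<open>d\<close> enter the convolution, so
  selecting degree \<open>n\<close> in the product selects degree \<open>n - d\<close> in
  \<open>f\<close>. Hence an ungraded solution of a graded linear equation can be replaced by its
  homogeneous components.\<close>

lemma hcomp_times:
  assumes "homogeneous d g"
  shows "hcomp n (g * f) = g * hcomp (n - d) f"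
proof (rule poly_mapping_eqI)
  fix t
  have *: "(coef g l * Sum_any (\<lambda>q. coef f q when t = l + q) when int (mdeg t) = n)
    = coef g l * Sum_any (\<lambda>q. coef (hcomp (n - d) f) q when t = l + q)" for l
  proof (cases "coef g l = 0")
    case False
    then have "int (mdeg l) = d" using assms by (auto simp: homogeneous_def in_keys_iff)
    then have "(coef (hcomp (n - d) f) q when t = l + q)
      = (coef f q when t = l + q \<and> int (mdeg t) = n)" for q
      by (auto simp: hcomp_def coef_part when_def mdeg_add)
    then show ?thesis by (simp add: when_def)
  qed simp
  have "coef (hcomp n (g * f)) t
    = Sum_any (\<lambda>l. coef g l * Sum_any (\<lambda>q. coef f q when t = l + q) when int (mdeg t) = n)"
    by (simp add: hcomp_def coef_part lookup_mult when_def)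
  then show "coef (hcomp n (g * f)) t = coef (g * hcomp (n - d) f) t"
    by (simp only: * lookup_mult)
qed

lemma homogeneous_times:
  assumes "homogeneous d f" "homogeneous e g"
  shows "homogeneous (d + e) (f * g)"
  using hcomp_times[OF assms(1), of "d + e" g] assms(2) by (simp add: homogeneous_iff_hcomp)

section \<open>Ideals and monomial ideals\<close>

lemma module_times: "Modules.module ((*) :: 'a::comm_ring_1 \<Rightarrow> 'a \<Rightarrow> 'a)"
  by unfold_locales (simp_all add: algebra_simps)

lemma is_ideal_ideal_of [simp]: "is_ideal (ideal_of G)"
  by (simp add: is_ideal_def ideal_of_def Modules.module.subspace_span[OF module_times])

lemma ideal_of_base: "g \<in> G \<Longrightarrow> g \<in> ideal_of G"
  by (simp add: ideal_of_def Modules.module.span_base[OF module_times])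

lemma is_ideal_zero: "is_ideal I \<Longrightarrow> 0 \<in> I"
  by (simp add: is_ideal_def Modules.module.subspace_0[OF module_times])

lemma is_ideal_add: "is_ideal I \<Longrightarrow> f \<in> I \<Longrightarrow> g \<in> I \<Longrightarrow> f + g \<in> I"
  by (simp add: is_ideal_def Modules.module.subspace_add[OF module_times])

lemma is_ideal_diff: "is_ideal I \<Longrightarrow> f \<in> I \<Longrightarrow> g \<in> I \<Longrightarrow> f - g \<in> I"
  by (simp add: is_ideal_def Modules.module.subspace_diff[OF module_times])

lemma is_ideal_times: "is_ideal I \<Longrightarrow> f \<in> I \<Longrightarrow> g * f \<in> I"
  by (simp add: is_ideal_def Modules.module.subspace_scale[OF module_times])

lemma is_ideal_sum: "is_ideal I \<Longrightarrow> (\<And>i. i \<in> A \<Longrightarrow> f i \<in> I) \<Longrightarrow> (\<Sum>i\<in>A. f i) \<in> I"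
  by (simp add: is_ideal_def Modules.module.subspace_sum[OF module_times])

lemma ideal_of_least: "is_ideal I \<Longrightarrow> G \<subseteq> I \<Longrightarrow> ideal_of G \<subseteq> I"
  by (simp add: is_ideal_def ideal_of_def Modules.module.span_minimal[OF module_times])

lemma is_idealI:
  "0 \<in> I \<Longrightarrow> (\<And>f g. f \<in> I \<Longrightarrow> g \<in> I \<Longrightarrow> f + g \<in> I) \<Longrightarrow> (\<And>g f. f \<in> I \<Longrightarrow> g * f \<in> I) \<Longrightarrow> is_ideal I"
  by (simp add: is_ideal_def Modules.module.subspace_def[OF module_times])

lemma ideal_of_insert: "f \<in> ideal_of (insert g G) \<longleftrightarrow> (\<exists>h. f - h * g \<in> ideal_of G)"
  by (simp add: ideal_of_def Modules.module.span_breakdown_eq[OF module_times])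

lemma ideal_of_empty: "f \<in> ideal_of {} \<longleftrightarrow> f = 0"
  by (simp add: ideal_of_def Modules.module.span_empty[OF module_times])

lemma poly_mapping_sum_single: "f = (\<Sum>t\<in>supp f. Poly_Mapping.single t (coef f t))"
proof (rule poly_mapping_eqI)
  fix k
  have "(\<Sum>t\<in>supp f. coef (Poly_Mapping.single t (coef f t)) k)
    = (\<Sum>t\<in>supp f. if t = k then coef f k else 0)"
    by (intro sum.cong) (auto simp: lookup_single when_def)
  then show "coef f k = coef (\<Sum>t\<in>supp f. Poly_Mapping.single t (coef f t)) k"
    by (auto simp: lookup_sum in_keys_iff)
qed

lemma mem_if_monomials_mem:
  fixes f :: "'k::field poly3"
  assumes "is_ideal I" "\<And>t. t \<in> supp f \<Longrightarrow> monomial t \<in> I"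
  shows "f \<in> I"
proof -
  have "Poly_Mapping.single t (coef f t) \<in> I" if "t \<in> supp f" for t
  proof -
    have "Poly_Mapping.single t (coef f t) = Poly_Mapping.single 0 (coef f t) * monomial t"
      by (simp add: monomial_def mult_single)
    then show ?thesis using assms that by (simp add: is_ideal_times)
  qed
  then have "(\<Sum>t\<in>supp f. Poly_Mapping.single t (coef f t)) \<in> I"
    by (intro is_ideal_sum assms)
  then show ?thesis by (metis poly_mapping_sum_single)
qed

lemma monomial_mem_if_adds: "is_ideal I \<Longrightarrow> monomial s \<in> I \<Longrightarrow> adds s t \<Longrightarrow> (monomial t :: 'k::field poly3) \<in> I"
  by (auto simp: adds_def monomial_mult[symmetric] mult.commute[of "monomial s"] intro: is_ideal_times)

text \<open>The right-hand side describes an ideal containing the generators, and each of its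
  members is a sum of scalar multiples of monomials that lie in the span. Membership in a monomial
  ideal thus becomes a question about supports.\<close>

lemma ideal_of_monomials:
  "(f :: 'k::field poly3) \<in> ideal_of (monomial ` T) \<longleftrightarrow> (\<forall>t\<in>supp f. \<exists>s\<in>T. adds s t)"
proof
  have "is_ideal {f :: 'k poly3. \<forall>t\<in>supp f. \<exists>s\<in>T. adds s t}"
  proof (rule is_idealI; clarsimp)
    fix f g :: "'k poly3" and t
    assume *: "\<forall>t\<in>supp f. \<exists>s\<in>T. adds s t" "\<forall>t\<in>supp g. \<exists>s\<in>T. adds s t" "t \<in> supp (f + g)"
    then have "t \<in> supp f \<union> supp g" using keys_add[of f g] by blast
    with * show "\<exists>s\<in>T. adds s t" by blast
  next
    fix f g :: "'k poly3" and t
    assume *: "\<forall>t\<in>supp f. \<exists>s\<in>T. adds s t" "t \<in> supp (g * f)"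
    then obtain a b where "b \<in> supp f" "t = a + b"
      using keys_mult[of g f] by blast
    then have ab: "b \<in> supp f" "t = b + a" by (simp_all add: add.commute)
    with * obtain s where "s \<in> T" "adds s b" by blast
    then show "\<exists>s\<in>T. adds s t" using ab adds_add adds_trans by blast
  qed
  moreover have "monomial ` T \<subseteq> {f :: 'k poly3. \<forall>t\<in>supp f. \<exists>s\<in>T. adds s t}"
    by (force intro: adds_refl)
  ultimately have "ideal_of (monomial ` T) \<subseteq> {f :: 'k poly3. \<forall>t\<in>supp f. \<exists>s\<in>T. adds s t}"
    by (rule ideal_of_least)
  then show "f \<in> ideal_of (monomial ` T) \<Longrightarrow> \<forall>t\<in>supp f. \<exists>s\<in>T. adds s t" by blast
next
  assume *: "\<forall>t\<in>supp f. \<exists>s\<in>T. adds s t"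
  show "f \<in> ideal_of (monomial ` T)"
  proof (rule mem_if_monomials_mem)
    fix t
    assume "t \<in> supp f"
    with * obtain s where "s \<in> T" "adds s t" by blast
    then show "(monomial t :: 'k poly3) \<in> ideal_of (monomial ` T)"
      by (metis ideal_of_base imageI is_ideal_ideal_of monomial_mem_if_adds)
  qed simp
qed

text \<open>The irrelevant ideal is itself a monomial ideal, and 1 is the only monomial divisible by
  no indeterminate. Minimality of a resolution becomes vanishing of constant terms.\<close>

lemma irrelevant_ideal_iff: "f \<in> irrelevant_ideal \<longleftrightarrow> coef f 0 = (0 :: 'k::field)"
proof -
  have "range indeterminate = (monomial :: _ \<Rightarrow> 'k poly3) ` range (\<lambda>v. Poly_Mapping.single v 1)"
    by (auto simp: indeterminate_def)
  then have "f \<in> irrelevant_ideal \<longleftrightarrow> (\<forall>t\<in>supp f. \<exists>v. adds (Poly_Mapping.single v 1) t)"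
    by (simp add: irrelevant_ideal_def ideal_of_monomials)
  also have "\<dots> \<longleftrightarrow> (\<forall>t\<in>supp f. t \<noteq> 0)"
  proof -
    have "(\<exists>v. adds (Poly_Mapping.single v 1) t) \<longleftrightarrow> (\<exists>v. 1 \<le> coef t v)" for t :: monom3
      by (auto simp: adds_iff lookup_single when_def)
    also have "(\<exists>v. 1 \<le> coef t v) \<longleftrightarrow> t \<noteq> 0" for t :: monom3
      by (metis One_nat_def Suc_leI gr0I lookup_zero not_one_le_zero poly_mapping_eqI)
    finally show ?thesis by blast
  qed
  finally show ?thesis by (auto simp: in_keys_iff)
qed


section \<open>Comparison of minimal resolutions\<close>

text \<open>If \<open>T\<close> were smaller, padding both factors by zeros to square matrices would
  give a one-sided, hence two-sided, inverse; but the product in the other order has a zero row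
  coming from the padding.\<close>

lemma card_le_if_factor_identity:
  fixes A :: "'a \<Rightarrow> 'b \<Rightarrow> 'k::field" and B :: "'b \<Rightarrow> 'a \<Rightarrow> 'k"
  assumes "finite S" "finite T"
    and AB: "\<And>i j. i \<in> S \<Longrightarrow> j \<in> S \<Longrightarrow> (\<Sum>k\<in>T. A i k * B k j) = (if i = j then 1 else 0)"
  shows "card S \<le> card T"
proof (rule ccontr)
  define n m where "n = card S" and "m = card T"
  assume "\<not> card S \<le> card T"
  then have mn: "m < n" by (simp add: n_def m_def)
  obtain f g where f: "bij_betw f {0..<n} S" and g: "bij_betw g {0..<m} T"
    using ex_bij_betw_nat_finite assms(1,2) unfolding n_def m_def by metis
  define A' where "A' = mat n n (\<lambda>(i, j). if j < m then A (f i) (g j) else 0)"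
  define B' where "B' = mat n n (\<lambda>(i, j). if i < m then B (g i) (f j) else 0)"
  have carr: "A' \<in> carrier_mat n n" "B' \<in> carrier_mat n n" by (simp_all add: A'_def B'_def)
  have "A' * B' = 1\<^sub>m n"
  proof (rule eq_matI)
    fix i j
    assume ij: "i < dim_row (1\<^sub>m n :: 'k mat)" "j < dim_col (1\<^sub>m n :: 'k mat)"
    then have fS: "f i \<in> S" "f j \<in> S" and feq: "f i = f j \<longleftrightarrow> i = j"
      using f by (auto simp: bij_betw_def inj_on_def)
    have "(A' * B') $$ (i, j) = (\<Sum>k\<in>{0..<n}. if k < m then A (f i) (g k) * B (g k) (f j) else 0)"
      using ij by (simp add: A'_def B'_def scalar_prod_def if_distrib cong: if_cong)
    also have "\<dots> = (\<Sum>k\<in>{0..<m}. A (f i) (g k) * B (g k) (f j))"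
      using mn by (intro sum.mono_neutral_cong_right) auto
    also have "\<dots> = (\<Sum>k\<in>T. A (f i) k * B k (f j))"
      using sum.reindex_bij_betw[OF g, of "\<lambda>k. A (f i) k * B k (f j)"] .
    also have "\<dots> = (1\<^sub>m n) $$ (i, j)"
      using AB[OF fS] ij by (simp add: feq)
    finally show "(A' * B') $$ (i, j) = (1\<^sub>m n) $$ (i, j)" .
  qed (simp_all add: A'_def B'_def)
  then have "B' * A' = 1\<^sub>m n" using carr mat_mult_left_right_inverse by blast
  moreover have "(B' * A') $$ (m, m) = 0"
    using mn by (simp add: A'_def B'_def scalar_prod_def)
  ultimately show False using mn by simp
qed

lemma count_list_conv_card: "count_list xs d = card {i. i < length xs \<and> xs ! i = d}"
  by (simp add: count_list_eq_length_filter length_filter_conv_card eq_commute)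

text \<open>By \<open>deg\<close>, a column of \<open>P\<close> belonging to degree \<open>d\<close>
  meets only rows of degree \<open>d\<close>. The degree \<open>d\<close> block of the identity
  therefore factors through the degree \<open>d\<close> part of \<open>b\<close>.\<close>

lemma count_list_le_if_graded_factor_identity:
  fixes P Q :: "'k::field mat"
  assumes P: "P \<in> carrier_mat (length b) (length a)" and Q: "Q \<in> carrier_mat (length a) (length b)"
    and QP: "Q * P = 1\<^sub>m (length a)"
    and deg: "\<And>k j. k < length b \<Longrightarrow> j < length a \<Longrightarrow> P $$ (k, j) \<noteq> 0 \<Longrightarrow> b ! k = a ! j"
  shows "count_list a d \<le> count_list b d"
  unfolding count_list_conv_card
proof (rule card_le_if_factor_identity)
  fix i j
  assume i: "i \<in> {i. i < length a \<and> a ! i = d}" and j: "j \<in> {i. i < length a \<and> a ! i = d}"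
  have "(\<Sum>k\<in>{k. k < length b \<and> b ! k = d}. Q $$ (i, k) * P $$ (k, j))
    = (\<Sum>k\<in>{0..<length b}. Q $$ (i, k) * P $$ (k, j))"
    using j deg by (intro sum.mono_neutral_left) auto
  also have "\<dots> = (Q * P) $$ (i, j)"
    using i j P Q by (simp add: scalar_prod_def)
  finally show "(\<Sum>k\<in>{k. k < length b \<and> b ! k = d}. Q $$ (i, k) * P $$ (k, j)) = (if i = j then 1 else 0)"
    using i j by (simp add: QP)
qed simp_all

section \<open>Graded maps and lifting\<close>

lemma graded_mapD:
  assumes "graded_map b a M"
  shows "M \<in> carrier_mat (length a) (length b)"
    and "i < length a \<Longrightarrow> j < length b \<Longrightarrow> homogeneous (b ! j - a ! i) (M $$ (i, j))"
  using assms by (auto simp: graded_map_def)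

lemma graded_map_one: "graded_map a a (1\<^sub>m (length a))"
proof -
  have "homogeneous 0 (1 :: 'a poly3)" using homogeneous_monomial[of 0 0] by simp
  then show ?thesis by (auto simp: graded_map_def)
qed

lemma graded_map_mult:
  assumes M: "graded_map b a M" and N: "graded_map c b N"
  shows "graded_map c a (M * N)"
  unfolding graded_map_def
proof (intro conjI allI impI)
  note carr = graded_mapD(1)[OF M] graded_mapD(1)[OF N]
  show "M * N \<in> carrier_mat (length a) (length c)" using carr by simp
  fix i j
  assume ij: "i < length a" "j < length c"
  have "homogeneous (c ! j - a ! i) (M $$ (i, k) * N $$ (k, j))" if "k < length b" for k
    using homogeneous_times[OF graded_mapD(2)[OF M ij(1) that] graded_mapD(2)[OF N that ij(2)]]
    by (simp add: algebra_simps)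
  then show "homogeneous (c ! j - a ! i) ((M * N) $$ (i, j))"
    using ij carr by (auto simp: scalar_prod_def intro!: homogeneous_sum)
qed

lemma mat_image_lift:
  assumes N: "N \<in> carrier_mat (dim_row D) n" and "\<And>j. j < n \<Longrightarrow> col N j \<in> mat_image D"
  obtains H where "H \<in> carrier_mat (dim_col D) n" "N = D * H"
proof -
  have "\<exists>h. \<forall>j<n. h j \<in> carrier_vec (dim_col D) \<and> col N j = D *\<^sub>v h j"
    using assms(2) unfolding mat_image_def by (intro choice) blast
  then obtain h where h: "\<And>j. j < n \<Longrightarrow> h j \<in> carrier_vec (dim_col D)"
      "\<And>j. j < n \<Longrightarrow> col N j = D *\<^sub>v h j" by blast
  define H where "H = mat (dim_col D) n (\<lambda>(i, j). h j $ i)"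
  have "N = D * H"
  proof (rule eq_matI)
    fix i j
    assume ij: "i < dim_row (D * H)" "j < dim_col (D * H)"
    then have j: "j < n" and i: "i < dim_row D" by (simp_all add: H_def)
    have "col H j = h j" using h(1)[OF j] j by (intro eq_vecI) (auto simp: H_def)
    then have "(D * H) $$ (i, j) = (D *\<^sub>v h j) $ i" using i j by (simp add: H_def)
    also have "\<dots> = N $$ (i, j)" using h(2)[OF j, symmetric] i j N by simp
    finally show "N $$ (i, j) = (D * H) $$ (i, j)" ..
  qed (use N in \<open>simp_all add: H_def\<close>)
  then show ?thesis using that[of H] by (simp add: H_def)
qed

text \<open>Graded free modules are projective. A lift \<open>K\<close> found column by column need
  not be graded; keeping only the component of the right degree in each entry preserves
  \<open>N = D * K\<close>, since \<open>N\<close> and \<open>D\<close> are graded.\<close>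

lemma graded_lift:
  assumes D: "graded_map c a D" and N: "graded_map b a N"
    and im: "\<And>j. j < length b \<Longrightarrow> col N j \<in> mat_image D"
  obtains H where "graded_map b c H" "N = D * H"
proof -
  note Dc = graded_mapD(1)[OF D] and Nc = graded_mapD(1)[OF N]
  obtain K where K: "K \<in> carrier_mat (dim_col D) (length b)" and NK: "N = D * K"
    using mat_image_lift[of N D "length b"] im Dc Nc by auto
  define H where "H = mat (length c) (length b) (\<lambda>(k, j). hcomp (b ! j - c ! k) (K $$ (k, j)))"
  have "graded_map b c H" by (simp add: graded_map_def H_def)
  moreover have "N = D * H"
  proof (rule eq_matI)
    fix i j
    assume "i < dim_row (D * H)" "j < dim_col (D * H)"
    then have ij: "i < length a" "j < length b" using Dc by (simp_all add: H_def)
    have "N $$ (i, j) = hcomp (b ! j - a ! i) (N $$ (i, j))"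
      using graded_mapD(2)[OF N ij] by (simp add: homogeneous_iff_hcomp)
    also have "\<dots> = hcomp (b ! j - a ! i) (\<Sum>k\<in>{0..<length c}. D $$ (i, k) * K $$ (k, j))"
      using ij Dc K by (simp add: NK scalar_prod_def)
    also have "\<dots> = (\<Sum>k\<in>{0..<length c}. hcomp (b ! j - a ! i) (D $$ (i, k) * K $$ (k, j)))"
      by (simp add: hcomp_def part_sum)
    also have "\<dots> = (\<Sum>k\<in>{0..<length c}. D $$ (i, k) * hcomp (b ! j - c ! k) (K $$ (k, j)))"
      by (intro sum.cong refl) (simp add: hcomp_times[OF graded_mapD(2)[OF D ij(1)]])
    also have "\<dots> = (D * H) $$ (i, j)"
      using ij Dc by (simp add: H_def scalar_prod_def)
    finally show "N $$ (i, j) = (D * H) $$ (i, j)" .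
  qed (use Dc Nc in \<open>simp_all add: H_def\<close>)
  ultimately show ?thesis using that by blast
qed

text \<open>Resolutions are extended by zero modules to infinite length, so that comparison maps and
  homotopies can be constructed by one recursion.\<close>

definition exact_complex :: "'k::field poly3 set \<Rightarrow> (nat \<Rightarrow> int list) \<Rightarrow> (nat \<Rightarrow> 'k poly3 mat) \<Rightarrow> bool" where
  "exact_complex I a M \<longleftrightarrow> a 0 = [0] \<and>
     mat_image (M 0) = {v \<in> carrier_vec 1. v $ 0 \<in> I} \<and>
     (\<forall>i. graded_map (a (Suc i)) (a i) (M i) \<and> mat_kernel (M i) = mat_image (M (Suc i)))"

text \<open>Reduction modulo the irrelevant ideal; a resolution is minimal iff all its matrices reduce to \<open>0\<close>.\<close>

definition const_mat :: "'k::field poly3 mat \<Rightarrow> 'k mat" where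
  "const_mat M = map_mat (\<lambda>f. coef f 0) M"

lemma const_mat_dim [simp]: "dim_row (const_mat M) = dim_row M" "dim_col (const_mat M) = dim_col M"
  by (simp_all add: const_mat_def)

lemma const_mat_carrier [simp]: "const_mat M \<in> carrier_mat r c \<longleftrightarrow> M \<in> carrier_mat r c"
  by (simp add: const_mat_def)

lemma const_mat_index [simp]:
  "i < dim_row M \<Longrightarrow> j < dim_col M \<Longrightarrow> const_mat M $$ (i, j) = coef (M $$ (i, j)) 0"
  by (simp add: const_mat_def)

lemma const_mat_mult: "dim_col A = dim_row B \<Longrightarrow> const_mat (A * B) = const_mat A * const_mat B"
  by (rule eq_matI) (simp_all add: scalar_prod_def lookup_sum coef_times_zero)

lemma const_mat_add:
  "A \<in> carrier_mat r c \<Longrightarrow> B \<in> carrier_mat r c \<Longrightarrow> const_mat (A + B) = const_mat A + const_mat B"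
  by (rule eq_matI) (simp_all add: lookup_add)

lemma const_mat_one [simp]: "const_mat (1\<^sub>m n) = 1\<^sub>m n"
  by (rule eq_matI) (simp_all add: lookup_one)

text \<open>A homogeneous entry with nonzero constant term has degree 0, so its row and column have
  equal shifts.\<close>

lemma graded_map_const_mat:
  assumes "graded_map b a M" "i < length a" "j < length b" "const_mat M $$ (i, j) \<noteq> 0"
  shows "a ! i = b ! j"
proof -
  note carr = graded_mapD(1)[OF assms(1)]
  have "0 \<in> supp (M $$ (i, j))" using assms carr by (auto simp: in_keys_iff)
  then show ?thesis using graded_mapD(2)[OF assms(1-3)] by (auto simp: homogeneous_def)
qed

section \<open>Exactness expressed by matrix products\<close>

lemma mat_mult_eq_0_iff_image_subset_kernel:
  assumes "A \<in> carrier_mat r m" "B \<in> carrier_mat m n"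
  shows "A * B = 0\<^sub>m r n \<longleftrightarrow> (\<forall>j<n. col B j \<in> mat_kernel A)"
proof
  assume 0: "A * B = 0\<^sub>m r n"
  show "\<forall>j<n. col B j \<in> mat_kernel A"
  proof (intro allI impI mat_kernelI[OF assms(1)])
    fix j assume j: "j < n"
    show "col B j \<in> carrier_vec m" using assms by (simp add: carrier_vecI)
    have "A *\<^sub>v col B j = col (A * B) j" by (rule col_mult2[symmetric, OF assms j])
    then show "A *\<^sub>v col B j = 0\<^sub>v r" using j by (simp add: 0)
  qed
next
  assume *: "\<forall>j<n. col B j \<in> mat_kernel A"
  show "A * B = 0\<^sub>m r n"
  proof (rule eq_matI)
    fix i j assume ij: "i < dim_row (0\<^sub>m r n :: 'a mat)" "j < dim_col (0\<^sub>m r n :: 'a mat)"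
    then have "A *\<^sub>v col B j = 0\<^sub>v r" using * mat_kernelD(2)[OF assms(1)] by simp
    then have "(A *\<^sub>v col B j) $ i = 0" using ij by simp
    then show "(A * B) $$ (i, j) = 0\<^sub>m r n $$ (i, j)" using ij assms by simp
  qed (use assms in auto)
qed

lemma col_mem_mat_image:
  assumes "A \<in> carrier_mat r m" "B \<in> carrier_mat m n" "j < n"
  shows "col (A * B) j \<in> mat_image A"
proof -
  have "col (A * B) j = A *\<^sub>v col B j" by (rule col_mult2[OF assms])
  moreover have "col B j \<in> carrier_vec (dim_col A)" using assms by (simp add: carrier_vecI)
  ultimately show ?thesis unfolding mat_image_def by blast
qed

lemma exact_complexD:
  assumes "exact_complex I a M"
  shows "graded_map (a (Suc i)) (a i) (M i)"
    and "M i \<in> carrier_mat (length (a i)) (length (a (Suc i)))"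
    and "mat_kernel (M i) = mat_image (M (Suc i))"
    and "a 0 = [0]"
proof -
  show g: "graded_map (a (Suc i)) (a i) (M i)" using assms by (simp add: exact_complex_def)
  show "M i \<in> carrier_mat (length (a i)) (length (a (Suc i)))" by (rule graded_mapD(1)[OF g])
qed (use assms in \<open>auto simp: exact_complex_def\<close>)

lemma exact_complex_square_zero:
  assumes "exact_complex I a M"
  shows "M i * M (Suc i) = 0\<^sub>m (length (a i)) (length (a (Suc (Suc i))))"
proof -
  note c = exact_complexD(2)[OF assms]
  have "col (M (Suc i)) j \<in> mat_kernel (M i)" if "j < length (a (Suc (Suc i)))" for j
  proof -
    have "col (M (Suc i) * 1\<^sub>m (length (a (Suc (Suc i))))) j \<in> mat_image (M (Suc i))"
      by (rule col_mem_mat_image[OF c _ that]) simp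
    then show ?thesis by (simp add: exact_complexD(3)[OF assms] right_mult_one_mat[OF c])
  qed
  then show ?thesis using mat_mult_eq_0_iff_image_subset_kernel[OF c c] by blast
qed

lemma exact_complex_lift:
  assumes ex: "exact_complex I b N" and X: "graded_map c (b (Suc i)) X"
    and z: "N i * X = 0\<^sub>m (length (b i)) (length c)"
  obtains Y where "graded_map c (b (Suc (Suc i))) Y" "X = N (Suc i) * Y"
proof -
  have "\<And>j. j < length c \<Longrightarrow> col X j \<in> mat_image (N (Suc i))"
    using z mat_mult_eq_0_iff_image_subset_kernel[OF exact_complexD(2)[OF ex] graded_mapD(1)[OF X]]
    by (simp add: exact_complexD(3)[OF ex])
  then show ?thesis using graded_lift[OF exact_complexD(1)[OF ex] X] that by blast
qed

text \<open>Meant for homotopies: they disappear modulo the irrelevant ideal, so their degrees are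
  never consulted.\<close>

lemma exact_complex_lift_ungraded:
  assumes ex: "exact_complex I b N" and X: "X \<in> carrier_mat (length (b (Suc i))) n"
    and z: "N i * X = 0\<^sub>m (length (b i)) n"
  obtains Y where "Y \<in> carrier_mat (length (b (Suc (Suc i)))) n" "X = N (Suc i) * Y"
proof -
  note c = exact_complexD(2)[OF ex, of "Suc i"]
  have "\<And>j. j < n \<Longrightarrow> col X j \<in> mat_image (N (Suc i))"
    using z mat_mult_eq_0_iff_image_subset_kernel[OF exact_complexD(2)[OF ex] X]
    by (simp add: exact_complexD(3)[OF ex])
  moreover have "X \<in> carrier_mat (dim_row (N (Suc i))) n" using X c by auto
  ultimately obtain Y where "Y \<in> carrier_mat (dim_col (N (Suc i))) n" "X = N (Suc i) * Y"
    using mat_image_lift by blast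
  then show ?thesis using that c by auto
qed

lemma comparison_map:
  assumes A: "exact_complex I a M" and B: "exact_complex I b N"
  obtains \<phi> where "\<phi> 0 = 1\<^sub>m 1" "\<And>i. graded_map (a i) (b i) (\<phi> i)"
    "\<And>i. \<phi> i * M i = N i * \<phi> (Suc i)"
proof -
  note Mc = exact_complexD(2)[OF A] and Nc = exact_complexD(2)[OF B]
  \<comment> \<open>The invariant includes liftability of the next composite, so that the recursive
    choice can always continue.\<close>
  define P where "P n X \<longleftrightarrow> (n = 0 \<longrightarrow> X = 1\<^sub>m 1) \<and> graded_map (a n) (b n) X \<and>
    (\<forall>j<length (a (Suc n)). col (X * M n) j \<in> mat_image (N n))" for n X
  have "\<exists>\<phi>. \<forall>n. P n (\<phi> n) \<and> \<phi> n * M n = N n * \<phi> (Suc n)"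
  proof (rule dependent_nat_choice)
    have M0: "M 0 \<in> carrier_mat 1 (length (a 1))" using Mc[of 0] exact_complexD(4)[OF A] by simp
    have "col (1\<^sub>m 1 * M 0) j \<in> mat_image (N 0)" if "j < length (a (Suc 0))" for j
    proof -
      \<comment> \<open>Both complexes have the boundaries prescribed by \<open>I\<close> at the
        start, so the identity in degree 0 lifts.\<close>
      have "mat_image (M 0) = mat_image (N 0)" using A B by (simp add: exact_complex_def)
      moreover have "col (M 0 * 1\<^sub>m (length (a 1))) j \<in> mat_image (M 0)"
        by (rule col_mem_mat_image[OF M0 _ ]) (use that in simp_all)
      ultimately show ?thesis using M0 by simp
    qed
    then have "P 0 (1\<^sub>m 1)"
      using graded_map_one[of "[0]"] by (simp add: P_def exact_complexD(4)[OF A] exact_complexD(4)[OF B])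
    then show "\<exists>X. P 0 X" ..
  next
    fix X n
    assume "P n X"
    then have X: "graded_map (a n) (b n) X"
      and im: "\<And>j. j < length (a (Suc n)) \<Longrightarrow> col (X * M n) j \<in> mat_image (N n)"
      by (auto simp: P_def)
    obtain Y where Y: "graded_map (a (Suc n)) (b (Suc n)) Y" "X * M n = N n * Y"
      using graded_lift[OF exact_complexD(1)[OF B] graded_map_mult[OF X exact_complexD(1)[OF A]] im] .
    note Xc = graded_mapD(1)[OF X] and Yc = graded_mapD(1)[OF Y(1)]
    have "N n * (Y * M (Suc n)) = (X * M n) * M (Suc n)"
      using assoc_mult_mat[OF Nc Yc Mc] by (simp add: Y(2))
    also have "\<dots> = X * (M n * M (Suc n))" by (rule assoc_mult_mat[OF Xc Mc Mc])
    also have "\<dots> = 0\<^sub>m (length (b n)) (length (a (Suc (Suc n))))"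
      using Xc by (simp add: exact_complex_square_zero[OF A])
    finally have "\<forall>j<length (a (Suc (Suc n))). col (Y * M (Suc n)) j \<in> mat_image (N (Suc n))"
      using mat_mult_eq_0_iff_image_subset_kernel[OF Nc mult_carrier_mat[OF Yc Mc]]
      by (simp add: exact_complexD(3)[OF B])
    with Y show "\<exists>Y. P (Suc n) Y \<and> X * M n = N n * Y" by (auto simp: P_def)
  qed
  then show ?thesis using that unfolding P_def by blast
qed

text \<open>\<open>\<theta> - 1\<close> vanishes in degree 0. Once \<open>h n\<close> is known,
  \<open>\<theta> (Suc n) - 1 - h n * M n\<close> consists of cycles, and a lift of it through
  \<open>M (Suc n)\<close> is the next homotopy.\<close>

lemma homotopic_to_identity:
  assumes A: "exact_complex I a M"
    and \<theta>: "\<theta> 0 = 1\<^sub>m 1" "\<And>i. \<theta> i \<in> carrier_mat (length (a i)) (length (a i))"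
      "\<And>i. \<theta> i * M i = M i * \<theta> (Suc i)"
  obtains h where "\<And>i. h i \<in> carrier_mat (length (a (Suc i))) (length (a i))"
    "\<And>i. \<theta> (Suc i) = 1\<^sub>m (length (a (Suc i))) + (M (Suc i) * h (Suc i) + h i * M i)"
proof -
  note Mc = exact_complexD(2)[OF A]
  let ?l = "\<lambda>i. length (a i)"
  \<comment> \<open>\<open>X\<close> stands for \<open>h n\<close>; the equation says that the error
    remaining in degree \<open>Suc n\<close> is a cycle.\<close>
  define P where "P n X \<longleftrightarrow> X \<in> carrier_mat (?l (Suc n)) (?l n) \<and>
    M n * (\<theta> (Suc n) - 1\<^sub>m (?l (Suc n)) - X * M n) = 0\<^sub>m (?l n) (?l (Suc n))" for n X
  have "\<exists>h. \<forall>n. P n (h n) \<and>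
    \<theta> (Suc n) = 1\<^sub>m (?l (Suc n)) + (M (Suc n) * h (Suc n) + h n * M n)"
  proof (rule dependent_nat_choice)
    have l0: "?l 0 = 1" using exact_complexD(4)[OF A] by simp
    have M0: "M 0 \<in> carrier_mat 1 (?l (Suc 0))" using Mc[of 0] by (simp only: l0)
    have T: "\<theta> (Suc 0) \<in> carrier_mat (?l (Suc 0)) (?l (Suc 0))" by (rule \<theta>)
    have "M 0 * \<theta> (Suc 0) = M 0" using \<theta>(3)[of 0] M0 by (simp add: \<theta>(1))
    \<comment> \<open>The homotopy starts with \<open>h 0 = 0\<close>, which is possible because
      \<open>\<theta> 0\<close> is the identity.\<close>
    then have "M 0 * (\<theta> (Suc 0) - 1\<^sub>m (?l (Suc 0)) - 0\<^sub>m (?l (Suc 0)) 1 * M 0) = 0\<^sub>m 1 (?l (Suc 0))"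
    proof -
      assume e: "M 0 * \<theta> (Suc 0) = M 0"
      have "\<theta> (Suc 0) - 1\<^sub>m (?l (Suc 0)) - 0\<^sub>m (?l (Suc 0)) 1 * M 0 = \<theta> (Suc 0) - 1\<^sub>m (?l (Suc 0))"
        using M0 T by (intro eq_matI) auto
      then show ?thesis
        using M0 by (simp add: mult_minus_distrib_mat[OF M0 T one_carrier_mat] e minus_r_inv_mat)
    qed
    then have "P 0 (0\<^sub>m (?l (Suc 0)) 1)" by (simp add: P_def l0)
    then show "\<exists>X. P 0 X" ..
  next
    fix X n
    assume "P n X"
    then have X: "X \<in> carrier_mat (?l (Suc n)) (?l n)"
      and z: "M n * (\<theta> (Suc n) - 1\<^sub>m (?l (Suc n)) - X * M n) = 0\<^sub>m (?l n) (?l (Suc n))"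
      by (auto simp: P_def)
    have XM: "X * M n \<in> carrier_mat (?l (Suc n)) (?l (Suc n))" using X Mc by simp
    have D: "\<theta> (Suc n) - 1\<^sub>m (?l (Suc n)) - X * M n \<in> carrier_mat (?l (Suc n)) (?l (Suc n))"
      using XM by (intro minus_carrier_mat)
    obtain Y where Y: "Y \<in> carrier_mat (?l (Suc (Suc n))) (?l (Suc n))"
      and D': "\<theta> (Suc n) - 1\<^sub>m (?l (Suc n)) - X * M n = M (Suc n) * Y"
      using exact_complex_lift_ungraded[OF A D z] .
    have MY: "M (Suc n) * Y \<in> carrier_mat (?l (Suc n)) (?l (Suc n))" by (rule mult_carrier_mat[OF Mc Y])
    have \<theta>n: "\<theta> (Suc n) = 1\<^sub>m (?l (Suc n)) + (M (Suc n) * Y + X * M n)"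
    proof (rule eq_matI)
      fix i j
      assume "i < dim_row (1\<^sub>m (?l (Suc n)) + (M (Suc n) * Y + X * M n))"
        "j < dim_col (1\<^sub>m (?l (Suc n)) + (M (Suc n) * Y + X * M n))"
      then have ij: "i < ?l (Suc n)" "j < ?l (Suc n)" using XM by auto
      have "(\<theta> (Suc n) - 1\<^sub>m (?l (Suc n)) - X * M n) $$ (i, j) = (M (Suc n) * Y) $$ (i, j)"
        by (simp only: D')
      then have "\<theta> (Suc n) $$ (i, j) - 1\<^sub>m (?l (Suc n)) $$ (i, j) - (X * M n) $$ (i, j) = (M (Suc n) * Y) $$ (i, j)"
        using ij XM \<theta>(2)[of "Suc n"] by (simp del: index_mult_mat)
      moreover have "(1\<^sub>m (?l (Suc n)) + (M (Suc n) * Y + X * M n)) $$ (i, j)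
        = 1\<^sub>m (?l (Suc n)) $$ (i, j) + ((M (Suc n) * Y) $$ (i, j) + (X * M n) $$ (i, j))"
        using ij XM MY by (simp del: index_mult_mat)
      ultimately show "\<theta> (Suc n) $$ (i, j) = (1\<^sub>m (?l (Suc n)) + (M (Suc n) * Y + X * M n)) $$ (i, j)"
        by (simp only:) (simp add: algebra_simps)
    qed (use XM \<theta>(2)[of "Suc n"] in auto)
    have M': "M (Suc n) \<in> carrier_mat (?l (Suc n)) (?l (Suc (Suc n)))" by (rule Mc)
    have YM: "Y * M (Suc n) \<in> carrier_mat (?l (Suc (Suc n))) (?l (Suc (Suc n)))" using Y M' by simp
    have "M (Suc n) * \<theta> (Suc (Suc n)) = M (Suc n) + (M (Suc n) * Y * M (Suc n) + X * M n * M (Suc n))"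
      unfolding \<theta>(3)[symmetric]
      by (subst \<theta>n) (use XM MY M' in \<open>simp add: add_mult_distrib_mat[of _ "?l (Suc n)" "?l (Suc n)"]\<close>)
    also have "X * M n * M (Suc n) = 0\<^sub>m (?l (Suc n)) (?l (Suc (Suc n)))"
      using assoc_mult_mat[OF X Mc M'] X by (simp add: exact_complex_square_zero[OF A])
    also have "M (Suc n) * Y * M (Suc n) = M (Suc n) * (Y * M (Suc n))"
      by (rule assoc_mult_mat[OF M' Y M'])
    finally have e: "M (Suc n) * \<theta> (Suc (Suc n)) = M (Suc n) + M (Suc n) * (Y * M (Suc n))"
      using M' YM by simp
    have "M (Suc n) * (\<theta> (Suc (Suc n)) - 1\<^sub>m (?l (Suc (Suc n))) - Y * M (Suc n))
      = M (Suc n) * \<theta> (Suc (Suc n)) - M (Suc n) * 1\<^sub>m (?l (Suc (Suc n))) - M (Suc n) * (Y * M (Suc n))"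
      by (simp only: mult_minus_distrib_mat[OF M' minus_carrier_mat[OF one_carrier_mat] YM]
          mult_minus_distrib_mat[OF M' \<theta>(2) one_carrier_mat])
    also have "\<dots> = 0\<^sub>m (?l (Suc n)) (?l (Suc (Suc n)))"
      unfolding e using M' mult_carrier_mat[OF M' YM]
      by (intro eq_matI) (simp_all del: index_mult_mat)
    finally have "P (Suc n) Y" using Y by (simp add: P_def)
    with \<theta>n show "\<exists>Y. P (Suc n) Y \<and> \<theta> (Suc n) = 1\<^sub>m (?l (Suc n)) + (M (Suc n) * Y + X * M n)" by blast
  qed
  then show ?thesis using that unfolding P_def by blast
qed

text \<open>The homotopy from \<open>\<psi> * \<phi>\<close> to the identity lives on the complex
  \<open>a\<close>, whose matrices reduce to 0, so both of its terms reduce to 0. The complex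
  \<open>b\<close> may be any resolution, for instance a cone whose minimality is still
  open.\<close>

lemma minimal_complex_comparison:
  assumes A: "exact_complex I a M" and B: "exact_complex I b N"
    and min: "\<And>i. const_mat (M i) = 0\<^sub>m (length (a i)) (length (a (Suc i)))"
  obtains \<phi> \<psi> where "\<And>i. graded_map (a i) (b i) (\<phi> i)" "\<And>i. graded_map (b i) (a i) (\<psi> i)"
    "\<And>i. \<phi> i * M i = N i * \<phi> (Suc i)"
    "\<And>i. const_mat (\<psi> i) * const_mat (\<phi> i) = 1\<^sub>m (length (a i))"
proof -
  note Mc = exact_complexD(2)[OF A] and Nc = exact_complexD(2)[OF B]
  obtain \<phi> where \<phi>: "\<phi> 0 = 1\<^sub>m 1" "\<And>i. graded_map (a i) (b i) (\<phi> i)"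
    "\<And>i. \<phi> i * M i = N i * \<phi> (Suc i)" by (rule comparison_map[OF A B]) blast
  obtain \<psi> where \<psi>: "\<psi> 0 = 1\<^sub>m 1" "\<And>i. graded_map (b i) (a i) (\<psi> i)"
    "\<And>i. \<psi> i * N i = M i * \<psi> (Suc i)" by (rule comparison_map[OF B A]) blast
  note \<phi>c = graded_mapD(1)[OF \<phi>(2)] and \<psi>c = graded_mapD(1)[OF \<psi>(2)]
  have comm: "\<psi> i * \<phi> i * M i = M i * (\<psi> (Suc i) * \<phi> (Suc i))" for i
  proof -
    have "\<psi> i * \<phi> i * M i = \<psi> i * (\<phi> i * M i)" by (rule assoc_mult_mat[OF \<psi>c \<phi>c Mc])
    also have "\<dots> = \<psi> i * N i * \<phi> (Suc i)"
      unfolding \<phi>(3) by (rule assoc_mult_mat[symmetric, OF \<psi>c Nc \<phi>c])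
    also have "\<dots> = M i * (\<psi> (Suc i) * \<phi> (Suc i))"
      unfolding \<psi>(3) by (rule assoc_mult_mat[OF Mc \<psi>c \<phi>c])
    finally show ?thesis .
  qed
  obtain h where h: "\<And>i. h i \<in> carrier_mat (length (a (Suc i))) (length (a i))"
    "\<And>i. \<psi> (Suc i) * \<phi> (Suc i) = 1\<^sub>m (length (a (Suc i))) + (M (Suc i) * h (Suc i) + h i * M i)"
    by (rule homotopic_to_identity[OF A, of "\<lambda>i. \<psi> i * \<phi> i"])
      (use \<phi>(1) \<psi>(1) comm mult_carrier_mat[OF \<psi>c \<phi>c] in auto)
  have "const_mat (\<psi> i) * const_mat (\<phi> i) = 1\<^sub>m (length (a i))" for i
  proof (cases i)
    case 0
    then show ?thesis using exact_complexD(4)[OF A] by (simp add: \<phi>(1) \<psi>(1))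
  next
    case (Suc j)
    let ?n = "length (a (Suc j))"
    have c: "M (Suc j) * h (Suc j) \<in> carrier_mat ?n ?n" "h j * M j \<in> carrier_mat ?n ?n"
      using Mc h(1) by (meson mult_carrier_mat)+
    have "const_mat (\<psi> i) * const_mat (\<phi> i) = const_mat (\<psi> i * \<phi> i)"
      using \<phi>c[of i] \<psi>c[of i] by (intro const_mat_mult[symmetric]) auto
    also have "\<dots> = 1\<^sub>m ?n + (const_mat (M (Suc j) * h (Suc j)) + const_mat (h j * M j))"
      unfolding Suc h(2)
      by (simp add: const_mat_add[OF one_carrier_mat add_carrier_mat[OF c(2)]] const_mat_add[OF c])
    also have "const_mat (M (Suc j) * h (Suc j)) = 0\<^sub>m ?n ?n"
      using Mc[of "Suc j"] h(1)[of "Suc j"]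
      by (subst const_mat_mult) (auto simp: min left_mult_zero_mat[of _ _ ?n])
    also have "const_mat (h j * M j) = 0\<^sub>m ?n ?n"
      using Mc[of j] h(1)[of j]
      by (subst const_mat_mult) (auto simp: min right_mult_zero_mat[of _ ?n])
    finally show ?thesis by (simp add: Suc)
  qed
  then show ?thesis using that \<phi> \<psi> by blast
qed

lemma minimal_complex_count_le:
  assumes A: "exact_complex I a M" and B: "exact_complex I b N"
    and min: "\<And>i. const_mat (M i) = 0\<^sub>m (length (a i)) (length (a (Suc i)))"
  shows "count_list (a i) d \<le> count_list (b i) d"
proof -
  obtain \<phi> \<psi> where \<phi>: "\<And>i. graded_map (a i) (b i) (\<phi> i)" "\<And>i. graded_map (b i) (a i) (\<psi> i)"
    "\<And>i. \<phi> i * M i = N i * \<phi> (Suc i)"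
    "\<And>i. const_mat (\<psi> i) * const_mat (\<phi> i) = 1\<^sub>m (length (a i))"
    by (rule minimal_complex_comparison[OF A B min]) blast
  show ?thesis
  proof (rule count_list_le_if_graded_factor_identity)
    show "const_mat (\<phi> i) \<in> carrier_mat (length (b i)) (length (a i))"
      "const_mat (\<psi> i) \<in> carrier_mat (length (a i)) (length (b i))"
      using \<phi> by (simp_all add: graded_mapD(1))
    show "b i ! k = a i ! j"
      if "k < length (b i)" "j < length (a i)" "const_mat (\<phi> i) $$ (k, j) \<noteq> 0" for k j
      using graded_map_const_mat[OF \<phi>(1) that] .
  qed (rule \<phi>)
qed

text \<open>With equal ranks the reduction of \<open>\<phi> (Suc i)\<close> is square with a left
  inverse, hence invertible. Since \<open>N i * \<phi> (Suc i) = \<phi> i * M i\<close> reduces to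
  0, so does \<open>N i\<close>.\<close>

lemma minimal_complex_transfer:
  assumes A: "exact_complex I a M" and B: "exact_complex I b N"
    and min: "\<And>i. const_mat (M i) = 0\<^sub>m (length (a i)) (length (a (Suc i)))"
    and len: "length (a (Suc i)) = length (b (Suc i))"
  shows "const_mat (N i) = 0\<^sub>m (length (b i)) (length (b (Suc i)))"
proof -
  obtain \<phi> \<psi> where \<phi>: "\<And>i. graded_map (a i) (b i) (\<phi> i)" "\<And>i. graded_map (b i) (a i) (\<psi> i)"
    "\<And>i. \<phi> i * M i = N i * \<phi> (Suc i)"
    "\<And>i. const_mat (\<psi> i) * const_mat (\<phi> i) = 1\<^sub>m (length (a i))"
    by (rule minimal_complex_comparison[OF A B min]) blast
  let ?n = "length (b (Suc i))"
  note Mc = exact_complexD(2)[OF A, of i] and Nc = exact_complexD(2)[OF B, of i]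
  have c: "const_mat (\<phi> (Suc i)) \<in> carrier_mat ?n ?n" "const_mat (\<psi> (Suc i)) \<in> carrier_mat ?n ?n"
    using graded_mapD(1)[OF \<phi>(1), of "Suc i"] graded_mapD(1)[OF \<phi>(2), of "Suc i"] by (simp_all add: len)
  have inv: "const_mat (\<phi> (Suc i)) * const_mat (\<psi> (Suc i)) = 1\<^sub>m ?n"
    using mat_mult_left_right_inverse[OF c(2,1)] \<phi>(4)[of "Suc i"] by (simp add: len)
  have \<phi>i: "\<phi> i \<in> carrier_mat (length (b i)) (length (a i))"
    and \<phi>S: "\<phi> (Suc i) \<in> carrier_mat ?n (length (a (Suc i)))" using graded_mapD(1)[OF \<phi>(1)] by auto
  have "const_mat (N i) * const_mat (\<phi> (Suc i)) = const_mat (\<phi> i * M i)"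
    using Nc \<phi>S by (simp add: \<phi>(3) const_mat_mult)
  also have "\<dots> = const_mat (\<phi> i) * const_mat (M i)"
    using Mc \<phi>i by (intro const_mat_mult) auto
  also have "\<dots> = 0\<^sub>m (length (b i)) ?n"
    using \<phi>i by (simp add: min len right_mult_zero_mat[of _ "length (b i)"])
  finally have z: "const_mat (N i) * const_mat (\<phi> (Suc i)) = 0\<^sub>m (length (b i)) ?n" .
  have Nc': "const_mat (N i) \<in> carrier_mat (length (b i)) ?n" using Nc by simp
  have "const_mat (N i) = const_mat (N i) * (const_mat (\<phi> (Suc i)) * const_mat (\<psi> (Suc i)))"
    using Nc' by (simp add: inv)
  also have "\<dots> = const_mat (N i) * const_mat (\<phi> (Suc i)) * const_mat (\<psi> (Suc i))"
    by (rule assoc_mult_mat[symmetric, OF Nc' c])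
  also have "\<dots> = 0\<^sub>m (length (b i)) ?n" using c by (simp add: z)
  finally show ?thesis .
qed


section \<open>Padded resolutions and uniqueness of Betti numbers\<close>

lemma exact_complex_pad:
  fixes I :: "'k::field poly3 set"
  assumes "graded_free_resolution I as Ms"
  defines "a \<equiv> \<lambda>i. if i < length as then as ! i else []"
  defines "M \<equiv> \<lambda>i. if i < length Ms then Ms ! i else 0\<^sub>m (length (a i)) 0"
  shows "exact_complex I a M"
proof -
  have len: "length as = Suc (length Ms)" and a0: "as ! 0 = [0]"
    and gr: "\<And>i. i < length Ms \<Longrightarrow> graded_map (as ! Suc i) (as ! i) (Ms ! i)"
    and ex: "\<And>i. i < length as \<Longrightarrow> cycles_at I Ms i = boundaries_at as Ms i"
    using assms(1) by (auto simp: graded_free_resolution_def)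
  \<comment> \<open>Beyond the end, the maps are matrices without columns. Their image is 0, which
    turns injectivity of the last map into exactness of the padded complex.\<close>
  have im0: "mat_image (0\<^sub>m r 0 :: 'k poly3 mat) = {0\<^sub>v r}" for r
  proof -
    have "(0\<^sub>m r 0 :: 'k poly3 mat) *\<^sub>v v = 0\<^sub>v r" if "v \<in> carrier_vec 0" for v
      using that by (intro eq_vecI) (auto simp: scalar_prod_def)
    then show ?thesis unfolding mat_image_def by (auto intro!: exI[of _ "vec 0 (\<lambda>_. 0)"])
  qed
  have bd: "mat_image (M i) = boundaries_at as Ms i" if "i < length as" for i
    using that by (auto simp: boundaries_at_def M_def a_def im0)
  have "graded_map (a (Suc i)) (a i) (M i)" for i
    using gr by (auto simp: a_def M_def len graded_map_def)
  moreover have "mat_kernel (M i) = mat_image (M (Suc i))" for i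
  proof (cases "i < length Ms")
    case True
    then have "cycles_at I Ms (Suc i) = mat_kernel (M i)" by (simp add: cycles_at_def M_def)
    then show ?thesis using ex[of "Suc i"] bd[of "Suc i"] True by (simp add: len)
  next
    case False
    have "mat_kernel (0\<^sub>m r 0 :: 'k poly3 mat) = {0\<^sub>v 0}" for r
      unfolding mat_kernel_def by (auto intro!: eq_vecI simp: scalar_prod_def)
    with False show ?thesis by (simp add: M_def a_def len im0)
  qed
  moreover have "mat_image (M 0) = {v \<in> carrier_vec 1. v $ 0 \<in> I}"
    using bd[of 0] ex[of 0] len by (simp add: cycles_at_def)
  ultimately show ?thesis by (simp add: exact_complex_def a0 a_def len)
qed

lemma const_mat_pad:
  fixes I :: "'k::field poly3 set"
  assumes "minimal_graded_free_resolution I as Ms"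
  defines "a \<equiv> \<lambda>i. if i < length as then as ! i else []"
  defines "M \<equiv> \<lambda>i. if i < length Ms then Ms ! i else 0\<^sub>m (length (a i)) 0"
  shows "const_mat (M i) = 0\<^sub>m (length (a i)) (length (a (Suc i)))"
proof -
  have res: "graded_free_resolution I as Ms" and el: "\<And>M. M \<in> set Ms \<Longrightarrow> elements_mat M \<subseteq> irrelevant_ideal"
    using assms(1) by (auto simp: minimal_graded_free_resolution_def)
  have ex: "exact_complex I a M" unfolding M_def a_def by (rule exact_complex_pad[OF res])
  note c = exact_complexD(2)[OF ex, of i]
  show ?thesis
  proof (rule eq_matI)
    fix r s
    assume "r < dim_row (0\<^sub>m (length (a i)) (length (a (Suc i))) :: 'k mat)"
      "s < dim_col (0\<^sub>m (length (a i)) (length (a (Suc i))) :: 'k mat)"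
    then have rs: "r < length (a i)" "s < length (a (Suc i))" by simp_all
    have "M i $$ (r, s) \<in> irrelevant_ideal"
    proof (cases "i < length Ms")
      case True
      have "M i $$ (r, s) \<in> elements_mat (M i)" using rs c by (intro elements_matI) auto
      then show ?thesis using el[of "Ms ! i"] True by (auto simp: M_def)
    next
      case False
      then have "length as \<le> Suc i" using res by (simp add: graded_free_resolution_def)
      then show ?thesis using rs by (simp add: a_def)
    qed
    then show "const_mat (M i) $$ (r, s) = 0\<^sub>m (length (a i)) (length (a (Suc i))) $$ (r, s)"
      using rs c by (simp add: irrelevant_ideal_iff)
  qed (use c in auto)
qed

lemma minimal_resolution_count_le:
  assumes "minimal_graded_free_resolution I as Ms" "graded_free_resolution I bs Ns"
  shows "count_list (if i < length as then as ! i else []) d \<le> count_list (if i < length bs then bs ! i else []) d"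
  using minimal_complex_count_le[OF exact_complex_pad exact_complex_pad[OF assms(2)] const_mat_pad[OF assms(1)]]
    assms(1) unfolding minimal_graded_free_resolution_def by blast

lemma minimal_resolution_count_eq:
  assumes "minimal_graded_free_resolution I as Ms" "minimal_graded_free_resolution I bs Ns"
  shows "count_list (if i < length as then as ! i else []) d = count_list (if i < length bs then bs ! i else []) d"
  using assms minimal_resolution_count_le minimal_graded_free_resolution_def by (metis le_antisym)

text \<open>Ranks alone detect minimality. This is how the cone of a given monomial ideal is
  recognized as minimal before anything is known about its exponents.\<close>

lemma minimal_resolution_same_lengths:
  assumes A: "minimal_graded_free_resolution I as Ms" and B: "graded_free_resolution I bs Ns"
    and "map length as = map length bs"
  shows "minimal_graded_free_resolution I bs Ns"
proof -
  have A': "graded_free_resolution I as Ms" using A by (simp add: minimal_graded_free_resolution_def)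
  have lens: "length as = length bs" "\<And>i. i < length bs \<Longrightarrow> length (as ! i) = length (bs ! i)"
  proof -
    show l: "length as = length bs" using assms(3) map_eq_imp_length_eq by blast
    show "length (as ! i) = length (bs ! i)" if "i < length bs" for i
      using arg_cong[OF assms(3), of "\<lambda>xs. xs ! i"] that l by simp
  qed
  have "elements_mat N \<subseteq> irrelevant_ideal" if N: "N \<in> set Ns" for N
  proof -
    obtain i where i: "i < length Ns" "N = Ns ! i" using N by (metis in_set_conv_nth)
    then have i': "Suc i < length bs" using B by (simp add: graded_free_resolution_def)
    have gr: "graded_map (bs ! Suc i) (bs ! i) N"
      using B i by (auto simp: graded_free_resolution_def)
    have z: "const_mat N = 0\<^sub>m (length (bs ! i)) (length (bs ! Suc i))"
      using minimal_complex_transfer[OF exact_complex_pad[OF A'] exact_complex_pad[OF B] const_mat_pad[OF A], of i]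
        lens i i' by simp
    show ?thesis
    proof
      fix f assume "f \<in> elements_mat N"
      then obtain r s where rs: "r < dim_row N" "s < dim_col N" "f = N $$ (r, s)"
        using elements_matD by metis
      then have "coef f 0 = const_mat N $$ (r, s)" by simp
      also have "\<dots> = 0" using rs graded_mapD(1)[OF gr] by (simp add: z)
      finally show "f \<in> irrelevant_ideal" by (simp add: irrelevant_ideal_iff)
    qed
  qed
  with B show ?thesis by (simp add: minimal_graded_free_resolution_def)
qed

text \<open>The mapping cone of the morphism of Koszul complexes from \<open>(\<xi>, \<eta>, \<zeta>)\<close> to \<open>(\<alpha>\<xi>, \<beta>\<eta>, \<gamma>\<zeta>)\<close> lifting
  multiplication by \<open>\<alpha>\<beta>\<gamma>\<close>, with the last summand \<open>R\<close> of both complexes cancelled.\<close>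

definition aci_mats :: "'a::comm_ring_1 \<Rightarrow> 'a \<Rightarrow> 'a \<Rightarrow> 'a \<Rightarrow> 'a \<Rightarrow> 'a \<Rightarrow> 'a mat list" where
  "aci_mats \<alpha> \<beta> \<gamma> \<xi> \<eta> \<zeta> =
   [mat_of_rows_list 4 [[\<alpha> * \<beta> * \<gamma>, \<alpha> * \<xi>, \<beta> * \<eta>, \<gamma> * \<zeta>]],
    mat_of_rows_list 6
     [[0, 0, 0, \<xi>, \<eta>, \<zeta>],
      [\<beta> * \<eta>, \<gamma> * \<zeta>, 0, - (\<beta> * \<gamma>), 0, 0],
      [- (\<alpha> * \<xi>), 0, \<gamma> * \<zeta>, 0, - (\<alpha> * \<gamma>), 0],
      [0, - (\<alpha> * \<xi>), - (\<beta> * \<eta>), 0, 0, - (\<alpha> * \<beta>)]],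
    mat_of_rows_list 3
     [[0, 0, \<gamma>],
      [0, \<beta>, 0],
      [\<alpha>, 0, 0],
      [0, \<zeta>, \<eta>],
      [\<zeta>, 0, - \<xi>],
      [- \<eta>, - \<xi>, 0]]]"

text \<open>With these coordinates, exactness becomes a matter of equations between ring
  elements.\<close>

lemma aci_mats_mult:
  fixes \<alpha> \<beta> \<gamma> \<xi> \<eta> \<zeta> :: "'a::comm_ring_1"
  defines "Ms \<equiv> aci_mats \<alpha> \<beta> \<gamma> \<xi> \<eta> \<zeta>"
  shows "v \<in> carrier_vec 4 \<Longrightarrow> Ms ! 0 *\<^sub>v v =
      vec_of_list [\<alpha> * \<beta> * \<gamma> * v $ 0 + \<alpha> * \<xi> * v $ 1 + \<beta> * \<eta> * v $ 2 + \<gamma> * \<zeta> * v $ 3]"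
    and "v \<in> carrier_vec 6 \<Longrightarrow> Ms ! 1 *\<^sub>v v = vec_of_list
      [\<xi> * v $ 3 + \<eta> * v $ 4 + \<zeta> * v $ 5,
       \<beta> * \<eta> * v $ 0 + \<gamma> * \<zeta> * v $ 1 - \<beta> * \<gamma> * v $ 3,
       - (\<alpha> * \<xi> * v $ 0) + \<gamma> * \<zeta> * v $ 2 - \<alpha> * \<gamma> * v $ 4,
       - (\<alpha> * \<xi> * v $ 1) - \<beta> * \<eta> * v $ 2 - \<alpha> * \<beta> * v $ 5]"
    and "v \<in> carrier_vec 3 \<Longrightarrow> Ms ! 2 *\<^sub>v v = vec_of_list
      [\<gamma> * v $ 2, \<beta> * v $ 1, \<alpha> * v $ 0, \<zeta> * v $ 1 + \<eta> * v $ 2, \<zeta> * v $ 0 - \<xi> * v $ 2, - (\<eta> * v $ 0) - \<xi> * v $ 1]"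
proof -
  assume v: "v \<in> carrier_vec 4"
  show "Ms ! 0 *\<^sub>v v =
      vec_of_list [\<alpha> * \<beta> * \<gamma> * v $ 0 + \<alpha> * \<xi> * v $ 1 + \<beta> * \<eta> * v $ 2 + \<gamma> * \<zeta> * v $ 3]"
    by (rule eq_vecI) (use v in \<open>auto simp: Ms_def aci_mats_def mat_of_rows_list_def scalar_prod_def numeral_eq_Suc less_Suc_eq\<close>)
next
  assume v: "v \<in> carrier_vec 6"
  show "Ms ! 1 *\<^sub>v v = vec_of_list
      [\<xi> * v $ 3 + \<eta> * v $ 4 + \<zeta> * v $ 5,
       \<beta> * \<eta> * v $ 0 + \<gamma> * \<zeta> * v $ 1 - \<beta> * \<gamma> * v $ 3,
       - (\<alpha> * \<xi> * v $ 0) + \<gamma> * \<zeta> * v $ 2 - \<alpha> * \<gamma> * v $ 4,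
       - (\<alpha> * \<xi> * v $ 1) - \<beta> * \<eta> * v $ 2 - \<alpha> * \<beta> * v $ 5]"
    by (rule eq_vecI) (use v in \<open>auto simp: Ms_def aci_mats_def mat_of_rows_list_def scalar_prod_def numeral_eq_Suc less_Suc_eq\<close>)
next
  assume v: "v \<in> carrier_vec 3"
  show "Ms ! 2 *\<^sub>v v = vec_of_list
      [\<gamma> * v $ 2, \<beta> * v $ 1, \<alpha> * v $ 0, \<zeta> * v $ 1 + \<eta> * v $ 2, \<zeta> * v $ 0 - \<xi> * v $ 2, - (\<eta> * v $ 0) - \<xi> * v $ 1]"
    by (rule eq_vecI) (use v in \<open>auto simp: Ms_def aci_mats_def mat_of_rows_list_def scalar_prod_def numeral_eq_Suc less_Suc_eq\<close>)
qed

lemma aci_mats_carrier: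
  "aci_mats \<alpha> \<beta> \<gamma> \<xi> \<eta> \<zeta> ! 0 \<in> carrier_mat 1 4"
  "aci_mats \<alpha> \<beta> \<gamma> \<xi> \<eta> \<zeta> ! 1 \<in> carrier_mat 4 6"
  "aci_mats \<alpha> \<beta> \<gamma> \<xi> \<eta> \<zeta> ! 2 \<in> carrier_mat 6 3"
  by (simp_all add: aci_mats_def mat_of_rows_list_def numeral_eq_Suc)

lemma vec_of_list_eq_iff: "vec_of_list xs = vec_of_list ys \<longleftrightarrow> xs = ys"
  by (metis list_vec)

lemma vec_list_expand:
  "v \<in> carrier_vec 3 \<Longrightarrow> v = vec_of_list [v $ 0, v $ 1, v $ 2]"
  "v \<in> carrier_vec 4 \<Longrightarrow> v = vec_of_list [v $ 0, v $ 1, v $ 2, v $ 3]"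
  "v \<in> carrier_vec 6 \<Longrightarrow> v = vec_of_list [v $ 0, v $ 1, v $ 2, v $ 3, v $ 4, v $ 5]"
  by (rule eq_vecI; auto simp: numeral_eq_Suc less_Suc_eq)+

lemma zero_vec_list:
  "0\<^sub>v 1 = vec_of_list [0 :: 'a::zero]"
  "0\<^sub>v 3 = vec_of_list [0 :: 'a, 0, 0]"
  "0\<^sub>v 4 = vec_of_list [0 :: 'a, 0, 0, 0]"
  "0\<^sub>v 6 = vec_of_list [0 :: 'a, 0, 0, 0, 0, 0]"
  by (rule eq_vecI; auto simp: numeral_eq_Suc less_Suc_eq)+

lemma mat_kernel_eq_mat_image:
  assumes A: "A \<in> carrier_mat r m" and B: "B \<in> carrier_mat m n"
    and zero: "\<And>w. w \<in> carrier_vec n \<Longrightarrow> A *\<^sub>v (B *\<^sub>v w) = 0\<^sub>v r"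
    and ex: "\<And>v. v \<in> carrier_vec m \<Longrightarrow> A *\<^sub>v v = 0\<^sub>v r \<Longrightarrow> \<exists>w\<in>carrier_vec n. v = B *\<^sub>v w"
  shows "mat_kernel A = mat_image B"
  using A B zero ex by (auto simp: mat_kernel[OF A] mat_image_def)

text \<open>\<open>koszul2\<close>, \<open>koszul3\<close> and \<open>koszul3'\<close> express
  exactness of the two Koszul complexes where it is used, and \<open>colon\<close> says that the
  colon ideal of \<open>(\<alpha>\<xi>, \<beta>\<eta>, \<gamma>\<zeta>)\<close> by
  \<open>\<alpha>\<beta>\<gamma>\<close> lies in \<open>(\<xi>, \<eta>, \<zeta>)\<close>. Each cycle
  is corrected by the comparison map until a Koszul relation remains.\<close>

lemma aci_mats_exact:
  fixes \<alpha> \<beta> \<gamma> \<xi> \<eta> \<zeta> :: "'a::comm_ring_1"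
  assumes nzd: "\<And>f. \<alpha> * f = 0 \<Longrightarrow> f = 0" "\<And>f. \<beta> * f = 0 \<Longrightarrow> f = 0"
      "\<And>f. \<gamma> * f = 0 \<Longrightarrow> f = 0" "\<And>f. \<zeta> * f = 0 \<Longrightarrow> f = 0"
    and koszul2: "\<And>f g. \<beta> * \<eta> * f + \<gamma> * \<zeta> * g = 0 \<Longrightarrow> \<exists>w. f = \<gamma> * \<zeta> * w \<and> g = - (\<beta> * \<eta> * w)"
    and koszul3: "\<And>f g h. \<alpha> * \<xi> * f + \<beta> * \<eta> * g + \<gamma> * \<zeta> * h = 0 \<Longrightarrow>
      \<exists>a b c. f = \<beta> * \<eta> * a + \<gamma> * \<zeta> * b \<and> g = - (\<alpha> * \<xi> * a) + \<gamma> * \<zeta> * c \<and> h = - (\<alpha> * \<xi> * b) - \<beta> * \<eta> * c"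
    and koszul3': "\<And>f g h. \<xi> * f + \<eta> * g + \<zeta> * h = 0 \<Longrightarrow>
      \<exists>a b c. f = \<eta> * a + \<zeta> * b \<and> g = - (\<xi> * a) + \<zeta> * c \<and> h = - (\<xi> * b) - \<eta> * c"
    and colon: "\<And>f g h k. \<alpha> * \<beta> * \<gamma> * f + \<alpha> * \<xi> * g + \<beta> * \<eta> * h + \<gamma> * \<zeta> * k = 0 \<Longrightarrow>
      \<exists>a b c. f = \<xi> * a + \<eta> * b + \<zeta> * c"
  defines "Ms \<equiv> aci_mats \<alpha> \<beta> \<gamma> \<xi> \<eta> \<zeta>"
  shows "mat_kernel (Ms ! 0) = mat_image (Ms ! 1)"
    and "mat_kernel (Ms ! 1) = mat_image (Ms ! 2)"
    and "mat_kernel (Ms ! 2) = {0\<^sub>v 3}"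
proof -
  note mult = aci_mats_mult[of _ \<alpha> \<beta> \<gamma> \<xi> \<eta> \<zeta>, folded Ms_def]
  note carr = aci_mats_carrier[of \<alpha> \<beta> \<gamma> \<xi> \<eta> \<zeta>, folded Ms_def]
  show "mat_kernel (Ms ! 0) = mat_image (Ms ! 1)"
  proof (rule mat_kernel_eq_mat_image[OF carr(1,2)])
    fix w :: "'a vec" assume w: "w \<in> carrier_vec 6"
    then have c: "Ms ! 1 *\<^sub>v w \<in> carrier_vec 4" using carr by simp
    show "Ms ! 0 *\<^sub>v (Ms ! 1 *\<^sub>v w) = 0\<^sub>v 1"
      unfolding mult(1)[OF c] zero_vec_list
      unfolding mult(2)[OF w] vec_of_list_index vec_of_list_eq_iff
      by (simp add: algebra_simps)
  next
    fix v :: "'a vec" assume v: "v \<in> carrier_vec 4" "Ms ! 0 *\<^sub>v v = 0\<^sub>v 1"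
    then have e: "\<alpha> * \<beta> * \<gamma> * v $ 0 + \<alpha> * \<xi> * v $ 1 + \<beta> * \<eta> * v $ 2 + \<gamma> * \<zeta> * v $ 3 = 0"
      unfolding mult(1)[OF v(1)] zero_vec_list vec_of_list_eq_iff by simp
    then obtain a b c where abc: "v $ 0 = \<xi> * a + \<eta> * b + \<zeta> * c" using colon by blast
    \<comment> \<open>\<open>colon\<close> places the first coordinate in
      \<open>(\<xi>, \<eta>, \<zeta>)\<close>; removing the corresponding boundary leaves a syzygy
      of \<open>\<alpha>\<xi>, \<beta>\<eta>, \<gamma>\<zeta>\<close> alone.\<close>
    have "\<alpha> * \<xi> * (v $ 1 + \<beta> * \<gamma> * a) + \<beta> * \<eta> * (v $ 2 + \<alpha> * \<gamma> * b) + \<gamma> * \<zeta> * (v $ 3 + \<alpha> * \<beta> * c) = 0"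
      (is "?lhs = 0")
    proof -
      have "?lhs = \<alpha> * \<beta> * \<gamma> * (\<xi> * a + \<eta> * b + \<zeta> * c) + \<alpha> * \<xi> * v $ 1 + \<beta> * \<eta> * v $ 2 + \<gamma> * \<zeta> * v $ 3"
        by (simp add: algebra_simps)
      then show ?thesis using e unfolding abc by simp
    qed
    from koszul3[OF this] obtain A B C where
      "v $ 1 + \<beta> * \<gamma> * a = \<beta> * \<eta> * A + \<gamma> * \<zeta> * B" "v $ 2 + \<alpha> * \<gamma> * b = - (\<alpha> * \<xi> * A) + \<gamma> * \<zeta> * C"
      "v $ 3 + \<alpha> * \<beta> * c = - (\<alpha> * \<xi> * B) - \<beta> * \<eta> * C" by blast
    then have "v $ 1 = \<beta> * \<eta> * A + \<gamma> * \<zeta> * B - \<beta> * \<gamma> * a" "v $ 2 = - (\<alpha> * \<xi> * A) + \<gamma> * \<zeta> * C - \<alpha> * \<gamma> * b"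
      "v $ 3 = - (\<alpha> * \<xi> * B) - \<beta> * \<eta> * C - \<alpha> * \<beta> * c" by (simp_all add: eq_diff_eq)
    moreover have w: "vec_of_list [A, B, C, a, b, c] \<in> carrier_vec 6" by (simp add: carrier_vecI)
    ultimately have "v = Ms ! 1 *\<^sub>v vec_of_list [A, B, C, a, b, c]"
      unfolding mult(2)[OF w] vec_of_list_index
      by (subst vec_list_expand(2)[OF v(1)]) (simp del: vec_of_list_Cons add: abc vec_of_list_eq_iff)
    with w show "\<exists>w\<in>carrier_vec 6. v = Ms ! 1 *\<^sub>v w" by blast
  qed
  show "mat_kernel (Ms ! 1) = mat_image (Ms ! 2)"
  proof (rule mat_kernel_eq_mat_image[OF carr(2,3)])
    fix w :: "'a vec" assume w: "w \<in> carrier_vec 3"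
    then have c: "Ms ! 2 *\<^sub>v w \<in> carrier_vec 6" using carr by simp
    show "Ms ! 1 *\<^sub>v (Ms ! 2 *\<^sub>v w) = 0\<^sub>v 4"
      unfolding mult(2)[OF c] zero_vec_list
      unfolding mult(3)[OF w] vec_of_list_index vec_of_list_eq_iff
      by (simp add: algebra_simps)
  next
    fix v :: "'a vec" assume v: "v \<in> carrier_vec 6" "Ms ! 1 *\<^sub>v v = 0\<^sub>v 4"
    then have e: "\<xi> * v $ 3 + \<eta> * v $ 4 + \<zeta> * v $ 5 = 0"
      "\<beta> * \<eta> * v $ 0 + \<gamma> * \<zeta> * v $ 1 - \<beta> * \<gamma> * v $ 3 = 0"
      "- (\<alpha> * \<xi> * v $ 0) + \<gamma> * \<zeta> * v $ 2 - \<alpha> * \<gamma> * v $ 4 = 0"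
      unfolding mult(2)[OF v(1)] zero_vec_list vec_of_list_eq_iff by simp_all
    from koszul3'[OF e(1)] obtain A B C where ABC: "v $ 3 = \<eta> * A + \<zeta> * B"
      "v $ 4 = - (\<xi> * A) + \<zeta> * C" "v $ 5 = - (\<xi> * B) - \<eta> * C" by blast
    \<comment> \<open>\<open>\<gamma> * A\<close> and \<open>\<beta> * B\<close> are what the
      comparison map predicts for \<open>v $ 0\<close> and \<open>v $ 1\<close>; the differences
      satisfy a Koszul relation.\<close>
    have "\<beta> * \<eta> * (v $ 0 - \<gamma> * A) + \<gamma> * \<zeta> * (v $ 1 - \<beta> * B) = 0"
      (is "?lhs = 0")
    proof -
      have "?lhs = \<beta> * \<eta> * v $ 0 + \<gamma> * \<zeta> * v $ 1 - \<beta> * \<gamma> * (\<eta> * A + \<zeta> * B)"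
        by (simp add: algebra_simps)
      then show ?thesis using e(2) unfolding ABC by simp
    qed
    from koszul2[OF this] obtain w where w: "v $ 0 - \<gamma> * A = \<gamma> * \<zeta> * w" "v $ 1 - \<beta> * B = - (\<beta> * \<eta> * w)" by blast
    have v01: "v $ 0 = \<gamma> * (A + \<zeta> * w)" "v $ 1 = \<beta> * (B - \<eta> * w)"
      using w[unfolded diff_eq_eq] by (simp_all add: distrib_left right_diff_distrib ac_simps)
    \<comment> \<open>Substituting \<open>v $ 0\<close> and \<open>v $ 4\<close> into the third row
      cancels the terms in \<open>A\<close>; what remains is a multiple of
      \<open>\<gamma> * \<zeta>\<close>, which can be cancelled.\<close>
    have "\<gamma> * (\<zeta> * (v $ 2 - \<alpha> * (C + \<xi> * w))) = 0"
      (is "?lhs = 0")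
    proof -
      have "?lhs = - (\<alpha> * \<xi> * (\<gamma> * (A + \<zeta> * w))) + \<gamma> * \<zeta> * v $ 2 - \<alpha> * \<gamma> * (- (\<xi> * A) + \<zeta> * C)"
        by (simp add: algebra_simps)
      then show ?thesis using e(3) unfolding ABC v01 by simp
    qed
    then have v2: "v $ 2 = \<alpha> * (C + \<xi> * w)" using nzd by (metis right_minus_eq)
    have u: "vec_of_list [C + \<xi> * w, B - \<eta> * w, A + \<zeta> * w] \<in> carrier_vec 3" by (simp add: carrier_vecI)
    have "v = Ms ! 2 *\<^sub>v vec_of_list [C + \<xi> * w, B - \<eta> * w, A + \<zeta> * w]"
      unfolding mult(3)[OF u] vec_of_list_index
      by (subst vec_list_expand(3)[OF v(1)], unfold vec_of_list_eq_iff v01 v2 ABC)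
        (simp add: algebra_simps)
    with u show "\<exists>w\<in>carrier_vec 3. v = Ms ! 2 *\<^sub>v w" by blast
  qed
  show "mat_kernel (Ms ! 2) = {0\<^sub>v 3}"
  proof -
    have "v = 0\<^sub>v 3" if v: "v \<in> carrier_vec 3" "Ms ! 2 *\<^sub>v v = 0\<^sub>v 6" for v
    proof -
      have "\<gamma> * v $ 2 = 0" "\<beta> * v $ 1 = 0" "\<alpha> * v $ 0 = 0"
        using v(2) unfolding mult(3)[OF v(1)] zero_vec_list vec_of_list_eq_iff by simp_all
      then have "v $ 2 = 0" "v $ 1 = 0" "v $ 0 = 0" using nzd by blast+
      then show ?thesis by (subst vec_list_expand(1)[OF v(1)]) (simp add: zero_vec_list)
    qed
    moreover have "Ms ! 2 *\<^sub>v 0\<^sub>v 3 = 0\<^sub>v 6"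
      unfolding mult(3)[OF zero_carrier_vec] by (simp add: zero_vec_list(4))
    ultimately show ?thesis by (auto simp: mat_kernel[OF carr(3)])
  qed
qed


section \<open>The resolution of four monomials\<close>

lemma monomial_division:
  fixes f :: "'k::field poly3"
  obtains q r where "f = monomial s * q + r" "\<And>t. t \<in> supp r \<Longrightarrow> t \<in> supp f \<and> \<not> adds s t"
proof -
  let ?S = "{t. adds s t}"
  obtain q where q: "part ?S f = monomial s * q"
    by (rule monomial_times_exists[of "part ?S f" s]) (auto simp: supp_part)
  have "f = monomial s * q + part (- ?S) f" using part_split[of f ?S] by (simp add: q)
  then show ?thesis by (rule that) (auto simp: supp_part)
qed

text \<open>At a monomial \<open>p + t\<close> with \<open>t\<close> in the support of
  \<open>f\<close>, the other three products have coefficient 0, so the coefficient of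
  \<open>f\<close> at \<open>t\<close> must vanish.\<close>

lemma monomial_times_eq_0_if_disjoint:
  fixes f u v w :: "'k::field poly3"
  assumes "monomial p * f + monomial q * u + monomial r * v + monomial s * w = 0"
    and "\<And>t. t \<in> supp f \<Longrightarrow> \<not> adds q (p + t) \<and> \<not> adds r (p + t) \<and> \<not> adds s (p + t)"
  shows "f = 0"
proof (rule ccontr)
  assume "f \<noteq> 0"
  then obtain t where t: "t \<in> supp f" by (meson ex_in_conv keys_eq_empty)
  have "coef (monomial p * f + monomial q * u + monomial r * v + monomial s * w) (p + t) = coef f t"
    using assms(2)[OF t] by (simp add: lookup_add coef_monomial_times_not_adds)
  then show False using t by (simp add: assms(1) in_keys_iff)
qed

text \<open>\<open>pq\<close> expresses that the two monomials are coprime. After division of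
  \<open>f\<close> by \<open>q\<close>, the remainder times \<open>p\<close> contains no multiple of
  \<open>q\<close>, so it vanishes.\<close>

lemma koszul2_monomials:
  fixes f g :: "'k::field poly3"
  assumes 0: "monomial p * f + monomial q * g = 0"
    and pq: "\<And>t. adds q (p + t) \<Longrightarrow> adds q t"
  shows "\<exists>w. f = monomial q * w \<and> g = - (monomial p * w)"
proof -
  obtain w r where w: "f = monomial q * w + r" and r: "\<And>t. t \<in> supp r \<Longrightarrow> t \<in> supp f \<and> \<not> adds q t"
    using monomial_division[of f q] by blast
  have e: "monomial p * r + monomial q * (g + monomial p * w) = 0"
    using 0 unfolding w by (simp add: algebra_simps)
  then have "r = 0"
    \<comment> \<open>The third and fourth summands are zero multiples of \<open>monomial q\<close>,
      so they add no new condition on the support.\<close>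
    using monomial_times_eq_0_if_disjoint[of p r q "g + monomial p * w" q 0 q 0] r pq by auto
  with e w show ?thesis by (auto simp: eq_neg_iff_add_eq_0)
qed

text \<open>Division of \<open>f\<close> by \<open>q\<close> and then by \<open>r\<close> leaves a
  remainder that must vanish, which reduces the relation to one between two coprime
  monomials.\<close>

lemma koszul3_monomials:
  fixes f g h :: "'k::field poly3"
  assumes 0: "monomial p * f + monomial q * g + monomial r * h = 0"
    and pqr: "\<And>t. adds q (p + t) \<Longrightarrow> adds q t" "\<And>t. adds r (p + t) \<Longrightarrow> adds r t"
      "\<And>t. adds r (q + t) \<Longrightarrow> adds r t"
  shows "\<exists>a b c. f = monomial q * a + monomial r * b \<and> g = - (monomial p * a) + monomial r * c
    \<and> h = - (monomial p * b) - monomial q * c"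
proof -
  obtain a u where a: "f = monomial q * a + u" and u: "\<And>t. t \<in> supp u \<Longrightarrow> t \<in> supp f \<and> \<not> adds q t"
    using monomial_division[of f q] by blast
  obtain b v where b: "u = monomial r * b + v" and v: "\<And>t. t \<in> supp v \<Longrightarrow> t \<in> supp u \<and> \<not> adds r t"
    using monomial_division[of u r] by blast
  have e: "monomial p * v + monomial q * (g + monomial p * a) + monomial r * (h + monomial p * b) = 0"
    using 0 unfolding a b by (simp add: algebra_simps)
  have "v = 0"
  proof (rule monomial_times_eq_0_if_disjoint)
    show "monomial p * v + monomial q * (g + monomial p * a) + monomial r * (h + monomial p * b) + monomial q * 0 = 0"
      using e by simp
  qed (use u v pqr in blast)
  with e have "monomial q * (g + monomial p * a) + monomial r * (h + monomial p * b) = 0" by simp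
  from koszul2_monomials[OF this pqr(3)] obtain c where
    "g + monomial p * a = monomial r * c" "h + monomial p * b = - (monomial q * c)" by blast
  moreover have "g = (g + monomial p * a) - monomial p * a" "h = (h + monomial p * b) - monomial p * b"
    by simp_all
  ultimately have "g = - (monomial p * a) + monomial r * c" "h = - (monomial p * b) - monomial q * c"
    by (simp_all only:) simp_all
  with a b \<open>v = 0\<close> show ?thesis by auto
qed

text \<open>By \<open>mult\<close>, the multiples of \<open>p\<close>, \<open>q\<close>,
  \<open>r\<close> in \<open>f\<close> can be absorbed into the terms with \<open>x\<close>,
  \<open>y\<close>, \<open>z\<close>. By \<open>xyz\<close>, \<open>m\<close> times the remaining
  part of \<open>f\<close> contains no multiple of \<open>x\<close>, \<open>y\<close> or
  \<open>z\<close>, so that part is 0.\<close>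

lemma colon_monomials:
  fixes f g h k :: "'k::field poly3"
  assumes 0: "monomial m * f + monomial x * g + monomial y * h + monomial z * k = 0"
    and xyz: "\<And>t. adds x (m + t) \<Longrightarrow> adds p t" "\<And>t. adds y (m + t) \<Longrightarrow> adds q t" "\<And>t. adds z (m + t) \<Longrightarrow> adds r t"
    and mult: "x + u = m + p" "y + v = m + q" "z + w = m + r"
  shows "\<exists>a b c. f = monomial p * a + monomial q * b + monomial r * c"
proof -
  obtain a f1 where a: "f = monomial p * a + f1" and f1: "\<And>t. t \<in> supp f1 \<Longrightarrow> t \<in> supp f \<and> \<not> adds p t"
    using monomial_division[of f p] by blast
  obtain b f2 where b: "f1 = monomial q * b + f2" and f2: "\<And>t. t \<in> supp f2 \<Longrightarrow> t \<in> supp f1 \<and> \<not> adds q t"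
    using monomial_division[of f1 q] by blast
  obtain c f3 where c: "f2 = monomial r * c + f3" and f3: "\<And>t. t \<in> supp f3 \<Longrightarrow> t \<in> supp f2 \<and> \<not> adds r t"
    using monomial_division[of f2 r] by blast
  have "monomial m * (monomial p * a) = monomial x * (monomial u * a)"
    "monomial m * (monomial q * b) = monomial y * (monomial v * b)"
    "monomial m * (monomial r * c) = monomial z * (monomial w * c)"
    unfolding mult.assoc[symmetric] monomial_mult mult by simp_all
  then have "monomial m * f3 + monomial x * (g + monomial u * a) + monomial y * (h + monomial v * b)
    + monomial z * (k + monomial w * c) = 0"
    using 0 unfolding a b c by (simp add: distrib_left ac_simps)
  then have "f3 = 0"
    by (rule monomial_times_eq_0_if_disjoint) (use f1 f2 f3 xyz in blast)
  with a b c show ?thesis by (auto simp: ac_simps)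
qed

text \<open>The ideals considered are generated by \<open>x\<^sup>a y\<^sup>b z\<^sup>c, x\<^bsup>a+e\<^esup>, y\<^bsup>b+f\<^esup>, z\<^bsup>c+g\<^esup>\<close>. The mapping cone resolves them even
  if some of \<open>a, b, c, e, f, g\<close> vanish; only minimality fails then.\<close>

definition aci_exponents :: "nat \<Rightarrow> nat \<Rightarrow> nat \<Rightarrow> nat \<Rightarrow> nat \<Rightarrow> nat \<Rightarrow> monom3 set" where
  "aci_exponents a b c e f g = {mono3 a b c, mono3 (a + e) 0 0, mono3 0 (b + f) 0, mono3 0 0 (c + g)}"

text \<open>The last row is the total \<open>(a + e) + (b + f) + (c + g)\<close> of the pure powers
  diminished by \<open>e\<close>, \<open>f\<close>, \<open>g\<close> in turn, written without
  subtraction.\<close>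

definition aci_degrees :: "nat \<Rightarrow> nat \<Rightarrow> nat \<Rightarrow> nat \<Rightarrow> nat \<Rightarrow> nat \<Rightarrow> int list list" where
  "aci_degrees a b c e f g = map (map int)
    [[0], [a + b + c, a + e, b + f, c + g],
     [(a + e) + (b + f), (a + e) + (c + g), (b + f) + (c + g), a + b + c + e, a + b + c + f, a + b + c + g],
     [a + (b + f) + (c + g), (a + e) + b + (c + g), (a + e) + (b + f) + c]]"

definition aci_resolution :: "nat \<Rightarrow> nat \<Rightarrow> nat \<Rightarrow> nat \<Rightarrow> nat \<Rightarrow> nat \<Rightarrow> 'k::field poly3 mat list" where
  "aci_resolution a b c e f g = aci_mats
    (monomial (mono3 a 0 0)) (monomial (mono3 0 b 0)) (monomial (mono3 0 0 c))
    (monomial (mono3 e 0 0)) (monomial (mono3 0 f 0)) (monomial (mono3 0 0 g))"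

lemma aci_resolution_graded:
  fixes a b c e f g :: nat
  defines "as \<equiv> aci_degrees a b c e f g" and "Ms \<equiv> aci_resolution a b c e f g"
  assumes "i < 3"
  shows "graded_map (as ! Suc i) (as ! i) (Ms ! i :: 'k::field poly3 mat)"
proof -
  have "i = 0 \<or> i = 1 \<or> i = 2" using assms by linarith
  moreover have "graded_map (as ! Suc 0) (as ! 0) (Ms ! 0)"
    by (auto simp: graded_map_def as_def Ms_def aci_degrees_def aci_resolution_def aci_mats_def
        mat_of_rows_list_def less_Suc_eq numeral_eq_Suc monomial_mult mono3_add
        intro!: homogeneous_uminus homogeneous_monomial)
  moreover have "graded_map (as ! Suc 1) (as ! 1) (Ms ! 1)"
    by (auto simp: graded_map_def as_def Ms_def aci_degrees_def aci_resolution_def aci_mats_def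
        mat_of_rows_list_def less_Suc_eq numeral_eq_Suc monomial_mult mono3_add
        intro!: homogeneous_uminus homogeneous_monomial)
  moreover have "graded_map (as ! Suc 2) (as ! 2) (Ms ! 2)"
    by (auto simp: graded_map_def as_def Ms_def aci_degrees_def aci_resolution_def aci_mats_def
        mat_of_rows_list_def less_Suc_eq numeral_eq_Suc monomial_mult mono3_add
        intro!: homogeneous_uminus homogeneous_monomial)
  ultimately show ?thesis by auto
qed

lemma aci_resolution_image:
  "mat_image (aci_resolution a b c e f g ! 0)
    = {v \<in> carrier_vec 1. v $ 0 \<in> (ideal_of (monomial ` aci_exponents a b c e f g) :: 'k::field poly3 set)}"
proof -
  let ?M = "aci_resolution a b c e f g ! 0 :: 'k poly3 mat"
  have c: "?M \<in> carrier_mat 1 4" unfolding aci_resolution_def by (rule aci_mats_carrier)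
  have J: "h \<in> ideal_of (monomial ` aci_exponents a b c e f g) \<longleftrightarrow>
    (\<exists>w x y z. h = monomial (mono3 a b c) * w + monomial (mono3 (a + e) 0 0) * x
      + monomial (mono3 0 (b + f) 0) * y + monomial (mono3 0 0 (c + g)) * z)" for h :: "'k poly3"
    by (simp add: aci_exponents_def ideal_of_insert ideal_of_empty algebra_simps)
  have M: "?M *\<^sub>v v = vec_of_list [monomial (mono3 a b c) * v $ 0 + monomial (mono3 (a + e) 0 0) * v $ 1
      + monomial (mono3 0 (b + f) 0) * v $ 2 + monomial (mono3 0 0 (c + g)) * v $ 3]"
    if "v \<in> carrier_vec 4" for v :: "'k poly3 vec"
    unfolding aci_resolution_def aci_mats_mult(1)[OF that] by (simp add: monomial_mult mono3_add)
  show ?thesis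
  proof (intro equalityI subsetI)
    fix u assume "u \<in> mat_image ?M"
    then obtain v where v: "v \<in> carrier_vec 4" "u = ?M *\<^sub>v v" using c by (auto simp: mat_image_def)
    then show "u \<in> {v \<in> carrier_vec 1. v $ 0 \<in> ideal_of (monomial ` aci_exponents a b c e f g)}"
      using c by (auto simp: M J)
  next
    fix u :: "'k poly3 vec"
    assume u: "u \<in> {v \<in> carrier_vec 1. v $ 0 \<in> ideal_of (monomial ` aci_exponents a b c e f g)}"
    then obtain w x y z where "u $ 0 = monomial (mono3 a b c) * w + monomial (mono3 (a + e) 0 0) * x
      + monomial (mono3 0 (b + f) 0) * y + monomial (mono3 0 0 (c + g)) * z" using J by auto
    moreover have v: "vec_of_list [w, x, y, z] \<in> carrier_vec 4" by (simp add: carrier_vecI)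
    ultimately have "u = ?M *\<^sub>v vec_of_list [w, x, y, z]"
      unfolding M[OF v] using u by (intro eq_vecI) (simp_all add: numeral_eq_Suc)
    with v c show "u \<in> mat_image ?M" by (auto simp: mat_image_def)
  qed
qed

lemma aci_resolution_exact:
  fixes a b c e f g :: nat
  defines "Ms \<equiv> aci_resolution a b c e f g :: 'k::field poly3 mat list"
  shows "mat_kernel (Ms ! 0) = mat_image (Ms ! 1)"
    and "mat_kernel (Ms ! 1) = mat_image (Ms ! 2)"
    and "mat_kernel (Ms ! 2) = {0\<^sub>v 3}"
proof -
  let ?\<alpha> = "monomial (mono3 a 0 0) :: 'k poly3" and ?\<beta> = "monomial (mono3 0 b 0) :: 'k poly3"
    and ?\<gamma> = "monomial (mono3 0 0 c) :: 'k poly3" and ?\<xi> = "monomial (mono3 e 0 0) :: 'k poly3"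
    and ?\<eta> = "monomial (mono3 0 f 0) :: 'k poly3" and ?\<zeta> = "monomial (mono3 0 0 g) :: 'k poly3"
  have prods: "?\<alpha> * ?\<beta> * ?\<gamma> = monomial (mono3 a b c)" "?\<alpha> * ?\<xi> = monomial (mono3 (a + e) 0 0)"
    "?\<beta> * ?\<eta> = monomial (mono3 0 (b + f) 0)" "?\<gamma> * ?\<zeta> = monomial (mono3 0 0 (c + g))"
    by (simp_all add: monomial_mult mono3_add)
  have nzd: "\<And>h. ?\<alpha> * h = 0 \<Longrightarrow> h = 0" "\<And>h. ?\<beta> * h = 0 \<Longrightarrow> h = 0" "\<And>h. ?\<gamma> * h = 0 \<Longrightarrow> h = 0"
    "\<And>h. ?\<zeta> * h = 0 \<Longrightarrow> h = 0" by simp_all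
  have k2: "\<exists>w. u = ?\<gamma> * ?\<zeta> * w \<and> v = - (?\<beta> * ?\<eta> * w)" if "?\<beta> * ?\<eta> * u + ?\<gamma> * ?\<zeta> * v = 0" for u v
    using that unfolding prods by (rule koszul2_monomials) (simp add: adds_mono3_iff lookup_add)
  have k3: "\<exists>p q r. u = ?\<beta> * ?\<eta> * p + ?\<gamma> * ?\<zeta> * q \<and> v = - (?\<alpha> * ?\<xi> * p) + ?\<gamma> * ?\<zeta> * r
    \<and> w = - (?\<alpha> * ?\<xi> * q) - ?\<beta> * ?\<eta> * r"
    if "?\<alpha> * ?\<xi> * u + ?\<beta> * ?\<eta> * v + ?\<gamma> * ?\<zeta> * w = 0" for u v w
    using that unfolding prods by (rule koszul3_monomials) (simp_all add: adds_mono3_iff lookup_add)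
  have k3': "\<exists>p q r. u = ?\<eta> * p + ?\<zeta> * q \<and> v = - (?\<xi> * p) + ?\<zeta> * r \<and> w = - (?\<xi> * q) - ?\<eta> * r"
    if "?\<xi> * u + ?\<eta> * v + ?\<zeta> * w = 0" for u v w
    using that by (rule koszul3_monomials) (simp_all add: adds_mono3_iff lookup_add)
  have colon: "\<exists>p q r. u = ?\<xi> * p + ?\<eta> * q + ?\<zeta> * r"
    if "?\<alpha> * ?\<beta> * ?\<gamma> * u + ?\<alpha> * ?\<xi> * v + ?\<beta> * ?\<eta> * w + ?\<gamma> * ?\<zeta> * x = 0" for u v w x
    using that unfolding prods
    \<comment> \<open>The witnesses are cofactors:
      \<open>x^a y^b z^c * x^e = x^(a+e) * y^b z^c\<close>, and similarly for \<open>y\<close> and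
      \<open>z\<close>.\<close>
    by (rule colon_monomials[where u = "mono3 0 b c" and v = "mono3 a 0 c" and w = "mono3 a b 0"])
      (simp_all add: adds_mono3_iff lookup_add mono3_add)
  note exact = aci_mats_exact[OF nzd k2 k3 k3' colon, folded aci_resolution_def, folded Ms_def]
  show "mat_kernel (Ms ! 0) = mat_image (Ms ! 1)"
    "mat_kernel (Ms ! 1) = mat_image (Ms ! 2)" "mat_kernel (Ms ! 2) = {0\<^sub>v 3}"
    by (rule exact; assumption)+
qed

lemma aci_resolution_is_resolution:
  "graded_free_resolution (ideal_of (monomial ` aci_exponents a b c e f g) :: 'k::field poly3 set)
    (aci_degrees a b c e f g) (aci_resolution a b c e f g)"
proof -
  let ?as = "aci_degrees a b c e f g" and ?Ms = "aci_resolution a b c e f g :: 'k poly3 mat list"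
  let ?J = "ideal_of (monomial ` aci_exponents a b c e f g) :: 'k poly3 set"
  have len: "length ?as = 4" "length ?Ms = 3" by (simp_all add: aci_degrees_def aci_resolution_def aci_mats_def)
  have ne: "?as ! 0 = [0]" "[] \<notin> set ?as" "length (?as ! 3) = 3" by (auto simp: aci_degrees_def)
  have "cycles_at ?J ?Ms i = boundaries_at ?as ?Ms i" if "i < 4" for i
  proof -
    have "i = 0 \<or> i = 1 \<or> i = 2 \<or> i = 3" using that by linarith
    then show ?thesis
      using aci_resolution_exact[where ?'k = 'k, of a b c e f g] aci_resolution_image[where ?'k = 'k, of a b c e f g] len ne
      by (auto simp: cycles_at_def boundaries_at_def)
  qed
  then show ?thesis
    using aci_resolution_graded ne len unfolding graded_free_resolution_def by auto
qed

text \<open>Up to sign all nonzero entries are products of the six monomials, and each of the six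
  occurs by itself in the last matrix. So minimality means that none of them is 1.\<close>

lemma aci_resolution_minimal_iff:
  "minimal_graded_free_resolution (ideal_of (monomial ` aci_exponents a b c e f g) :: 'k::field poly3 set)
    (aci_degrees a b c e f g) (aci_resolution a b c e f g)
   \<longleftrightarrow> 0 < a \<and> 0 < b \<and> 0 < c \<and> 0 < e \<and> 0 < f \<and> 0 < g" (is "?L \<longleftrightarrow> ?R")
proof -
  have mon: "(monomial t :: 'k poly3) \<in> irrelevant_ideal \<longleftrightarrow> t \<noteq> 0" 
    "- (monomial t :: 'k poly3) \<in> irrelevant_ideal \<longleftrightarrow> t \<noteq> 0" for t
    by (simp_all add: irrelevant_ideal_iff coef_monomial)
  have z: "(0 :: 'k poly3) \<in> irrelevant_ideal" by (simp add: irrelevant_ideal_iff)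
  have "?L \<longleftrightarrow> (\<forall>M\<in>set (aci_resolution a b c e f g :: 'k poly3 mat list). elements_mat M \<subseteq> irrelevant_ideal)"
    by (simp add: minimal_graded_free_resolution_def aci_resolution_is_resolution)
  also have "\<dots> \<longleftrightarrow> ?R"
    unfolding aci_resolution_def aci_mats_def
    by (auto simp: elements_mat_def mat_of_rows_list_def atLeast0_lessThan_Suc numeral_eq_Suc monomial_mult mono3_add mon z)
  finally show ?thesis .
qed


section \<open>Artinian monomial ideals\<close>

lemma exact_complex_mem_iff:
  assumes ex: "exact_complex I a M"
  shows "h \<in> I \<longleftrightarrow> (\<exists>v\<in>carrier_vec (length (a 1)). h = (\<Sum>k<length (a 1). M 0 $$ (0, k) * v $ k))"
proof -
  have c: "M 0 \<in> carrier_mat 1 (length (a 1))"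
    using exact_complexD(2)[OF ex, of 0] exact_complexD(4)[OF ex] by simp
  have im: "mat_image (M 0) = {v \<in> carrier_vec 1. v $ 0 \<in> I}" using ex by (simp add: exact_complex_def)
  have m: "M 0 *\<^sub>v v = vec 1 (\<lambda>_. \<Sum>k<length (a 1). M 0 $$ (0, k) * v $ k)" if "v \<in> carrier_vec (length (a 1))" for v
    using that c by (intro eq_vecI) (auto simp: scalar_prod_def lessThan_atLeast0)
  have "h \<in> I \<longleftrightarrow> vec 1 (\<lambda>_. h) \<in> mat_image (M 0)" by (simp add: im)
  also have "\<dots> \<longleftrightarrow> (\<exists>v\<in>carrier_vec (length (a 1)). vec 1 (\<lambda>_. h) = M 0 *\<^sub>v v)"
    using c by (auto simp: mat_image_def)
  also have "\<dots> \<longleftrightarrow> (\<exists>v\<in>carrier_vec (length (a 1)). h = (\<Sum>k<length (a 1). M 0 $$ (0, k) * v $ k))"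
  proof (rule bex_cong[OF refl])
    fix v :: "'a poly3 vec" assume v: "v \<in> carrier_vec (length (a 1))"
    show "vec 1 (\<lambda>_. h) = M 0 *\<^sub>v v \<longleftrightarrow> h = (\<Sum>k<length (a 1). M 0 $$ (0, k) * v $ k)"
      unfolding m[OF v] by (simp add: vec_eq_iff)
  qed
  finally show ?thesis .
qed

text \<open>The entries of \<open>M 0\<close> are homogeneous generators of \<open>I\<close>, so a
  component of a combination is again a combination.\<close>

lemma exact_complex_hcomp_mem:
  assumes ex: "exact_complex I a M" and h: "h \<in> I"
  shows "hcomp n h \<in> I"
proof -
  obtain v where v: "v \<in> carrier_vec (length (a 1))" "h = (\<Sum>k<length (a 1). M 0 $$ (0, k) * v $ k)"
    using h exact_complex_mem_iff[OF ex] by blast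
  have g: "homogeneous (a 1 ! k) (M 0 $$ (0, k))" if "k < length (a 1)" for k
    using graded_mapD(2)[OF exact_complexD(1)[OF ex, of 0], of 0 k] that exact_complexD(4)[OF ex] by simp
  have "hcomp n h = (\<Sum>k<length (a 1). hcomp n (M 0 $$ (0, k) * v $ k))"
    unfolding v(2) by (simp add: hcomp_def part_sum)
  also have "\<dots> = (\<Sum>k<length (a 1). M 0 $$ (0, k) * vec (length (a 1)) (\<lambda>k. hcomp (n - a 1 ! k) (v $ k)) $ k)"
    by (intro sum.cong refl) (simp add: hcomp_times[OF g])
  finally show ?thesis unfolding exact_complex_mem_iff[OF ex] by (rule bexI) simp
qed

text \<open>For an indeterminate \<open>v\<close> the chain \<open>I + (v^n)\<close> stabilizes,
  giving \<open>v^m = i + v^(m+1) * g\<close> with \<open>i\<close> in \<open>I\<close>. The last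
  term has no component of degree \<open>m\<close>, so \<open>v^m\<close> is a component of
  \<open>i\<close>.\<close>

lemma artinian_homogeneous_contains_power:
  fixes I :: "'k::field poly3 set"
  assumes I: "is_ideal I" and art: "artinian_quotient I"
    and hom: "\<And>f n. f \<in> I \<Longrightarrow> hcomp n f \<in> I"
  obtains N where "monomial (Poly_Mapping.single v N) \<in> I"
proof -
  let ?x = "\<lambda>n. monomial (Poly_Mapping.single v n) :: 'k poly3"
  define F where "F n = {f. \<exists>i\<in>I. \<exists>g. f = i + ?x n * g}" for n
  have x_Suc: "?x (Suc n) = ?x n * ?x 1" for n by (simp add: monomial_mult single_add[symmetric])
  have "is_ideal (F n)" for n
  proof (rule is_idealI)
    show "0 \<in> F n" unfolding F_def using is_ideal_zero[OF I] by (auto intro!: bexI[of _ 0] exI[of _ 0])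
    show "f + g \<in> F n" if fg: "f \<in> F n" "g \<in> F n" for f g
    proof -
      obtain i h j k where "i \<in> I" "f = i + ?x n * h" "j \<in> I" "g = j + ?x n * k"
        using fg unfolding F_def by blast
      then have "i + j \<in> I" "f + g = (i + j) + ?x n * (h + k)"
        using is_ideal_add[OF I] by (simp_all add: algebra_simps)
      then show ?thesis unfolding F_def by blast
    qed
    show "g * f \<in> F n" if f: "f \<in> F n" for f g
    proof -
      obtain i h where "i \<in> I" "f = i + ?x n * h" using f unfolding F_def by blast
      moreover from this have "g * i \<in> I" by (intro is_ideal_times[OF I])
      moreover have "g * (i + ?x n * h) = g * i + ?x n * (g * h)" by (simp add: algebra_simps)
      ultimately show ?thesis unfolding F_def by blast
    qed
  qed
  moreover have "I \<subseteq> F n" for n unfolding F_def by (force intro: exI[of _ 0])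
  moreover have "F (Suc n) \<subseteq> F n" for n unfolding F_def x_Suc by (auto simp: mult.assoc)
  ultimately obtain m where m: "\<And>n. n \<ge> m \<Longrightarrow> F n = F m"
    using art unfolding artinian_quotient_def by blast
  have "?x m \<in> F m" unfolding F_def using is_ideal_zero[OF I] by (auto intro!: bexI[of _ 0] exI[of _ 1])
  then have "?x m \<in> F (Suc m)" using m[of "Suc m"] by simp
  then obtain i g where i: "i \<in> I" "?x m = i + ?x (Suc m) * g" unfolding F_def by blast
  have deg: "mdeg (Poly_Mapping.single v n) = n" for n by (simp add: mdeg_def)
  have "hcomp (int m) (?x (Suc m) * g) = 0"
  proof -
    have "hcomp (- 1) g = 0" by (simp add: hcomp_def part_eq_0_iff)
    then show ?thesis
      by (simp add: hcomp_times[OF homogeneous_monomial, of "int (Suc m)"] deg)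
  qed
  then have "hcomp (int m) i = ?x m"
    using i(2) homogeneous_monomial[of "int m" "Poly_Mapping.single v m"]
    by (metis add.right_neutral deg hcomp_def homogeneous_iff_hcomp part_add)
  then have "?x m \<in> I" using hom[OF i(1)] by metis
  then show ?thesis by (rule that)
qed

section \<open>Artinian quotients from finitely many standard monomials\<close>

lemma coef_const_times: "coef (Poly_Mapping.single 0 c * f) t = c * coef f t" for f :: "'k::field poly3"
proof -
  have "coef (f * Poly_Mapping.single 0 c) t = Sum_any (\<lambda>l. (c * coef f t when t = l))"
    unfolding lookup_mult
  proof (rule Sum_any.cong)
    fix l :: monom3
    have "Sum_any (\<lambda>q. coef (Poly_Mapping.single 0 c) q when t = l + q) = Sum_any (\<lambda>q::monom3. (c when t = l) when 0 = q)"
      by (rule Sum_any.cong) (auto simp: lookup_single when_def)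
    then show "coef f l * Sum_any (\<lambda>q. coef (Poly_Mapping.single 0 c) q when t = l + q) = (c * coef f t when t = l)"
      by (simp add: when_def)
  qed
  then show ?thesis by (simp add: mult.commute[of f])
qed

text \<open>The subspaces of polynomials without \<open>b\<close> stabilize by induction. Either
  some \<open>V k\<close> avoids \<open>b\<close> entirely, or every \<open>V n\<close> has an
  element \<open>g\<close> with nonzero coefficient at \<open>b\<close>; subtracting a multiple of
  \<open>g\<close> moves any member of \<open>V m\<close> into the stable subspaces, and adding it
  back shows membership in \<open>V n\<close>.\<close>

lemma descending_subspaces_stabilize:
  fixes V :: "nat \<Rightarrow> 'k::field poly3 set"
  assumes "finite B"
    and "\<And>n f g. f \<in> V n \<Longrightarrow> g \<in> V n \<Longrightarrow> f + g \<in> V n"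
    and "\<And>n f c. f \<in> V n \<Longrightarrow> Poly_Mapping.single 0 c * f \<in> V n"
    and "\<And>n. V (Suc n) \<subseteq> V n" and "\<And>n. 0 \<in> V n" and "\<And>n f. f \<in> V n \<Longrightarrow> supp f \<subseteq> B"
  shows "\<exists>m. \<forall>n\<ge>m. V n = V m"
  using assms
proof (induction B arbitrary: V rule: finite_induct)
  case empty
  have "f = 0" if "f \<in> V n" for f n using empty.prems(5)[OF that] by simp
  then have "V n = {0}" for n using empty.prems(4)[of n] by auto
  then show ?case by simp
next
  case (insert b B)
  note add = insert.prems(1) and scale = insert.prems(2) and dec = insert.prems(3)
    and zero = insert.prems(4) and sup = insert.prems(5)
  have mono: "V n \<subseteq> V m" if "m \<le> n" for m n
    using that by (induction rule: dec_induct) (use dec in auto)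
  let ?W = "\<lambda>n. {f \<in> V n. coef f b = 0}"
  have "\<exists>m. \<forall>n\<ge>m. ?W n = ?W m"
  proof (rule insert.IH)
    show "supp f \<subseteq> B" if "f \<in> ?W n" for n f
      using that sup[of f n] by (auto simp: in_keys_iff)
    show "?W (Suc n) \<subseteq> ?W n" for n using dec[of n] by blast
  qed (use add scale zero in \<open>auto simp: lookup_add coef_const_times\<close>)
  then obtain m where m: "\<And>n. n \<ge> m \<Longrightarrow> ?W n = ?W m" by blast
  show ?case
  proof (cases "\<exists>k. \<forall>f\<in>V k. coef f b = 0")
    case True
    then obtain k where k: "\<And>f. f \<in> V k \<Longrightarrow> coef f b = 0" by blast
    have eq: "V n = ?W m" if "n \<ge> max m k" for n
      using k mono[of k n] m[of n] that by auto
    have "V n = V (max m k)" if "n \<ge> max m k" for n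
      by (rule trans[OF eq[OF that] eq[OF order_refl, symmetric]])
    then show ?thesis by blast
  next
    case False
    have "V m \<subseteq> V n" if "n \<ge> m" for n
    proof
      fix f assume f: "f \<in> V m"
      obtain g where g: "g \<in> V n" "coef g b \<noteq> 0" using False by blast
      let ?c = "coef f b / coef g b"
      have "f + Poly_Mapping.single 0 (- ?c) * g \<in> V m"
        using f g mono[OF that] by (intro add scale) auto
      moreover have "coef (f + Poly_Mapping.single 0 (- ?c) * g) b = 0"
        using g by (simp add: lookup_add coef_const_times)
      ultimately have "f + Poly_Mapping.single 0 (- ?c) * g \<in> V n" using m[OF that] by auto
      then have "(f + Poly_Mapping.single 0 (- ?c) * g) + Poly_Mapping.single 0 ?c * g \<in> V n"
        by (rule add) (rule scale[OF g(1)])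
      moreover have "(f + Poly_Mapping.single 0 (- ?c) * g) + Poly_Mapping.single 0 ?c * g = f"
        by (rule poly_mapping_eqI) (simp add: lookup_add coef_const_times)
      ultimately show "f \<in> V n" by (simp only:)
    qed
    with mono show ?thesis by (meson subset_antisym)
  qed
qed

text \<open>An ideal containing the monomial ideal is determined by its members supported on the
  finitely many monomials outside, and these form a finite-dimensional space.\<close>

lemma artinian_if_cofinite_monomials:
  assumes fin: "finite {t. \<not> (\<exists>s\<in>T. adds s t)}"
  shows "artinian_quotient (ideal_of (monomial ` T) :: 'k::field poly3 set)"
  unfolding artinian_quotient_def
proof (intro allI impI)
  fix F :: "nat \<Rightarrow> 'k poly3 set"
  let ?J = "ideal_of (monomial ` T) :: 'k poly3 set" and ?B = "{t. \<not> (\<exists>s\<in>T. adds s t)}"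
  assume F: "\<forall>n. is_ideal (F n) \<and> ?J \<subseteq> F n \<and> F (Suc n) \<subseteq> F n"
  then have id: "\<And>n. is_ideal (F n)" and J: "\<And>n. ?J \<subseteq> F n" and dec: "\<And>n. F (Suc n) \<subseteq> F n" by auto
  let ?V = "\<lambda>n. {f \<in> F n. supp f \<subseteq> ?B}"
  have supp_scale: "supp (Poly_Mapping.single 0 c * f) \<subseteq> supp f" for c and f :: "'k poly3"
    by (auto simp: in_keys_iff coef_const_times)
  have "\<exists>m. \<forall>n\<ge>m. ?V n = ?V m"
  proof (rule descending_subspaces_stabilize[OF fin])
    show "f + g \<in> ?V n" if "f \<in> ?V n" "g \<in> ?V n" for n f g
    proof -
      have "supp (f + g) \<subseteq> ?B" using that by (intro subset_trans[OF keys_add] Un_least) simp_all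
      with that show ?thesis by (simp add: is_ideal_add[OF id])
    qed
    show "Poly_Mapping.single 0 c * f \<in> ?V n" if "f \<in> ?V n" for n f c
    proof -
      have "supp (Poly_Mapping.single 0 c * f) \<subseteq> ?B"
        using that by (intro subset_trans[OF supp_scale]) simp
      with that show ?thesis by (simp add: is_ideal_times[OF id])
    qed
    show "?V (Suc n) \<subseteq> ?V n" for n using dec by blast
    show "0 \<in> ?V n" for n using is_ideal_zero[OF id] by simp
  qed blast
  then obtain m where m: "\<And>n. n \<ge> m \<Longrightarrow> ?V n = ?V m" by blast
  have eqv: "f \<in> F n \<longleftrightarrow> part ?B f \<in> ?V n" for f n
  proof -
    have "part (- ?B) f \<in> ?J" by (auto simp: ideal_of_monomials supp_part)
    then have p: "part (- ?B) f \<in> F n" using J by blast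
    have d: "f - part (- ?B) f = part ?B f" unfolding diff_eq_eq by (rule part_split)
    have "part ?B f \<in> F n" if "f \<in> F n" using is_ideal_diff[OF id that p] unfolding d .
    moreover have "f \<in> F n" if "part ?B f \<in> F n"
      using is_ideal_add[OF id that p] unfolding part_split[symmetric] .
    moreover have "supp (part ?B f) \<subseteq> ?B" by (simp add: supp_part)
    ultimately show ?thesis by blast
  qed
  have "F n = F m" if "n \<ge> m" for n
  proof (rule Set.set_eqI)
    fix f
    show "f \<in> F n \<longleftrightarrow> f \<in> F m" using eqv[of f n] eqv[of f m] unfolding m[OF that] by blast
  qed
  then show "\<exists>m. \<forall>n\<ge>m. F n = F m" by blast
qed

lemma finite_not_adds:
  assumes "mono3 p 0 0 \<in> T" "mono3 0 q 0 \<in> T" "mono3 0 0 r \<in> T"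
  shows "finite {t. \<not> (\<exists>s\<in>T. adds s t)}"
proof (rule finite_subset)
  show "{t. \<not> (\<exists>s\<in>T. adds s t)} \<subseteq> (\<lambda>(i, j, k). mono3 i j k) ` ({..p} \<times> {..q} \<times> {..r})"
  proof
    fix t assume "t \<in> {t. \<not> (\<exists>s\<in>T. adds s t)}"
    then have "\<not> adds (mono3 p 0 0) t" "\<not> adds (mono3 0 q 0) t" "\<not> adds (mono3 0 0 r) t" using assms by auto
    then have "(coef t Ind_x, coef t Ind_y, coef t Ind_z) \<in> {..p} \<times> {..q} \<times> {..r}"
      by (simp add: adds_mono3_iff)
    then show "t \<in> (\<lambda>(i, j, k). mono3 i j k) ` ({..p} \<times> {..q} \<times> {..r})"
      by (rule rev_image_eqI) (simp add: mono3_coef)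
  qed
qed simp

text \<open>Reading off the coefficient at a minimal monomial of \<open>J\<close> is linear over \<open>R\<close>, acting through the
  constant term. So the minimal monomials are linearly independent in \<open>J / (x,y,z) J\<close>.\<close>

lemma card_minimal_monomials_le:
  fixes J :: "'k::field poly3 set"
  assumes ex: "exact_complex J a M" and J: "\<And>f. f \<in> J \<longleftrightarrow> supp f \<subseteq> U"
    and S: "finite S" "S \<subseteq> U" "\<And>s t. s \<in> S \<Longrightarrow> t \<in> U \<Longrightarrow> adds t s \<Longrightarrow> t = s"
  shows "card S \<le> length (a 1)"
proof -
  have "\<exists>v. monomial s = (\<Sum>k<length (a 1). M 0 $$ (0, k) * v $ k)" if "s \<in> S" for s
  proof -
    have "monomial s \<in> J" using that S(2) by (auto simp: J)
    then show ?thesis using exact_complex_mem_iff[OF ex] by blast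
  qed
  then have "\<forall>s\<in>S. \<exists>v. monomial s = (\<Sum>k<length (a 1). M 0 $$ (0, k) * v $ k)" by blast
  from bchoice[OF this] obtain v where
    v: "\<And>s. s \<in> S \<Longrightarrow> monomial s = (\<Sum>k<length (a 1). M 0 $$ (0, k) * v s $ k)" by blast
  have gens: "supp (M 0 $$ (0, k)) \<subseteq> U" if "k < length (a 1)" for k
  proof -
    have "M 0 $$ (0, k) = (\<Sum>j<length (a 1). M 0 $$ (0, j) * unit_vec (length (a 1)) k $ j)"
      using that by (simp add: unit_vec_def if_distrib[of "(*) _"] cong: if_cong)
    then have "M 0 $$ (0, k) \<in> J" unfolding exact_complex_mem_iff[OF ex] by (rule bexI) (rule unit_vec_carrier)
    then show ?thesis by (simp add: J)
  qed
  have "card S \<le> card {..<length (a 1)}"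
  proof (rule card_le_if_factor_identity)
    fix s s' assume s: "s \<in> S" "s' \<in> S"
    have "coef (M 0 $$ (0, k)) s * coef (v s' $ k) 0 = coef (M 0 $$ (0, k) * v s' $ k) s" if "k < length (a 1)" for k
    proof -
      have "coef (v s' $ k * M 0 $$ (0, k)) s = coef (v s' $ k) 0 * coef (M 0 $$ (0, k)) s"
      proof (rule coef_times_eq)
        fix l q assume "s = l + q" "q \<in> supp (M 0 $$ (0, k))"
        then show "q = s" using S(3)[OF s(1), of q] gens[OF that] by (metis add.commute adds_add subsetD)
      qed
      then show ?thesis by (simp add: mult.commute)
    qed
    then have "(\<Sum>k<length (a 1). coef (M 0 $$ (0, k)) s * coef (v s' $ k) 0) = coef (monomial s' :: 'k poly3) s"
      by (simp add: v[OF s(2)] lookup_sum)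
    then show "(\<Sum>k<length (a 1). coef (M 0 $$ (0, k)) s * coef (v s' $ k) 0) = (if s = s' then 1 else 0)"
      by (auto simp: coef_monomial)
  qed (use S in auto)
  then show ?thesis by simp
qed

lemma single_eq_mono3:
  "Poly_Mapping.single Ind_x n = mono3 n 0 0" "Poly_Mapping.single Ind_y n = mono3 0 n 0"
  "Poly_Mapping.single Ind_z n = mono3 0 0 n"
  by (simp_all add: mono3_def)

text \<open>The least pure powers are minimal monomials, and any monomial they fail to generate
  yields a fourth minimal one. A fifth would exceed the rank 4 of the first module.\<close>

lemma monomial_ideal_four_generators:
  fixes J :: "'k::field poly3 set"
  assumes mon: "monomial_ideal J" and art: "artinian_quotient J"
    and ex: "exact_complex J a M" and len: "length (a 1) = 4" and proper: "1 \<notin> J"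
  obtains a b c e f g where "J = ideal_of (monomial ` aci_exponents a b c e f g)"
proof -
  obtain T where JT: "J = ideal_of (monomial ` T)" using mon by (auto simp: monomial_ideal_def)
  define U where "U = {t. \<exists>s\<in>T. adds s t}"
  have J: "h \<in> J \<longleftrightarrow> supp h \<subseteq> U" for h by (auto simp: JT ideal_of_monomials U_def)
  have mU: "monomial t \<in> J \<longleftrightarrow> t \<in> U" for t by (simp add: J)
  have up: "t \<in> U" if "s \<in> U" "adds s t" for s t using that adds_trans unfolding U_def by blast
  have "0 \<notin> U" using proper mU[of 0] by simp
  have id: "is_ideal J" by (simp add: JT)
  note pow = artinian_homogeneous_contains_power[OF id art exact_complex_hcomp_mem[OF ex]]
  have ex_pow: "\<exists>n. mono3 n 0 0 \<in> U" "\<exists>n. mono3 0 n 0 \<in> U" "\<exists>n. mono3 0 0 n \<in> U"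
    using pow[of Ind_x] pow[of Ind_y] pow[of Ind_z] by (metis mU single_eq_mono3)+
  define p q r where "p = (LEAST n. mono3 n 0 0 \<in> U)" and "q = (LEAST n. mono3 0 n 0 \<in> U)"
    and "r = (LEAST n. mono3 0 0 n \<in> U)"
  let ?A = "{mono3 p 0 0, mono3 0 q 0, mono3 0 0 r}"
  have A: "mono3 p 0 0 \<in> U" "mono3 0 q 0 \<in> U" "mono3 0 0 r \<in> U"
    unfolding p_def q_def r_def using ex_pow by (auto intro: LeastI_ex)
  have least: "\<And>n. mono3 n 0 0 \<in> U \<Longrightarrow> p \<le> n" "\<And>n. mono3 0 n 0 \<in> U \<Longrightarrow> q \<le> n" "\<And>n. mono3 0 0 n \<in> U \<Longrightarrow> r \<le> n"
    unfolding p_def q_def r_def by (auto intro: Least_le)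
  \<comment> \<open>Positive exponents keep the three pure powers distinct, as the later count of
    five monomials requires.\<close>
  have pos: "0 < p" "0 < q" "0 < r" using A \<open>0 \<notin> U\<close> by (auto intro: Nat.gr0I)
  have minA: "t = s" if "s \<in> ?A" "t \<in> U" "adds t s" for s t
  proof -
    have *: "t = mono3 (coef t Ind_x) (coef t Ind_y) (coef t Ind_z)" by (simp add: mono3_coef)
    from that(1) consider "s = mono3 p 0 0" | "s = mono3 0 q 0" | "s = mono3 0 0 r" by blast
    then show ?thesis
    proof cases
      case 1
      with that(3) have "coef t Ind_x \<le> p" "coef t Ind_y = 0" "coef t Ind_z = 0" by (auto simp: adds_iff all_indet)
      with * least(1) that(2) 1 show ?thesis by (metis le_antisym)
    next
      case 2
      with that(3) have "coef t Ind_x = 0" "coef t Ind_y \<le> q" "coef t Ind_z = 0" by (auto simp: adds_iff all_indet)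
      with * least(2) that(2) 2 show ?thesis by (metis le_antisym)
    next
      case 3
      with that(3) have "coef t Ind_x = 0" "coef t Ind_y = 0" "coef t Ind_z \<le> r" by (auto simp: adds_iff all_indet)
      with * least(3) that(2) 3 show ?thesis by (metis le_antisym)
    qed
  qed
  \<comment> \<open>A monomial of least degree among those of \<open>U\<close> not divisible by any
    member of \<open>B\<close> is minimal in \<open>U\<close>, because its divisors in
    \<open>U\<close> also avoid \<open>B\<close>.\<close>
  have extend: "\<exists>u\<in>U. (\<forall>s\<in>B. \<not> adds s u) \<and> (\<forall>t\<in>U. adds t u \<longrightarrow> t = u)"
    if nB: "\<not> (\<forall>t\<in>U. \<exists>s\<in>B. adds s t)" for B
  proof -
    let ?P = "\<lambda>t. t \<in> U \<and> (\<forall>s\<in>B. \<not> adds s t)"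
    from nB obtain u0 where "?P u0" by blast
    then obtain u where u: "?P u" "\<And>t. ?P t \<Longrightarrow> mdeg u \<le> mdeg t"
      using ex_has_least_nat[of ?P u0 mdeg] by blast
    have "t = u" if t: "t \<in> U" "adds t u" for t
    proof -
      have "?P t" using u(1) t adds_trans by blast
      then have "mdeg u \<le> mdeg t" by (rule u(2))
      moreover obtain w where "u = t + w" using t(2) by (auto simp: adds_def)
      ultimately have "w = 0" by (simp add: mdeg_add)
      with \<open>u = t + w\<close> show ?thesis by simp
    qed
    with u(1) show ?thesis by blast
  qed
  have "\<exists>u\<in>U. coef u Ind_x \<le> p \<and> coef u Ind_y \<le> q \<and> coef u Ind_z \<le> r \<and> (\<forall>t\<in>U. \<exists>s\<in>insert u ?A. adds s t)"
  proof (cases "\<forall>t\<in>U. \<exists>s\<in>?A. adds s t")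
    case True
    \<comment> \<open>If the pure powers suffice, one of them is repeated as the fourth monomial.
      This degenerate shape has vanishing exponents and a nonminimal cone, so it is excluded
      later.\<close>
    with A(1) show ?thesis by (intro bexI[of _ "mono3 p 0 0"]) auto
  next
    case False
    from extend[OF this] obtain u where u: "u \<in> U" "\<And>s. s \<in> ?A \<Longrightarrow> \<not> adds s u" "\<And>t. t \<in> U \<Longrightarrow> adds t u \<Longrightarrow> t = u"
      by blast
    have "\<forall>t\<in>U. \<exists>s\<in>insert u ?A. adds s t"
    proof (rule ccontr)
      assume "\<not> (\<forall>t\<in>U. \<exists>s\<in>insert u ?A. adds s t)"
      from extend[OF this] obtain v where v: "v \<in> U" "\<And>s. s \<in> insert u ?A \<Longrightarrow> \<not> adds s v"
        "\<And>t. t \<in> U \<Longrightarrow> adds t v \<Longrightarrow> t = v" by blast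
      have "v \<notin> insert u ?A" "u \<notin> ?A" using u(2) v(2) adds_refl by blast+
      then have "card (insert v (insert u ?A)) = 5" using pos by simp
      moreover have "card (insert v (insert u ?A)) \<le> length (a 1)"
      proof (rule card_minimal_monomials_le[OF ex J])
        show "t = s" if "s \<in> insert v (insert u ?A)" "t \<in> U" "adds t s" for s t
          using that u(3) v(3) minA by blast
      qed (use u(1) v(1) A in auto)
      ultimately show False using len by simp
    qed
    moreover have "\<not> adds (mono3 p 0 0) u" "\<not> adds (mono3 0 q 0) u" "\<not> adds (mono3 0 0 r) u" using u(2) by auto
    ultimately show ?thesis using u(1) by (intro bexI[of _ u]) (auto simp: adds_mono3_iff)
  qed
  then obtain u where u: "u \<in> U" "coef u Ind_x \<le> p" "coef u Ind_y \<le> q" "coef u Ind_z \<le> r"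
    "\<And>t. t \<in> U \<Longrightarrow> \<exists>s\<in>insert u ?A. adds s t" by blast
  \<comment> \<open>The bounds on the exponents of \<open>u\<close> make the natural subtractions
    exact.\<close>
  have E: "aci_exponents (coef u Ind_x) (coef u Ind_y) (coef u Ind_z) (p - coef u Ind_x) (q - coef u Ind_y) (r - coef u Ind_z)
    = insert u ?A"
    using u(2-4) by (simp add: aci_exponents_def mono3_coef)
  have "J = ideal_of (monomial ` insert u ?A)"
  proof (rule Set.set_eqI)
    fix h
    show "h \<in> J \<longleftrightarrow> h \<in> ideal_of (monomial ` insert u ?A)"
      unfolding J ideal_of_monomials using u(1,5) A up by blast
  qed
  then show ?thesis using that unfolding E[symmetric] by blast
qed


section \<open>Graded pieces and the Euler characteristic\<close>

text \<open>Rank-nullity on a finite-dimensional subspace of a possibly infinite-dimensional space: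
  a basis \<open>A\<close> of the kernel is extended to a basis \<open>B\<close>, and
  \<open>L\<close> is injective on the span of \<open>B - A\<close>.\<close>

lemma (in vector_space) dim_eq_dim_image_add_dim_kernel:
  assumes L: "Vector_Spaces.linear scale scale L"
    and V: "subspace V" "V \<subseteq> span W" "finite W"
  shows "dim V = dim (L ` V) + dim {v \<in> V. L v = 0}"
proof -
  interpret L: Vector_Spaces.linear scale scale L by (rule L)
  let ?K = "{v \<in> V. L v = 0}"
  obtain A where A: "A \<subseteq> ?K" "independent A" "?K \<subseteq> span A" "card A = dim ?K"
    using basis_exists[of ?K] by blast
  obtain B where B: "A \<subseteq> B" "B \<subseteq> V" "independent B" "V \<subseteq> span B"
    using maximal_independent_subset_extend[of A V] A by blast
  have finB: "finite B" using independent_span_bound[OF V(3) B(3)] B(2) V(2) by blast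
  let ?C = "B - A"
  have finC: "finite ?C" and finA: "finite A" using finB B(1) finite_subset by auto
  have spanB: "span B = V" using B V(1) by (simp add: span_minimal subset_antisym)
  have inj: "inj_on L (span ?C)"
    unfolding L.inj_on_iff_eq_0[OF subspace_span]
  proof (intro ballI impI)
    fix x assume x: "x \<in> span ?C" "L x = 0"
    then have "x \<in> ?K" using span_mono[of ?C B] spanB by auto
    then have "x \<in> span A" using A(3) by blast
    then obtain w where w: "x = (\<Sum>a\<in>A. w a *s a)" using span_finite[OF finA] by auto
    obtain u where u: "x = (\<Sum>c\<in>?C. u c *s c)" using x(1) span_finite[OF finC] by auto
    \<comment> \<open>The same \<open>x\<close> written over \<open>B - A\<close> and over
      \<open>A\<close> gives, after subtraction, a relation over the independent set
      \<open>B\<close>.\<close>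
    have "(\<Sum>b\<in>B. (if b \<in> A then - w b else u b) *s b)
      = (\<Sum>b\<in>?C. (if b \<in> A then - w b else u b) *s b) + (\<Sum>b\<in>A. (if b \<in> A then - w b else u b) *s b)"
      by (rule sum.subset_diff[OF B(1) finB])
    also have "(\<Sum>b\<in>?C. (if b \<in> A then - w b else u b) *s b) = x" unfolding u by (rule sum.cong) auto
    also have "(\<Sum>b\<in>A. (if b \<in> A then - w b else u b) *s b) = - x"
      unfolding w sum_negf[symmetric] by (rule sum.cong) auto
    finally have "(\<Sum>b\<in>B. (if b \<in> A then - w b else u b) *s b) = 0" by simp
    then have "(if b \<in> A then - w b else u b) = 0" if "b \<in> B" for b
      using independentD[OF B(3) finB order_refl, where u = "\<lambda>b. if b \<in> A then - w b else u b"] that by blast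
    then have "u c = 0" if "c \<in> ?C" for c using that by (metis DiffD1 DiffD2)
    then show "x = 0" unfolding u by simp
  qed
  have "dim (L ` V) = card (L ` ?C)"
  proof (rule dim_unique)
    show "L ` ?C \<subseteq> L ` V" using B(2) by blast
    show "independent (L ` ?C)"
      using L.independent_injective_image[OF independent_mono[OF B(3)] inj] by blast
    show "L ` V \<subseteq> span (L ` ?C)"
    proof
      fix y assume "y \<in> L ` V"
      then obtain x where x: "x \<in> V" "y = L x" by blast
      then obtain w where w: "x = (\<Sum>b\<in>B. w b *s b)" using span_finite[OF finB] spanB by auto
      have "y = (\<Sum>b\<in>B. w b *s L b)" unfolding x(2) w by (simp add: L.sum L.scale)
      also have "\<dots> \<in> span (L ` ?C)"
      proof (rule span_sum)
        fix b assume b: "b \<in> B"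
        show "w b *s L b \<in> span (L ` ?C)"
        proof (cases "b \<in> A")
          case True
          then have "L b = 0" using A(1) by blast
          then show ?thesis by (simp add: span_zero)
        next
          case False
          then show ?thesis using b by (intro span_scale span_base) blast
        qed
      qed
      finally show "y \<in> span (L ` ?C)" .
    qed
  qed simp
  also have "card (L ` ?C) = card ?C" using inj_on_subset[OF inj span_superset] by (rule card_image)
  finally have "dim (L ` V) + card A = card B"
    using card_Diff_subset[OF finA B(1)] card_mono[OF finB B(1)] by simp
  moreover have "dim V = card B" by (rule dim_unique[OF B(2,4,3)]) simp
  ultimately show ?thesis by (simp add: A(4))
qed

section \<open>Dimensions of graded pieces\<close>

definition kscale :: "'k::field \<Rightarrow> (nat \<Rightarrow> 'k poly3) \<Rightarrow> nat \<Rightarrow> 'k poly3" where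
  "kscale c v = (\<lambda>i. Poly_Mapping.single 0 c * v i)"

lemma kscale_apply [simp]: "kscale c v i = Poly_Mapping.single 0 c * v i"
  by (simp add: kscale_def)

interpretation kspace: vector_space "kscale :: 'k::field \<Rightarrow> _"
proof
  fix c d :: 'k and v w :: "nat \<Rightarrow> 'k poly3"
  show "kscale c (v + w) = kscale c v + kscale c w" by (simp add: fun_eq_iff distrib_left)
  show "kscale (c + d) v = kscale c v + kscale d v" by (simp add: fun_eq_iff single_add distrib_right)
  show "kscale c (kscale d v) = kscale (c * d) v"
    by (simp add: fun_eq_iff mult.assoc[symmetric] mult_single)
  show "kscale 1 v = v" by (simp add: fun_eq_iff)
qed

text \<open>Module elements are functions on \<open>nat\<close> vanishing beyond the rank, so that
  the graded pieces of all modules of a resolution lie in a single vector space.\<close>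

definition graded_piece :: "int list \<Rightarrow> int \<Rightarrow> (nat \<Rightarrow> 'k::field poly3) set" where
  "graded_piece a n = 
    {v. (\<forall>i<length a. homogeneous (n - a ! i) (v i)) \<and> (\<forall>i\<ge>length a. v i = 0)}"

definition hilb :: "int \<Rightarrow> nat" where
  "hilb m = card {t. int (mdeg t) = m}"

lemma mdeg_eq_image: "{t. int (mdeg t) = int n} = (\<lambda>(i, j). mono3 i j (n - i - j)) ` (SIGMA i:{..n}. {..n - i})"
proof (intro equalityI subsetI)
  fix t assume "t \<in> {t. int (mdeg t) = int n}"
  then have d: "coef t Ind_x + coef t Ind_y + coef t Ind_z = n" by (simp add: mdeg_expand)
  then have "n - coef t Ind_x - coef t Ind_y = coef t Ind_z" by linarith
  with d show "t \<in> (\<lambda>(i, j). mono3 i j (n - i - j)) ` (SIGMA i:{..n}. {..n - i})"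
    by (intro rev_image_eqI[of "(coef t Ind_x, coef t Ind_y)"]) (auto simp: mono3_coef)
qed auto

lemma finite_mdeg_eq [simp]: "finite {t. int (mdeg t) = m}"
proof (cases "m < 0")
  case True
  then have "{t. int (mdeg t) = m} = {}" by auto
  then show ?thesis by simp
next
  case False
  then obtain n where "m = int n" by (metis nonneg_int_cases not_less)
  then show ?thesis by (simp add: mdeg_eq_image del: of_nat_eq_iff)
qed

text \<open>The binomial coefficient \<open>n + 2\<close> over 2, doubled to avoid division.\<close>

lemma hilb_eq: "2 * int (hilb (int n)) = (int n + 1) * (int n + 2)"
proof -
  have "inj_on (\<lambda>(i, j). mono3 i j (n - i - j)) (SIGMA i:{..n}. {..n - i})" by (auto simp: inj_on_def)
  then have "hilb (int n) = card (SIGMA i:{..n}. {..n - i})"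
    unfolding hilb_def mdeg_eq_image by (rule card_image)
  also have "\<dots> = (\<Sum>i\<le>n. Suc (n - i))" by simp
  also have "\<dots> = (\<Sum>i\<le>n. Suc i)" by (rule sum.nat_diff_reindex[of "\<lambda>i. Suc i" "Suc n", unfolded lessThan_Suc_atMost, simplified])
  finally have h: "hilb (int n) = (\<Sum>i\<le>n. Suc i)" .
  show ?thesis unfolding h by (induction n) (auto simp: algebra_simps)
qed

lemma sum_fun_apply: "(\<Sum>x\<in>A. f x) i = (\<Sum>x\<in>A. f x i)"
  by (induction A rule: infinite_finite_induct) auto

definition unit_fun :: "nat \<times> monom3 \<Rightarrow> nat \<Rightarrow> 'k::field poly3" where
  "unit_fun p = (\<lambda>i. if i = fst p then monomial (snd p) else 0)"

definition graded_basis :: "int list \<Rightarrow> int \<Rightarrow> (nat \<times> monom3) set" where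
  "graded_basis a n = (SIGMA j:{..<length a}. {t. int (mdeg t) = n - a ! j})"

lemma finite_graded_basis [simp]: "finite (graded_basis a n)"
  by (simp add: graded_basis_def)

lemma coef_unit_fun: "coef (unit_fun p i :: 'k::field poly3) t = (if p = (i, t) then 1 else 0)"
  by (cases p) (auto simp: unit_fun_def coef_monomial)

lemma inj_unit_fun: "inj (unit_fun :: _ \<Rightarrow> _ \<Rightarrow> 'k::field poly3)"
proof (rule injI)
  fix p q assume e: "(unit_fun p :: nat \<Rightarrow> 'k poly3) = unit_fun q"
  have "coef (unit_fun p (fst p) :: 'k poly3) (snd p) = coef (unit_fun q (fst p) :: 'k poly3) (snd p)"
    by (simp only: e)
  then show "p = q" by (auto simp: coef_unit_fun split: if_splits)
qed

lemma coef_sum_unit_fun: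
  assumes "finite B"
  shows "coef ((\<Sum>p\<in>B. kscale (w p) (unit_fun p)) i) t = (if (i, t) \<in> B then w (i, t) else (0 :: 'k::field))"
proof -
  have "coef ((\<Sum>p\<in>B. kscale (w p) (unit_fun p)) i) t = (\<Sum>p\<in>B. if p = (i, t) then w p else 0)"
    by (simp add: sum_fun_apply lookup_sum coef_const_times coef_unit_fun if_distrib cong: if_cong)
  also have "\<dots> = (if (i, t) \<in> B then w (i, t) else 0)" using assms by simp
  finally show ?thesis .
qed

text \<open>The basis consists of unit vectors times monomials of the complementary degree. The
  spanning statement supplies the finite dimension needed for rank-nullity.\<close>

lemma graded_piece_basis:
  fixes a :: "int list"
  shows "kspace.dim (graded_piece a n :: (nat \<Rightarrow> 'k::field poly3) set) = (\<Sum>j<length a. hilb (n - a ! j))"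
    and "kspace.subspace (graded_piece a n :: (nat \<Rightarrow> 'k poly3) set)"
    and "(graded_piece a n :: (nat \<Rightarrow> 'k poly3) set) \<subseteq> kspace.span (unit_fun ` graded_basis a n)"
proof -
  let ?G = "graded_piece a n :: (nat \<Rightarrow> 'k poly3) set" and ?B = "unit_fun ` graded_basis a n :: (nat \<Rightarrow> 'k poly3) set"
  have hs: "homogeneous m (Poly_Mapping.single 0 c * h)" if "homogeneous m h" for m c and h :: "'k poly3"
    using that by (auto simp: homogeneous_def in_keys_iff coef_const_times)
  show sub: "kspace.subspace ?G"
    unfolding kspace.subspace_def graded_piece_def
    by (auto simp: homogeneous_add hs)
  have sumB: "(\<Sum>v\<in>?B. kscale (u v) v) = (\<Sum>p\<in>graded_basis a n. kscale (u (unit_fun p)) (unit_fun p))" for u :: "_ \<Rightarrow> 'k"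
    using inj_on_subset[OF inj_unit_fun] by (subst sum.reindex) auto
  have "v \<in> kspace.span ?B" if v: "v \<in> ?G" for v
  proof -
    have "v = (\<Sum>p\<in>graded_basis a n. kscale (coef (v (fst p)) (snd p)) (unit_fun p))"
    proof (intro ext poly_mapping_eqI)
      fix i t
      have "coef (v i) t = 0" if "(i, t) \<notin> graded_basis a n"
      proof (cases "i < length a")
        case True
        then have "homogeneous (n - a ! i) (v i)" using v by (auto simp: graded_piece_def)
        with True that show ?thesis by (auto simp: homogeneous_def graded_basis_def in_keys_iff)
      next
        case False
        then show ?thesis using v by (auto simp: graded_piece_def)
      qed
      then show "coef (v i) t = coef ((\<Sum>p\<in>graded_basis a n. kscale (coef (v (fst p)) (snd p)) (unit_fun p)) i) t"
        by (simp add: coef_sum_unit_fun)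
    qed
    also have "\<dots> \<in> kspace.span ?B"
      by (intro kspace.span_sum kspace.span_scale kspace.span_base) auto
    finally show ?thesis .
  qed
  then show span: "?G \<subseteq> kspace.span ?B" by blast
  have indep: "kspace.independent ?B"
  proof (rule kspace.independent_if_scalars_zero)
    fix u :: "_ \<Rightarrow> 'k" and v assume 0: "(\<Sum>v\<in>?B. kscale (u v) v) = 0" and "v \<in> ?B"
    then obtain i t where it: "(i, t) \<in> graded_basis a n" "v = unit_fun (i, t)" by auto
    have "coef ((\<Sum>v\<in>?B. kscale (u v) v) i) t = u v"
      unfolding sumB by (simp add: coef_sum_unit_fun it)
    then show "u v = 0" by (simp add: 0)
  qed simp
  have "?B \<subseteq> ?G"
    by (auto simp: graded_piece_def graded_basis_def unit_fun_def intro!: homogeneous_monomial[OF sym])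
  then have "kspace.dim ?G = card ?B" by (rule kspace.dim_unique[OF _ span indep]) simp
  also have "\<dots> = card (graded_basis a n)" using inj_on_subset[OF inj_unit_fun] by (intro card_image) auto
  also have "\<dots> = (\<Sum>j<length a. hilb (n - a ! j))"
    unfolding graded_basis_def hilb_def by (rule card_SigmaI) simp_all
  finally show "kspace.dim ?G = (\<Sum>j<length a. hilb (n - a ! j))" .
qed

section \<open>Exactness in a single degree\<close>

definition mat_fun :: "'k::field poly3 mat \<Rightarrow> (nat \<Rightarrow> 'k poly3) \<Rightarrow> nat \<Rightarrow> 'k poly3" where
  "mat_fun M v = (\<lambda>i. if i < dim_row M then \<Sum>k<dim_col M. M $$ (i, k) * v k else 0)"

lemma linear_mat_fun: "Vector_Spaces.linear kscale kscale (mat_fun M)"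
proof
  show "mat_fun M (v + w) = mat_fun M v + mat_fun M w" for v w
    by (auto simp: mat_fun_def fun_eq_iff distrib_left sum.distrib)
  show "mat_fun M (kscale c v) = kscale c (mat_fun M v)" for c v
  proof
    fix i
    have "(\<Sum>k<dim_col M. M $$ (i, k) * (Poly_Mapping.single 0 c * v k))
      = Poly_Mapping.single 0 c * (\<Sum>k<dim_col M. M $$ (i, k) * v k)"
      by (subst sum_distrib_left) (rule sum.cong[OF refl], rule mult.left_commute)
    then show "mat_fun M (kscale c v) i = kscale c (mat_fun M v) i" by (simp add: mat_fun_def)
  qed
qed

text \<open>An element of degree \<open>n\<close> is a graded map from \<open>R(-n)\<close>, that
  is, a graded one-column matrix; lifting lemmas for graded maps thereby apply to elements.\<close>

definition col_mat :: "int list \<Rightarrow> (nat \<Rightarrow> 'k::field poly3) \<Rightarrow> 'k poly3 mat" where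
  "col_mat a v = mat (length a) 1 (\<lambda>(i, _). v i)"

lemma graded_piece_iff: "v \<in> graded_piece a n \<longleftrightarrow> graded_map [n] a (col_mat a v) \<and> (\<forall>i\<ge>length a. v i = 0)"
  by (auto simp: graded_piece_def graded_map_def col_mat_def)

lemma col_mat_mat_fun:
  assumes "M \<in> carrier_mat (length a) (length b)"
  shows "col_mat a (mat_fun M v) = M * col_mat b v"
  using assms by (intro eq_matI) (auto simp: col_mat_def mat_fun_def scalar_prod_def lessThan_atLeast0)

lemma mat_fun_graded_piece:
  assumes M: "graded_map b a M" and v: "v \<in> graded_piece b n"
  shows "mat_fun M v \<in> graded_piece a n"
  using graded_map_mult[OF M, of "[n]" "col_mat b v"] v graded_mapD(1)[OF M]
  by (simp add: graded_piece_iff col_mat_mat_fun) (simp add: mat_fun_def)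

lemma graded_piece_eqI:
  assumes "v \<in> graded_piece a n" "w \<in> graded_piece a n" "col_mat a v = col_mat a w"
  shows "v = w"
proof
  fix i
  show "v i = w i"
  proof (cases "i < length a")
    case True
    then have "col_mat a v $$ (i, 0) = v i" "col_mat a w $$ (i, 0) = w i" by (simp_all add: col_mat_def)
    then show ?thesis by (simp add: assms(3))
  next
    case False
    then show ?thesis using assms by (simp add: graded_piece_iff)
  qed
qed

lemma col_mat_surj:
  assumes "graded_map [n] a X"
  obtains v where "v \<in> graded_piece a n" "X = col_mat a v"
proof -
  let ?v = "\<lambda>i. if i < length a then X $$ (i, 0) else 0"
  have "X = col_mat a ?v" using graded_mapD(1)[OF assms] by (intro eq_matI) (auto simp: col_mat_def)
  moreover from this have "?v \<in> graded_piece a n" using assms by (auto simp: graded_piece_iff)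
  ultimately show ?thesis using that by blast
qed

lemma graded_piece_exact:
  assumes ex: "exact_complex I a M"
  shows "mat_fun (M (Suc i)) ` graded_piece (a (Suc (Suc i))) n
    = {v \<in> graded_piece (a (Suc i)) n. mat_fun (M i) v = 0}"
proof (intro equalityI subsetI)
  note gr = exact_complexD(1)[OF ex] and Mc = exact_complexD(2)[OF ex]
  have 0: "mat_fun (M i) v = 0 \<longleftrightarrow> M i * col_mat (a (Suc i)) v = 0\<^sub>m (length (a i)) (length [n])"
    if v: "v \<in> graded_piece (a (Suc i)) n" for v
  proof -
    have "mat_fun (M i) v = 0 \<longleftrightarrow> col_mat (a i) (mat_fun (M i) v) = col_mat (a i) 0"
      using graded_piece_eqI[OF mat_fun_graded_piece[OF gr v], of 0] by (auto simp: graded_piece_def)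
    also have "col_mat (a i) 0 = 0\<^sub>m (length (a i)) (length [n])" by (intro eq_matI) (auto simp: col_mat_def)
    finally show ?thesis by (simp only: col_mat_mat_fun[OF Mc])
  qed
  {
    fix v assume "v \<in> mat_fun (M (Suc i)) ` graded_piece (a (Suc (Suc i))) n"
    then obtain w where w: "w \<in> graded_piece (a (Suc (Suc i))) n" "v = mat_fun (M (Suc i)) w" by blast
    have v: "v \<in> graded_piece (a (Suc i)) n" unfolding w(2) by (rule mat_fun_graded_piece[OF gr w(1)])
    have wc: "col_mat (a (Suc (Suc i))) w \<in> carrier_mat (length (a (Suc (Suc i)))) (length [n])"
      by (simp add: col_mat_def)
    have "M i * col_mat (a (Suc i)) v = M i * M (Suc i) * col_mat (a (Suc (Suc i))) w"
      unfolding w(2) col_mat_mat_fun[OF Mc] by (rule assoc_mult_mat[symmetric, OF Mc Mc wc])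
    also have "\<dots> = 0\<^sub>m (length (a i)) (length [n])"
      using wc by (simp add: exact_complex_square_zero[OF ex])
    finally show "v \<in> {v \<in> graded_piece (a (Suc i)) n. mat_fun (M i) v = 0}" using v 0[OF v] by simp
  next
    fix v assume "v \<in> {v \<in> graded_piece (a (Suc i)) n. mat_fun (M i) v = 0}"
    then have v: "v \<in> graded_piece (a (Suc i)) n" and z: "M i * col_mat (a (Suc i)) v = 0\<^sub>m (length (a i)) (length [n])"
      using 0 by auto
    have "graded_map [n] (a (Suc i)) (col_mat (a (Suc i)) v)" using v by (simp add: graded_piece_iff)
    from exact_complex_lift[OF ex this z] obtain Y where
      Y: "graded_map [n] (a (Suc (Suc i))) Y" "col_mat (a (Suc i)) v = M (Suc i) * Y" by blast
    obtain w where w: "w \<in> graded_piece (a (Suc (Suc i))) n" "Y = col_mat (a (Suc (Suc i))) w"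
      by (rule col_mat_surj[OF Y(1)])
    have "v = mat_fun (M (Suc i)) w"
      by (rule graded_piece_eqI[OF v mat_fun_graded_piece[OF gr w(1)]])
        (simp only: Y(2) w(2) col_mat_mat_fun[OF Mc])
    with w(1) show "v \<in> mat_fun (M (Suc i)) ` graded_piece (a (Suc (Suc i))) n" by blast
  }
qed

text \<open>The assumption on \<open>I\<close> says that \<open>R/I\<close> is zero in degree
  \<open>n\<close>.\<close>

lemma graded_piece_surj:
  fixes I :: "'k::field poly3 set"
  assumes ex: "exact_complex I a M" and I: "\<And>f. homogeneous n f \<Longrightarrow> f \<in> I"
  shows "mat_fun (M 0) ` graded_piece (a (Suc 0)) n = graded_piece (a 0) n"
proof (intro equalityI subsetI)
  note gr = exact_complexD(1)[OF ex] and Mc = exact_complexD(2)[OF ex]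
  fix v :: "nat \<Rightarrow> 'k poly3" assume v: "v \<in> graded_piece (a 0) n"
  have a0: "a 0 = [0]" by (rule exact_complexD(4)[OF ex])
  have vg: "graded_map [n] (a 0) (col_mat (a 0) v)" using v by (simp add: graded_piece_iff)
  have "col (col_mat (a 0) v) 0 \<in> mat_image (M 0)"
  proof -
    have "homogeneous n (v 0)" using v by (auto simp: graded_piece_def a0 split: if_splits)
    then have "v 0 \<in> I" by (rule I)
    then show ?thesis using ex by (simp add: exact_complex_def a0 col_mat_def col_def)
  qed
  then obtain Y where Y: "graded_map [n] (a (Suc 0)) Y" "col_mat (a 0) v = M 0 * Y"
    using graded_lift[OF gr vg] by auto
  obtain w where w: "w \<in> graded_piece (a (Suc 0)) n" "Y = col_mat (a (Suc 0)) w"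
    by (rule col_mat_surj[OF Y(1)])
  have "v = mat_fun (M 0) w"
    by (rule graded_piece_eqI[OF v mat_fun_graded_piece[OF gr w(1)]])
      (simp only: Y(2) w(2) col_mat_mat_fun[OF Mc])
  with w(1) show "v \<in> mat_fun (M 0) ` graded_piece (a (Suc 0)) n" by blast
qed (use mat_fun_graded_piece[OF exact_complexD(1)[OF ex]] in blast)

definition hilb_list :: "int list \<Rightarrow> int \<Rightarrow> nat" where
  "hilb_list a n = (\<Sum>j<length a. hilb (n - a ! j))"

text \<open>Rank-nullity for the first three maps, with images identified with kernels, makes the
  alternating sum of dimensions vanish. It is arranged with positive terms on both sides because the
  values are natural numbers.\<close>

lemma euler_characteristic:
  fixes I :: "'k::field poly3 set"
  assumes ex: "exact_complex I a M" and I: "\<And>f. homogeneous n f \<Longrightarrow> f \<in> I" and a4: "a 4 = []"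
  shows "hilb_list (a 1) n + hilb_list (a 3) n = hilb_list (a 0) n + hilb_list (a 2) n"
proof -
  let ?G = "\<lambda>i. graded_piece (a i) n :: (nat \<Rightarrow> 'k poly3) set" and ?K = "\<lambda>i. {v \<in> graded_piece (a (Suc i)) n. mat_fun (M i) v = 0}"
  have dimG: "kspace.dim (?G i) = hilb_list (a i) n" for i
    unfolding hilb_list_def by (rule graded_piece_basis(1))
  have rn: "hilb_list (a (Suc i)) n = kspace.dim (mat_fun (M i) ` ?G (Suc i)) + kspace.dim (?K i)" for i
    using kspace.dim_eq_dim_image_add_dim_kernel[OF linear_mat_fun[of "M i"] graded_piece_basis(2,3), of "a (Suc i)" n]
    by (simp add: dimG)
  have e: "mat_fun (M (Suc i)) ` ?G (Suc (Suc i)) = ?K i" for i by (rule graded_piece_exact[OF ex])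
  \<comment> \<open>The module in position 4 is zero, so the last map is injective.\<close>
  have "?K 2 = mat_fun (M 3) ` ?G 4" using e[of 2] by (simp add: eval_nat_numeral)
  also have "?G 4 = {0}" by (auto simp: graded_piece_def a4 fun_eq_iff)
  also have "mat_fun (M 3) ` {0} = {0}" by (auto simp: mat_fun_def fun_eq_iff)
  finally have "kspace.dim (?K 2) = kspace.dim ({0} :: (nat \<Rightarrow> 'k poly3) set)" by (rule arg_cong)
  also have "\<dots> = 0"
    by (rule kspace.dim_unique[of "{}"]) (simp_all add: kspace.span_empty kspace.independent_empty)
  finally have K2: "kspace.dim (?K 2) = 0" .
  show ?thesis
    using rn[of 0] rn[of 1] rn[of 2] e[of 0] e[of 1] K2 dimG[of 0] graded_piece_surj[OF ex I]
    by (simp add: eval_nat_numeral)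
qed


section \<open>Degree bookkeeping\<close>

text \<open>A monomial of degree at least \<open>p + q + r\<close> is divisible by one of the pure
  powers \<open>x^p\<close>, \<open>y^q\<close>, \<open>z^r\<close> in \<open>I\<close>.\<close>

lemma artinian_contains_high_degrees:
  fixes I :: "'k::field poly3 set"
  assumes I: "is_ideal I" and art: "artinian_quotient I" and ex: "exact_complex I a M"
  obtains N where "\<And>n f. int N \<le> n \<Longrightarrow> homogeneous n f \<Longrightarrow> f \<in> I"
proof -
  note pow = artinian_homogeneous_contains_power[OF I art exact_complex_hcomp_mem[OF ex]]
  obtain p where p: "monomial (mono3 p 0 0) \<in> I" using pow[of Ind_x] by (auto simp: single_eq_mono3)
  obtain q where q: "monomial (mono3 0 q 0) \<in> I" using pow[of Ind_y] by (auto simp: single_eq_mono3)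
  obtain r where r: "monomial (mono3 0 0 r) \<in> I" using pow[of Ind_z] by (auto simp: single_eq_mono3)
  have "f \<in> I" if n: "int (p + q + r) \<le> n" and f: "homogeneous n f" for n f
  proof (rule mem_if_monomials_mem[OF I])
    fix t assume "t \<in> supp f"
    then have "int (mdeg t) = n" using f by (simp add: homogeneous_def)
    then have "p + q + r \<le> coef t Ind_x + coef t Ind_y + coef t Ind_z" using n by (simp add: mdeg_expand)
    then have "p \<le> coef t Ind_x \<or> q \<le> coef t Ind_y \<or> r \<le> coef t Ind_z" by linarith
    then show "monomial t \<in> I"
      using monomial_mem_if_adds[OF I p, of t] monomial_mem_if_adds[OF I q, of t] monomial_mem_if_adds[OF I r, of t]
      by (auto simp: adds_mono3_iff)
  qed
  then show ?thesis by (rule that)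
qed

lemma hilb_diff: "0 \<le> m \<Longrightarrow> int (hilb (m + 1)) = int (hilb m) + m + 2"
  using hilb_eq[of "nat m"] hilb_eq[of "nat (m + 1)"] by (simp add: algebra_simps)

text \<open>Subtracting the Euler identities in degrees \<open>n\<close> and \<open>n + 1\<close>
  leaves a term \<open>n - x + 2\<close> for each shift \<open>x\<close>. The ranks satisfy
  \<open>1 - 4 + 6 - 3 = 0\<close>, so the alternating sum of the shifts vanishes, which is twice
  the claimed relation.\<close>

lemma aci_degree_sum:
  fixes I :: "'k::field poly3 set"
  assumes I: "is_ideal I" and art: "artinian_quotient I"
    and res: "graded_free_resolution I
      [[0], [u, d1, d2, d3], [d1 + d2, d1 + d3, d2 + d3, s1, s2, s3], [w - s1, w - s2, w - s3]] Ms"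
    and w: "w = d1 + d2 + d3 + u"
  shows "s1 + s2 + s3 = 2 * u + d1 + d2 + d3"
proof -
  let ?as = "[[0], [u, d1, d2, d3], [d1 + d2, d1 + d3, d2 + d3, s1, s2, s3], [w - s1, w - s2, w - s3]]"
  let ?a = "\<lambda>i. if i < length ?as then ?as ! i else []"
  note ex = exact_complex_pad[OF res]
  obtain N where N: "\<And>n f. int N \<le> n \<Longrightarrow> homogeneous n f \<Longrightarrow> f \<in> I"
    using artinian_contains_high_degrees[OF I art ex] by blast
  define xs where "xs = [0, u, d1, d2, d3, w - s1, w - s2, w - s3, d1 + d2, d1 + d3, d2 + d3, s1, s2, s3]"
  \<comment> \<open>All \<open>n - x\<close> with \<open>x\<close> a shift are nonnegative, where
    first differences of \<open>hilb\<close> are linear. The entry 0 of \<open>xs\<close> makes the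
    maximum nonnegative, so \<open>R/I\<close> vanishes from degree \<open>n\<close> on.\<close>
  define n where "n = int N + Max (set xs)"
  have euler: "int (hilb (m - u)) + hilb (m - d1) + hilb (m - d2) + hilb (m - d3)
      + hilb (m - (w - s1)) + hilb (m - (w - s2)) + hilb (m - (w - s3))
    = hilb m + hilb (m - (d1 + d2)) + hilb (m - (d1 + d3)) + hilb (m - (d2 + d3))
      + hilb (m - s1) + hilb (m - s2) + hilb (m - s3)" if "int N \<le> m" for m
  proof -
    have "hilb_list (?a 1) m + hilb_list (?a 3) m = hilb_list (?a 0) m + hilb_list (?a 2) m"
      by (rule euler_characteristic[OF ex]) (use N[OF that] in auto)
    then show ?thesis
      unfolding of_nat_add[symmetric] of_nat_eq_iff
      by (simp add: hilb_list_def numeral_eq_Suc lessThan_Suc ac_simps)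
  qed
  have step: "int (hilb (n + 1 - x)) = int (hilb (n - x)) + (n - x) + 2" if "x \<le> n" for x
    using hilb_diff[of "n - x"] that by (simp add: algebra_simps)
  have xs: "x \<le> n" if "x \<in> set xs" for x
  proof -
    have "x \<le> Max (set xs)" using that by (intro Max_ge) simp_all
    then show ?thesis by (simp add: n_def)
  qed
  have "0 \<le> Max (set xs)" by (rule Max_ge) (simp_all add: xs_def)
  then have N: "int N \<le> n" "int N \<le> n + 1" by (simp_all add: n_def)
  have "int (hilb (n + 1)) = int (hilb n) + n + 2" using step[OF xs, of 0] by (simp add: xs_def)
  moreover have "u \<in> set xs" "d1 \<in> set xs" "d2 \<in> set xs" "d3 \<in> set xs" "w - s1 \<in> set xs" "w - s2 \<in> set xs"
    "w - s3 \<in> set xs" "d1 + d2 \<in> set xs" "d1 + d3 \<in> set xs" "d2 + d3 \<in> set xs"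
    "s1 \<in> set xs" "s2 \<in> set xs" "s3 \<in> set xs" by (simp_all add: xs_def)
  note steps = this[THEN xs, THEN step]
  ultimately show ?thesis
    using euler[OF N(1)] euler[OF N(2), unfolded steps] w by linarith
qed

lemma mset_eq_three:
  assumes "mset [x, y, z] = mset [u, v, w]"
  shows "x = u \<and> y = v \<and> z = w \<or> x = u \<and> y = w \<and> z = v \<or> x = v \<and> y = u \<and> z = w \<or>
    x = v \<and> y = w \<and> z = u \<or> x = w \<and> y = u \<and> z = v \<or> x = w \<and> y = v \<and> z = u"
  using assms by (auto simp: add_eq_conv_ex)

text \<open>The matching of \<open>p, q, r\<close> with the \<open>d\<close> and of
  \<open>e, f, g\<close> with the \<open>s\<close> may use different permutations. The bounds
  survive because termwise inequalities between two lists persist when each list is sorted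
  separately.\<close>

lemma aci_degree_matching:
  fixes m p q r e f g u d1 d2 d3 s1 s2 s3 w :: int
  assumes F1: "mset [m, p, q, r] = mset [u, d1, d2, d3]"
    and F2: "mset [p + q, p + r, q + r, m + e, m + f, m + g] = mset [d1 + d2, d1 + d3, d2 + d3, s1, s2, s3]"
    and F3: "mset [p + q + r - e, p + q + r - f, p + q + r - g] = mset [w - s1, w - s2, w - s3]"
    and w: "w = d1 + d2 + d3 + u"
    and d: "d1 \<le> d2" "d2 \<le> d3" and s: "s1 \<le> s2" "s2 \<le> s3"
    and e: "0 < e" "e < p" "0 < f" "f < q" "0 < g" "g < r"
  shows "u < s1 \<and> s1 < u + d1 \<and> u < s2 \<and> s2 < u + d2 \<and> u < s3 \<and> s3 < u + d3"
proof -
  have sum: "m + p + q + r = w" using arg_cong[OF F1, of sum_mset] w by simp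
  \<comment> \<open>Reflection at the total degree \<open>w\<close> turns
    \<open>p + q + r - e\<close> into \<open>m + e\<close> and \<open>w - s1\<close> into
    \<open>s1\<close>.\<close>
  have "image_mset (\<lambda>x. w - x) (mset [p + q + r - e, p + q + r - f, p + q + r - g])
    = image_mset (\<lambda>x. w - x) (mset [w - s1, w - s2, w - s3])" by (simp only: F3)
  moreover have "w - (p + q + r - e) = m + e" "w - (p + q + r - f) = m + f" "w - (p + q + r - g) = m + g"
    using sum by simp_all
  ultimately have S: "mset [m + e, m + f, m + g] = mset [s1, s2, s3]" by simp
  have "mset [p + q, p + r, q + r] + mset [m + e, m + f, m + g]
    = mset [d1 + d2, d1 + d3, d2 + d3] + mset [s1, s2, s3]"
    using F2 by (simp only: mset_append[symmetric] append.simps)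
  then have "mset [p + q, p + r, q + r] = mset [d1 + d2, d1 + d3, d2 + d3]"
    unfolding S by (simp only: add_right_cancel)
  \<comment> \<open>Each of \<open>p\<close>, \<open>q\<close>, \<open>r\<close> occurs in two pair
    sums, so \<open>p + q + r = d1 + d2 + d3\<close>, and the total \<open>w\<close> leaves
    \<open>m = u\<close>.\<close>
  then have "sum_mset (mset [p + q, p + r, q + r]) = sum_mset (mset [d1 + d2, d1 + d3, d2 + d3])"
    by (simp only:)
  then have "m = u" using sum w by simp
  with F1 have "mset [p, q, r] = mset [d1, d2, d3]" by simp
  \<comment> \<open>Six permutations on either side give 36 cases of linear inequalities.\<close>
  from mset_eq_three[OF this] mset_eq_three[OF S] \<open>m = u\<close> d s e show ?thesis
    by (elim disjE conjE; simp)
qed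

section \<open>The two implications\<close>

lemma count_list_eq_imp_mset_eq: "(\<And>x. count_list xs x = count_list ys x) \<Longrightarrow> mset xs = mset ys"
  by (intro multiset_eqI) (simp add: count_mset)

text \<open>The generators have zero constant term, and so does every combination of them.\<close>

lemma minimal_complex_proper:
  assumes ex: "exact_complex I a M" and z: "const_mat (M 0) = 0\<^sub>m (length (a 0)) (length (a (Suc 0)))"
  shows "1 \<notin> I"
proof
  assume "1 \<in> I"
  then obtain v where v: "1 = (\<Sum>k<length (a 1). M 0 $$ (0, k) * v $ k)"
    using exact_complex_mem_iff[OF ex] by blast
  have c: "M 0 \<in> carrier_mat 1 (length (a 1))"
    using exact_complexD(2)[OF ex, of 0] exact_complexD(4)[OF ex] by simp
  have "coef (M 0 $$ (0, k)) 0 = 0" if "k < length (a 1)" for k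
  proof -
    have "coef (M 0 $$ (0, k)) 0 = const_mat (M 0) $$ (0, k)" using c that by simp
    then show ?thesis using that exact_complexD(4)[OF ex] by (simp add: z)
  qed
  then have "coef (\<Sum>k<length (a 1). M 0 $$ (0, k) * v $ k) 0 = 0"
    unfolding lookup_sum coef_times_zero by (intro sum.neutral) auto
  then show False unfolding v[symmetric] by (simp add: lookup_one)
qed

lemma minimal_resolution_proper:
  assumes "minimal_graded_free_resolution I as Ms"
  shows "1 \<notin> I"
proof -
  have "graded_free_resolution I as Ms" using assms by (simp add: minimal_graded_free_resolution_def)
  then show ?thesis
    by (rule minimal_complex_proper[OF exact_complex_pad]) (rule const_mat_pad[OF assms])
qed

lemma monomial_ideal_degrees_bounded:
  fixes J :: "'k::field poly3 set"
  assumes mon: "monomial_ideal J" and art: "artinian_quotient J"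
    and res: "minimal_graded_free_resolution J bs Ns"
    and counts: "\<And>i x. count_list (if i < length bs then bs ! i else []) x = count_list (if i < 4 then as ! i else []) x"
    and as: "as = [[0], [u, d1, d2, d3], [d1 + d2, d1 + d3, d2 + d3, s1, s2, s3], [w - s1, w - s2, w - s3]]"
    and w: "w = d1 + d2 + d3 + u"
    and d: "d1 \<le> d2" "d2 \<le> d3" and s: "s1 \<le> s2" "s2 \<le> s3"
  shows "u < s1 \<and> s1 < u + d1 \<and> u < s2 \<and> s2 < u + d2 \<and> u < s3 \<and> s3 < u + d3"
proof -
  let ?b = "\<lambda>i. if i < length bs then bs ! i else []"
  have gres: "graded_free_resolution J bs Ns" using res by (simp add: minimal_graded_free_resolution_def)
  have ms: "mset (?b i) = mset (if i < 4 then as ! i else [])" for i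
    by (rule count_list_eq_imp_mset_eq[OF counts])
  have lb: "length (?b i) = length (if i < 4 then as ! i else [])" for i
    by (rule mset_eq_length[OF ms])
  \<comment> \<open>Betti numbers do not record the length directly; it is fixed by the requirement
    that all listed modules be nonzero.\<close>
  have "\<not> 4 < length bs"
  proof
    assume "4 < length bs"
    then have "bs ! 4 = []" "bs ! 4 \<in> set bs" using lb[of 4] nth_mem[of 4 bs] by auto
    then show False using gres by (simp add: graded_free_resolution_def)
  qed
  moreover have "3 < length bs" using lb[of 3] by (auto simp: as split: if_splits)
  ultimately have lbs: "length bs = 4" by simp
  have b1: "length (?b 1) = 4" using lb[of 1] by (simp add: as)
  obtain a b c e f g where J: "J = ideal_of (monomial ` aci_exponents a b c e f g)"
    by (rule monomial_ideal_four_generators[OF mon art exact_complex_pad[OF gres] b1 minimal_resolution_proper[OF res]])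
  let ?cs = "aci_degrees a b c e f g"
  have lcs: "length ?cs = 4" by (simp add: aci_degrees_def)
  have cres: "graded_free_resolution J ?cs (aci_resolution a b c e f g)"
    unfolding J by (rule aci_resolution_is_resolution)
  \<comment> \<open>The cone has the ranks of the minimal resolution \<open>bs\<close>, hence is
    minimal, and this yields the positive exponents.\<close>
  have "map length bs = map length ?cs"
  proof (rule nth_equalityI)
    fix i assume "i < length (map length bs)"
    then have i: "i < 4" by (simp add: lbs)
    then have "i = 0 \<or> i = 1 \<or> i = 2 \<or> i = 3" by linarith
    then have "length (as ! i) = length (?cs ! i)" by (auto simp: as aci_degrees_def)
    then show "map length bs ! i = map length ?cs ! i"
      using lb[of i] i by (simp add: lbs lcs)
  qed (simp add: lbs lcs)
  then have cmin: "minimal_graded_free_resolution J ?cs (aci_resolution a b c e f g)"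
    by (rule minimal_resolution_same_lengths[OF res cres])
  then have pos: "0 < a" "0 < b" "0 < c" "0 < e" "0 < f" "0 < g"
    unfolding J aci_resolution_minimal_iff by auto
  have F: "mset (?cs ! i) = mset (as ! i)" if "i < 4" for i
  proof -
    have "mset (if i < length ?cs then ?cs ! i else []) = mset (?b i)"
      by (rule count_list_eq_imp_mset_eq) (rule minimal_resolution_count_eq[OF cmin res])
    then show ?thesis using ms[of i] that by (simp add: aci_degrees_def)
  qed
  show ?thesis
  proof (rule aci_degree_matching[OF _ _ _ w d s])
    show "mset [int (a + b + c), int (a + e), int (b + f), int (c + g)] = mset [u, d1, d2, d3]"
      using F[of 1] by (simp add: as aci_degrees_def)
    show "mset [int (a + e) + int (b + f), int (a + e) + int (c + g), int (b + f) + int (c + g),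
        int (a + b + c) + int e, int (a + b + c) + int f, int (a + b + c) + int g]
      = mset [d1 + d2, d1 + d3, d2 + d3, s1, s2, s3]"
      using F[of 2] by (simp add: as aci_degrees_def)
    have "mset [int (a + e) + int (b + f) + int (c + g) - int e, int (a + e) + int (b + f) + int (c + g) - int f,
        int (a + e) + int (b + f) + int (c + g) - int g] = mset (?cs ! 3)"
      by (simp add: aci_degrees_def algebra_simps)
    then show "mset [int (a + e) + int (b + f) + int (c + g) - int e, int (a + e) + int (b + f) + int (c + g) - int f,
        int (a + e) + int (b + f) + int (c + g) - int g] = mset [w - s1, w - s2, w - s3]"
      using F[of 3] by (simp add: as)
  qed (use pos in simp_all)
qed

lemma monomial_ideal_with_degrees_exists:
  fixes u d1 d2 d3 s1 s2 s3 w :: int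
  assumes sum: "s1 + s2 + s3 = 2 * u + d1 + d2 + d3" and w: "w = d1 + d2 + d3 + u"
    and bd: "u < s1" "s1 < u + d1" "u < s2" "s2 < u + d2" "u < s3" "s3 < u + d3"
  obtains J :: "'k::field poly3 set" and Ns where "monomial_ideal J" "artinian_quotient J"
    "minimal_graded_free_resolution J
      [[0], [u, d1, d2, d3], [d1 + d2, d1 + d3, d2 + d3, s1, s2, s3], [w - s1, w - s2, w - s3]] Ns"
proof -
  \<comment> \<open>The solution of \<open>a + e = d1\<close>, \<open>u + e = s1\<close> and their
    analogues; \<open>sum\<close> is then equivalent to \<open>a + b + c = u\<close>.\<close>
  define a b c e f g where "a = nat (d1 + u - s1)" and "b = nat (d2 + u - s2)" and "c = nat (d3 + u - s3)"
    and "e = nat (s1 - u)" and "f = nat (s2 - u)" and "g = nat (s3 - u)"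
  have i: "int a = d1 + u - s1" "int b = d2 + u - s2" "int c = d3 + u - s3"
    "int e = s1 - u" "int f = s2 - u" "int g = s3 - u"
    using bd by (simp_all add: a_def b_def c_def e_def f_def g_def)
  have pos: "0 < a \<and> 0 < b \<and> 0 < c \<and> 0 < e \<and> 0 < f \<and> 0 < g"
    using bd by (simp add: a_def b_def c_def e_def f_def g_def)
  let ?J = "ideal_of (monomial ` aci_exponents a b c e f g) :: 'k poly3 set"
  have "aci_degrees a b c e f g
    = [[0], [u, d1, d2, d3], [d1 + d2, d1 + d3, d2 + d3, s1, s2, s3], [w - s1, w - s2, w - s3]]"
    using sum w by (simp add: aci_degrees_def i)
  moreover have "minimal_graded_free_resolution ?J (aci_degrees a b c e f g) (aci_resolution a b c e f g)"
    unfolding aci_resolution_minimal_iff by (rule pos)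
  moreover have "monomial_ideal ?J" by (auto simp: monomial_ideal_def)
  moreover have "artinian_quotient ?J"
    by (rule artinian_if_cofinite_monomials, rule finite_not_adds[of "a + e" _ "b + f" "c + g"]) (simp_all add: aci_exponents_def)
  ultimately show ?thesis using that by metis
qed

theorem proposition4p15:
  fixes I :: "'k::field poly3 set"
    and d s :: "nat \<Rightarrow> int" and dstar dtot :: int
    and Ms :: "'k poly3 mat list"
  assumes "infinite (UNIV :: 'k set)"
    and "almost_complete_intersection3 I"
    and "has_last_rank I 3"
    and "minimal_graded_free_resolution I
          [[0],
           [dstar, d 1, d 2, d 3],
           [d 1 + d 2, d 1 + d 3, d 2 + d 3, s 1, s 2, s 3],
           [dtot - s 1, dtot - s 2, dtot - s 3]] Ms"
    and "dtot = d 1 + d 2 + d 3 + dstar"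
    and "d 1 \<le> d 2" and "d 2 \<le> d 3"
    and "s 1 \<le> s 2" and "s 2 \<le> s 3"
  shows "(\<exists>J :: 'k poly3 set. monomial_ideal J \<and> artinian_quotient J \<and>
             same_graded_betti_numbers I J)
         \<longleftrightarrow> (\<forall>i\<in>{1..3}. dstar < s i \<and> s i < dstar + d i)"
proof -
  let ?as = "[[0], [dstar, d 1, d 2, d 3], [d 1 + d 2, d 1 + d 3, d 2 + d 3, s 1, s 2, s 3],
    [dtot - s 1, dtot - s 2, dtot - s 3]]"
  have art: "artinian_quotient I" and I: "is_ideal I"
    using assms(2) by (auto simp: almost_complete_intersection3_def minimally_generates_def)
  have res: "graded_free_resolution I ?as Ms"
    using assms(4) by (simp add: minimal_graded_free_resolution_def)
  have "{1..3} = {1, 2, 3 :: nat}" by auto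
  then have bounds: "(\<forall>i\<in>{1..3}. dstar < s i \<and> s i < dstar + d i) \<longleftrightarrow>
    dstar < s 1 \<and> s 1 < dstar + d 1 \<and> dstar < s 2 \<and> s 2 < dstar + d 2 \<and> dstar < s 3 \<and> s 3 < dstar + d 3"
    by simp
  show ?thesis
    unfolding bounds
  proof
    assume "\<exists>J :: 'k poly3 set. monomial_ideal J \<and> artinian_quotient J \<and> same_graded_betti_numbers I J"
    then obtain J :: "'k poly3 set" and \<beta> where J: "monomial_ideal J" "artinian_quotient J"
      and \<beta>: "has_graded_betti_numbers I \<beta>" "has_graded_betti_numbers J \<beta>"
      by (auto simp: same_graded_betti_numbers_def)
    obtain cs Ks where cs: "minimal_graded_free_resolution I cs Ks"
      "\<And>i j. \<beta> i j = (if i < length cs then count_list (cs ! i) j else 0)"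
      using \<beta>(1) unfolding has_graded_betti_numbers_def by blast
    obtain bs Ns where bs: "minimal_graded_free_resolution J bs Ns"
      "\<And>i j. \<beta> i j = (if i < length bs then count_list (bs ! i) j else 0)"
      using \<beta>(2) unfolding has_graded_betti_numbers_def by blast
    \<comment> \<open>The Betti numbers \<open>\<beta>\<close> come from some resolution
      \<open>cs\<close> of \<open>I\<close>; uniqueness identifies them with the shifts of the given
      one.\<close>
    have "count_list (if i < length bs then bs ! i else []) x = count_list (if i < 4 then ?as ! i else []) x" for i x
    proof -
      have "count_list (if i < length bs then bs ! i else []) x = \<beta> i x" by (simp add: bs(2))
      also have "\<dots> = count_list (if i < length cs then cs ! i else []) x" by (simp add: cs(2))
      also have "\<dots> = count_list (if i < length ?as then ?as ! i else []) x"
        by (rule minimal_resolution_count_eq[OF cs(1) assms(4)])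
      finally show ?thesis by simp
    qed
    then show "dstar < s 1 \<and> s 1 < dstar + d 1 \<and> dstar < s 2 \<and> s 2 < dstar + d 2 \<and> dstar < s 3 \<and> s 3 < dstar + d 3"
      by (rule monomial_ideal_degrees_bounded[OF J bs(1) _ refl assms(5-9)])
  next
    assume bd: "dstar < s 1 \<and> s 1 < dstar + d 1 \<and> dstar < s 2 \<and> s 2 < dstar + d 2 \<and> dstar < s 3 \<and> s 3 < dstar + d 3"
    have "s 1 + s 2 + s 3 = 2 * dstar + d 1 + d 2 + d 3"
      by (rule aci_degree_sum[OF I art res assms(5)])
    then obtain J :: "'k poly3 set" and Ns where J: "monomial_ideal J" "artinian_quotient J"
      "minimal_graded_free_resolution J ?as Ns"
      by (rule monomial_ideal_with_degrees_exists[OF _ assms(5)]) (use bd in blast)+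
    let ?\<beta> = "\<lambda>i j. if i < length ?as then count_list (?as ! i) j else 0"
    have "has_graded_betti_numbers I ?\<beta>" "has_graded_betti_numbers J ?\<beta>"
      unfolding has_graded_betti_numbers_def using assms(4) J(3) by blast+
    with J show "\<exists>J :: 'k poly3 set. monomial_ideal J \<and> artinian_quotient J \<and> same_graded_betti_numbers I J"
      unfolding same_graded_betti_numbers_def by blast
  qed
qed

end
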